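(* Let ${\rm Airy}_{2\to1}(t)$, $t\in\mathbb R$, be the Airy$_{2\to1}$ process. For any $t_1<t_2<\dots<t_n$ and $x_1,\dots,x_n\in\mathbb R$, $$\mathbb P\Big(\bigcap_{k=1}^n\{{\rm Airy}_{2\to1}(t_k)\le x_k\}\Big)=\det\Big(I-K_{2\to1}^{t_1}+\bar P_{\tilde x_1}e^{(t_2-t_1)\Delta}\bar P_{\tilde x_2}\cdots e^{(t_n-t_{n-1})\Delta}\bar P_{\tilde x_n}e^{(t_1-t_n)\Delta}K_{2\to1}^{t_1}\Big)_{L^2(\mathbb R)},$$ where $\tilde x_i=x_i-(t_i^-)^2$ with $r^-=\min\{0,r\}$, $\bar P_af(x)=\mathbf 1_{x\le a}f(x)$, $K_{2\to1}^{t_1}(x,y)=K_{2\to1}^{\rm ext}(t_1,x+(t_1^-)^2;t_1,y+(t_1^-)^2)$, and $e^{(t_1-t_n)\Delta}K_{2\to1}^{t_1}$ denotes the operator with kernel $K_{2\to1}^{\rm ext}(t_n,x+(t_n^-)^2;t_1,y+(t_1^-)^2)$.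
   Context: The Airy$_{2\to1}$ process is the real-valued process with finite-dimensional distributions, for $t_1<\dots<t_n$, $$\mathbb P\Big(\bigcap_{k=1}^n\{{\rm Airy}_{2\to1}(t_k)\le x_k\}\Big)=\det\big(I-\chi K_{2\to1}^{\rm ext}\big)_{L^2(\{t_1,\dots,t_n\}\times\mathbb R)},\qquad \chi f(t_i,x)=\mathbf 1_{x\ge x_i}f(t_i,x),$$ where $$K_{2\to1}^{\rm ext}(s,x;t,y)=-\frac{\mathbf 1_{t>s}}{\sqrt{4\pi(t-s)}}\exp\Big(-\frac{(\tilde y-\tilde x)^2}{4(t-s)}\Big)+\frac1{(2\pi\mathrm i)^2}\int_{\gamma_+}dw\int_{\gamma_-}dz\,\frac{e^{w^3/3+tw^2-\tilde yw}}{e^{z^3/3+sz^2-\tilde xz}}\,\frac{2w}{(z-w)(z+w)},$$ with, in this formula, $\tilde x=x-(s^-)^2$, $\tilde y=y-(t^-)^2$, $r^-=\min\{0,r\}$. The contours are $\gamma_+$ from $e^{\mathrm i\phi_+}\infty$ to $e^{-\mathrm i\phi_+}\infty$ and $\gamma_-$ from $e^{-\mathrm i\phi_-}\infty$ to $e^{\mathrm i\phi_-}\infty$ with $\phi_+\in(\pi/3,\pi/2)$, $\phi_-\in(\pi/2,\pi-\phi_+)$, with $\gamma_-$ lying to the left of $\gamma_+$ and $-\gamma_+$ lying to the left of $\gamma_-$. The operator $K^{\rm ext}_{2\to1}$ acts by summation over $\{t_1,\dots,t_n\}$ and Lebesgue integration over $\mathbb R$. $\Delta=d^2/dx^2$ and,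 for $t>0$, $e^{t\Delta}$ is the heat operator with kernel $(4\pi t)^{-1/2}e^{-(x-y)^2/(4t)}$. Fredholm determinants $\det(I-A)$ are understood, where necessary, after conjugating $A$ by a multiplication operator so that it becomes trace class (which does not change the Fredholm expansion). *)

theory Defs
  imports "HOL-Probability.Probability" "Jordan_Normal_Form.Determinant"
begin

section \<open>Fredholm determinants\<close>

definition fredholm_minor :: "('a \<Rightarrow> 'a \<Rightarrow> complex) \<Rightarrow> nat \<Rightarrow> (nat \<Rightarrow> 'a) \<Rightarrow> complex" where
  "fredholm_minor A m x = Determinant.det (Matrix.mat m m (\<lambda>(i, j). A (x i) (x j)))"

text \<open>
  \<open>det(I - A)\<close> on the \<open>L\<^sup>2\<close> space of the measure \<open>\<mu>\<close>, for an integral operator with kernel \<open>A\<close>,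
  is given by its Fredholm expansion. Replacing \<open>A(x, y)\<close> by \<open>v(x) A(x, y) / v(y)\<close> with a
  nowhere vanishing \<open>v\<close> leaves every minor, hence the expansion, unchanged, so no conjugation has
  to be mentioned. \<open>fredholm_convergent\<close> says that the expansion converges absolutely;
  \<open>fredholm_det\<close> carries information only then.
\<close>

definition fredholm_convergent :: "'a measure \<Rightarrow> ('a \<Rightarrow> 'a \<Rightarrow> complex) \<Rightarrow> bool" where
  "fredholm_convergent \<mu> A \<longleftrightarrow>
     (\<forall>m. integrable (Pi\<^sub>M {..<m} (\<lambda>_. \<mu>)) (fredholm_minor A m)) \<and>
     summable (\<lambda>m. (\<integral>x. norm (fredholm_minor A m x) \<partial>Pi\<^sub>M {..<m} (\<lambda>_. \<mu>)) / fact m)"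

definition fredholm_det :: "'a measure \<Rightarrow> ('a \<Rightarrow> 'a \<Rightarrow> complex) \<Rightarrow> complex" where
  "fredholm_det \<mu> A =
     (\<Sum>m. (- 1) ^ m / fact m * (\<integral>x. fredholm_minor A m x \<partial>Pi\<^sub>M {..<m} (\<lambda>_. \<mu>)))"


section \<open>Contours\<close>

text \<open>
  A contour from \<open>e\<^sup>i\<^sup>\<alpha>\<infinity>\<close> to \<open>e\<^sup>i\<^sup>\<beta>\<infinity>\<close>: a piecewise \<open>C\<^sup>1\<close> curve, parametrised by the real line with
  bounded speed, whose two ends are (translated) rays in the directions \<open>\<alpha>\<close> and \<open>\<beta>\<close>.
\<close>

definition ray_contour :: "real \<Rightarrow> real \<Rightarrow> (real \<Rightarrow> complex) \<Rightarrow> bool" where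
  "ray_contour \<alpha> \<beta> \<gamma> \<longleftrightarrow>
     \<gamma> piecewise_C1_differentiable_on UNIV \<and>
     (\<exists>L. L-lipschitz_on UNIV \<gamma>) \<and>
     (\<exists>R c d. (\<forall>u \<le> - R. \<gamma> u = c + complex_of_real (- u) * cis \<alpha>) \<and>
              (\<forall>u \<ge> R. \<gamma> u = d + complex_of_real u * cis \<beta>))"

text \<open>
  The contours below meet every horizontal line; ``to the left'' means that on each such line all
  points of the first curve precede all points of the second.
\<close>

definition left_of :: "(real \<Rightarrow> complex) \<Rightarrow> (real \<Rightarrow> complex) \<Rightarrow> bool" where
  "left_of \<gamma> \<delta> \<longleftrightarrow> (\<forall>u v. Im (\<gamma> u) = Im (\<delta> v) \<longrightarrow> Re (\<gamma> u) < Re (\<delta> v))"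

definition airy21_contours :: "real \<Rightarrow> real \<Rightarrow> (real \<Rightarrow> complex) \<Rightarrow> (real \<Rightarrow> complex) \<Rightarrow> bool" where
  "airy21_contours \<phi>p \<phi>m \<gamma>p \<gamma>m \<longleftrightarrow>
     pi / 3 < \<phi>p \<and> \<phi>p < pi / 2 \<and> pi / 2 < \<phi>m \<and> \<phi>m < pi - \<phi>p \<and>
     ray_contour \<phi>p (- \<phi>p) \<gamma>p \<and> ray_contour (- \<phi>m) \<phi>m \<gamma>m \<and>
     left_of \<gamma>m \<gamma>p \<and> left_of (\<lambda>u. - \<gamma>p u) \<gamma>m"

definition line_integral :: "(real \<Rightarrow> complex) \<Rightarrow> (complex \<Rightarrow> complex) \<Rightarrow> complex" where
  "line_integral \<gamma> f = (\<integral>u. f (\<gamma> u) * vector_derivative \<gamma> (at u) \<partial>lborel)"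


section \<open>The kernel and the process\<close>

definition heat_kernel :: "real \<Rightarrow> real \<Rightarrow> real \<Rightarrow> real" where
  "heat_kernel r x y = exp (- ((x - y)\<^sup>2 / (4 * r))) / sqrt (4 * pi * r)"

text \<open>The shift \<open>(r\<^sup>-)\<^sup>2\<close>, where \<open>r\<^sup>- = min {0, r}\<close>.\<close>

definition neg_sq :: "real \<Rightarrow> real" where
  "neg_sq r = (min 0 r)\<^sup>2"

definition K21_ext ::
  "(real \<Rightarrow> complex) \<Rightarrow> (real \<Rightarrow> complex) \<Rightarrow> real \<Rightarrow> real \<Rightarrow> real \<Rightarrow> real \<Rightarrow> complex" where
  "K21_ext \<gamma>p \<gamma>m s x t y =
     (let x' = x - neg_sq s; y' = y - neg_sq t in
      - complex_of_real (if t > s then heat_kernel (t - s) x' y' else 0)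
      + 1 / (2 * complex_of_real pi * \<i>)\<^sup>2 *
        line_integral \<gamma>p (\<lambda>w. line_integral \<gamma>m (\<lambda>z.
          exp (w ^ 3 / 3 + complex_of_real t * w\<^sup>2 - complex_of_real y' * w)
          / exp (z ^ 3 / 3 + complex_of_real s * z\<^sup>2 - complex_of_real x' * z)
          * (2 * w / ((z - w) * (z + w))))))"

text \<open>
  The kernel of \<open>\<chi> K\<^sup>e\<^sup>x\<^sup>t\<close> on \<open>{t\<^sub>1, \<dots>, t\<^sub>n} \<times> \<real>\<close>, with the point \<open>t\<^sub>i\<close> represented by its index \<open>i\<close>.
\<close>

definition chi_K21_ext ::
  "(real \<Rightarrow> complex) \<Rightarrow> (real \<Rightarrow> complex) \<Rightarrow> (nat \<Rightarrow> real) \<Rightarrow> (nat \<Rightarrow> real)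
   \<Rightarrow> nat \<times> real \<Rightarrow> nat \<times> real \<Rightarrow> complex" where
  "chi_K21_ext \<gamma>p \<gamma>m t x =
     (\<lambda>(i, u) (j, v). if u \<ge> x i then K21_ext \<gamma>p \<gamma>m (t i) u (t j) v else 0)"

definition airy21_process ::
  "(real \<Rightarrow> complex) \<Rightarrow> (real \<Rightarrow> complex) \<Rightarrow> 'a measure \<Rightarrow> (real \<Rightarrow> 'a \<Rightarrow> real) \<Rightarrow> bool" where
  "airy21_process \<gamma>p \<gamma>m M X \<longleftrightarrow>
     prob_space M \<and> (\<forall>s. X s \<in> borel_measurable M) \<and>
     (\<forall>n t x. 1 \<le> n \<longrightarrow> strict_mono_on {1..n} t \<longrightarrow>
        complex_of_real (measure M {\<omega> \<in> space M. \<forall>k\<in>{1..n}. X (t k) \<omega> \<le> x k})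
        = fredholm_det (count_space {1..n} \<Otimes>\<^sub>M lborel) (chi_K21_ext \<gamma>p \<gamma>m t x))"


section \<open>The operators on the line\<close>

definition Pbar :: "real \<Rightarrow> (real \<Rightarrow> complex) \<Rightarrow> real \<Rightarrow> complex" where
  "Pbar a f x = (if x \<le> a then f x else 0)"

definition heat_op :: "real \<Rightarrow> (real \<Rightarrow> complex) \<Rightarrow> real \<Rightarrow> complex" where
  "heat_op r f x = (\<integral>y. complex_of_real (heat_kernel r x y) * f y \<partial>lborel)"

text \<open>
  The operator \<open>P\<^bsub>a\<^sub>1\<^esub> e\<^bsup>(t\<^sub>2-t\<^sub>1)\<Delta>\<^esup> P\<^bsub>a\<^sub>2\<^esub> \<cdots> e\<^bsup>(t\<^sub>n-t\<^sub>n\<^sub>-\<^sub>1)\<Delta>\<^esup> P\<^bsub>a\<^sub>n\<^esub>\<close>, with \<open>P\<^bsub>a\<^esub>\<close> standing for \<open>Pbar a\<close>.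
\<close>

definition path_op ::
  "(nat \<Rightarrow> real) \<Rightarrow> (nat \<Rightarrow> real) \<Rightarrow> nat \<Rightarrow> (real \<Rightarrow> complex) \<Rightarrow> real \<Rightarrow> complex" where
  "path_op t a n =
     Pbar (a 1) \<circ>
     foldr (\<lambda>k T. heat_op (t (Suc k) - t k) \<circ> Pbar (a (Suc k)) \<circ> T) [1..<n] id"

text \<open>
  In the variables \<open>x - (s\<^sup>-)\<^sup>2\<close>, \<open>y - (t\<^sup>-)\<^sup>2\<close>: for \<open>s = t = t\<^sub>1\<close> this is the kernel of \<open>K\<^bsup>t\<^sub>1\<^esup>\<close>, and for
  \<open>s = t\<^sub>n\<close>, \<open>t = t\<^sub>1\<close> it is the kernel that \<open>e\<^bsup>(t\<^sub>1-t\<^sub>n)\<Delta>\<^esup> K\<^bsup>t\<^sub>1\<^esup>\<close> stands for.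
\<close>

definition K21_shifted ::
  "(real \<Rightarrow> complex) \<Rightarrow> (real \<Rightarrow> complex) \<Rightarrow> real \<Rightarrow> real \<Rightarrow> real \<Rightarrow> real \<Rightarrow> complex" where
  "K21_shifted \<gamma>p \<gamma>m s t x y = K21_ext \<gamma>p \<gamma>m s (x + neg_sq s) t (y + neg_sq t)"

text \<open>
  A composition \<open>T L\<close> with an integral operator \<open>L\<close> has the kernel obtained by applying \<open>T\<close> to the
  kernel of \<open>L\<close> in its first variable. Below is the kernel of the operator that is subtracted from
  \<open>I\<close> in the path-integral formula.
\<close>

definition path_kernel ::
  "(real \<Rightarrow> complex) \<Rightarrow> (real \<Rightarrow> complex) \<Rightarrow> (nat \<Rightarrow> real) \<Rightarrow> (nat \<Rightarrow> real) \<Rightarrow> nat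
   \<Rightarrow> real \<Rightarrow> real \<Rightarrow> complex" where
  "path_kernel \<gamma>p \<gamma>m t x n u v =
     K21_shifted \<gamma>p \<gamma>m (t 1) (t 1) u v
     - path_op t (\<lambda>i. x i - neg_sq (t i)) n (\<lambda>u'. K21_shifted \<gamma>p \<gamma>m (t n) (t 1) u' v) u"

end

theory Submission
  imports Defs "Jordan_Normal_Form.Schur_Decomposition"
begin

text \<open>
  The extended kernel is \<open>\<chi>K = N + \<chi>kR\<close>, where \<open>N\<close> collects the heat kernels from row \<open>i\<close> to rows
  \<open>j > i\<close> and the double contour integral is factored through the variable \<open>w\<close> as \<open>k\<^sub>i R\<^sub>j\<close>. Since
  \<open>N\<close> is strictly upper triangular, row operations turn \<open>I - N - \<chi>kR\<close> into \<open>I - \<phi>R\<close> with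
  \<open>\<phi> = (I - N)\<^sup>-\<^sup>1\<chi>k\<close> without changing the determinant. Then \<open>det(I - \<phi>R) = det(I - R\<phi>)\<close> on the
  contour, and \<open>R\<phi> = \<Sum>\<^sub>j R\<^sub>1 e\<^bsup>(t\<^sub>j-t\<^sub>1)\<Delta>\<^esup> \<phi>\<^sub>j = R\<^sub>1 P\<close>, where \<open>P R\<^sub>1\<close> is the path kernel; a second
  exchange of the factors ends the proof.

  No trace class theory is used. All kernels satisfy \<open>|A(x, y)| \<le> C f(x) g(y)\<close> for weights with
  \<open>\<integral> f g < \<infinity>\<close>, so that Hadamard's bound makes the expansions converge. Expanding a minor along a row
  shows that the Fredholm coefficients are polynomials in the traces \<open>tr A\<^sup>k\<close>, hence
  \<open>det(I - PR) = det(I - RP)\<close>. Multiplication of \<open>I - A\<close> by \<open>I - E\<close> with \<open>E\<^sup>2 = 0\<close>, \<open>tr E = 0\<close> leaves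
  the determinant unchanged because its derivative along a segment telescopes.
\<close>

section \<open>Hadamard's determinant bound\<close>

text \<open>The obstacle is domination at both ends of the line. At +infinity \<open>k\<close> has
  size e^(a u) with a \<ge> Re z on the left contour and \<open>R\<close> has size e^(-b u) with b
  \<le> Re w on the right one. The product is integrable there only if a < b, while the contours are
  merely ordered on each horizontal line; hence the right contour is translated to the right, which
  meets no pole. At -infinity \<open>k\<close> alone grows like a Gaussian, since Re z is unbounded
  below. The path kernel is small there only by cancellation: with each \<open>Pbar\<close> written
  as I minus a cutoff, the semigroup law turns e^((t_n - t_1)\<Delta>) k_n into k_1, which cancels,
  and what remains are heat evolutions of functions cut off from below. These decay like a Gaussian,
  faster than \<open>R\<close> grows. The rates are tied to t_n - t_1, because a heat kernel of time
  r tolerates Gaussian weights only up to a coefficient of order 1/r. No backward heat operator is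
  ever applied: the kernel that e^((t_1 - t_n)\<Delta>) K stands for is k_n R_1, and the forward
  identity e^(r\<Delta>) k_(s+r) = k_s suffices.\<close>

lemma norm_det_le:
  fixes A :: "complex mat"
  assumes A: "A \<in> carrier_mat m m"
    and bd: "\<And>i j. i < m \<Longrightarrow> j < m \<Longrightarrow> norm (A $$ (i, j)) \<le> 1"
  shows "norm (Determinant.det A) \<le> sqrt (real m) ^ m"
proof (cases "m = 0")
  case True
  then show ?thesis using A by (simp add: Determinant.det_def)
next
  case False
  have csq: "(complex_of_real (norm z))\<^sup>2 = z * cnj z" for z
    by (simp add: complex_norm_square flip: of_real_power)
  \<comment> \<open>\<open>H\<close> is the adjoint of \<open>A\<close>, and \<open>G\<close> the
    Gram matrix of its rows: det G is the squared modulus of det A, and the trace of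
    \<open>G\<close> is the sum of all squared entries, at most m^2. Applying the inequality of
    arithmetic and geometric means to the eigenvalues of \<open>G\<close> compares the two.\<close>
  define H where "H = mat m m (\<lambda>(i, j). cnj (A $$ (j, i)))"
  have H: "H \<in> carrier_mat m m" by (simp add: H_def)
  define G where "G = A * H"
  have G: "G \<in> carrier_mat m m" using A H by (simp add: G_def)
  have G_ij: "G $$ (i, j) = (\<Sum>k<m. A $$ (i, k) * cnj (A $$ (j, k)))" if "i < m" "j < m" for i j
    using A H that by (simp add: G_def H_def scalar_prod_def lessThan_atLeast0)
  have "H = map_mat cnj (transpose_mat A)"
    using A by (intro eq_matI) (auto simp: H_def)
  moreover have "Determinant.det (map_mat cnj B) = cnj (Determinant.det B)"
    if "B \<in> carrier_mat m m" for B
    using that by (simp add: Determinant.det_def)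
  ultimately have detH: "Determinant.det H = cnj (Determinant.det A)"
    using A det_transpose[OF A] by simp
  have detG: "Determinant.det G = of_real ((norm (Determinant.det A))\<^sup>2)"
    using det_mult[OF A H] by (simp only: G_def detH complex_norm_square)
  \<comment> \<open>A triangular form is enough: it exhibits trace and determinant as sum and
    product of one list of eigenvalues.\<close>
  obtain es where cp: "char_poly G = (\<Prod>e\<leftarrow>es. [:- e, 1:])" and len: "length es = m"
    using char_poly_factorized[OF G] by blast
  obtain B P Q where sd: "schur_decomposition G es = (B, P, Q)"
    by (metis prod_cases3)
  have sim: "similar_mat_wit G B P Q" and ut: "upper_triangular B" and dg: "diag_mat B = es"
    using schur_decomposition[OF G cp sd] by auto
  note wit = similar_mat_witD2[OF G sim]
  have B: "B \<in> carrier_mat m m" and P: "P \<in> carrier_mat m m" and Q: "Q \<in> carrier_mat m m"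
    and QP: "Q * P = 1\<^sub>m m" and GPBQ: "G = P * B * Q"
    using wit by auto
  have es_i: "es ! i = B $$ (i, i)" if "i < m" for i
    using that B unfolding dg[symmetric] diag_mat_def by simp
  have tr_comm: "(\<Sum>i<m. (C * D) $$ (i, i)) = (\<Sum>i<m. (D * C) $$ (i, i))"
    if "C \<in> carrier_mat m m" "D \<in> carrier_mat m m" for C D :: "complex mat"
    using that
    by (simp add: scalar_prod_def lessThan_atLeast0, subst sum.swap) (simp add: mult.commute)
  have "(\<Sum>i<m. G $$ (i, i)) = (\<Sum>i<m. (Q * (P * B)) $$ (i, i))"
    unfolding GPBQ using P B Q by (intro tr_comm) auto
  also have "Q * (P * B) = B"
    using P B Q QP by (metis assoc_mult_mat left_mult_one_mat)
  finally have trG: "(\<Sum>i<m. es ! i) = (\<Sum>i<m. G $$ (i, i))"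
    by (simp add: es_i)
  have "Determinant.det G = Determinant.det B"
    using det_similar[of G B] sim by (auto simp: similar_mat_def)
  also have "\<dots> = prod_list es"
    using det_upper_triangular[OF ut B] dg by simp
  finally have prG: "(\<Prod>i<m. es ! i) = Determinant.det G"
    by (subst (asm) prod.list_conv_set_nth) (simp add: len lessThan_atLeast0)
  \<comment> \<open>Rayleigh quotient: for an eigenvector \<open>v\<close>, the vector
    \<open>u\<close> is the adjoint of \<open>A\<close> applied to \<open>v\<close>, and the
    eigenvalue is |u|^2 / |v|^2.\<close>
  have ev: "\<exists>r\<ge>0. es ! i = of_real r" if i: "i < m" for i
  proof -
    have "poly (char_poly G) (es ! i) = 0"
      unfolding cp poly_prod_list using i len by (auto simp: prod_list_zero_iff image_iff)
    then have "eigenvalue G (es ! i)"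
      using eigenvalue_root_char_poly[OF G] by simp
    then obtain v where v: "v \<in> carrier_vec m" "v \<noteq> 0\<^sub>v m" and Gv: "G *\<^sub>v v = es ! i \<cdot>\<^sub>v v"
      using G unfolding eigenvalue_def eigenvector_def by auto
    define u where "u k = (\<Sum>j<m. cnj (A $$ (j, k)) * v $ j)" for k
    have "es ! i * v $ l = (\<Sum>j<m. G $$ (l, j) * v $ j)" if "l < m" for l
      using arg_cong[OF Gv, of "\<lambda>x. x $ l"] that v G
      by (simp add: scalar_prod_def lessThan_atLeast0)
    then have "(\<Sum>l<m. cnj (v $ l) * (es ! i * v $ l))
        = (\<Sum>l<m. \<Sum>j<m. \<Sum>k<m. cnj (v $ l) * (A $$ (l, k) * cnj (A $$ (j, k)) * v $ j))"
      by (simp add: G_ij sum_distrib_left sum_distrib_right)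
    also have "\<dots> = (\<Sum>k<m. \<Sum>l<m. \<Sum>j<m. cnj (v $ l) * (A $$ (l, k) * cnj (A $$ (j, k)) * v $ j))"
      by (subst sum.swap[where A = "{..<m}" and B = "{..<m}" and
          g = "\<lambda>k l. \<Sum>j<m. cnj (v $ l) * (A $$ (l, k) * cnj (A $$ (j, k)) * v $ j)"])
        (intro sum.cong refl sum.swap)
    also have "\<dots> = (\<Sum>k<m. cnj (u k) * u k)"
      by (simp add: u_def sum_distrib_left sum_distrib_right algebra_simps)
    also have "\<dots> = of_real (\<Sum>k<m. (norm (u k))\<^sup>2)"
      by (simp add: csq mult.commute)
    also have "(\<Sum>l<m. cnj (v $ l) * (es ! i * v $ l)) = es ! i * of_real (\<Sum>l<m. (norm (v $ l))\<^sup>2)"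
      by (simp add: csq sum_distrib_left mult.commute mult.left_commute)
    finally have eq: "es ! i * of_real (\<Sum>l<m. (norm (v $ l))\<^sup>2) = of_real (\<Sum>k<m. (norm (u k))\<^sup>2)" .
    obtain l where l: "l < m" "v $ l \<noteq> 0"
      using v by (metis carrier_vecD eq_vecI index_zero_vec)
    have pos: "0 < (\<Sum>l<m. (norm (v $ l))\<^sup>2)"
      using l by (intro sum_pos2[of _ l]) auto
    have "es ! i = of_real ((\<Sum>k<m. (norm (u k))\<^sup>2) / (\<Sum>l<m. (norm (v $ l))\<^sup>2))"
      unfolding of_real_divide eq[symmetric] using pos
      by (metis nonzero_mult_div_cancel_right of_real_eq_0_iff less_irrefl)
    then show ?thesis
      by (intro exI[of _ "(\<Sum>k<m. (norm (u k))\<^sup>2) / (\<Sum>l<m. (norm (v $ l))\<^sup>2)"])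
        (auto intro!: sum_nonneg divide_nonneg_nonneg)
  qed
  then obtain r where r: "\<And>i. i < m \<Longrightarrow> 0 \<le> r i" "\<And>i. i < m \<Longrightarrow> es ! i = of_real (r i)"
    by metis
  have "complex_of_real (\<Prod>i<m. r i) = of_real ((norm (Determinant.det A))\<^sup>2)"
    using prG detG r(2) by simp
  then have prod_r: "(\<Prod>i<m. r i) = (norm (Determinant.det A))\<^sup>2"
    by (simp only: of_real_eq_iff)
  have "complex_of_real (\<Sum>i<m. r i) = of_real (\<Sum>i<m. \<Sum>k<m. (norm (A $$ (i, k)))\<^sup>2)"
    using trG by (simp add: G_ij csq r(2) cong: sum.cong_simp)
  then have "(\<Sum>i<m. r i) = (\<Sum>i<m. \<Sum>k<m. (norm (A $$ (i, k)))\<^sup>2)"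
    by (simp only: of_real_eq_iff)
  also have "\<dots> \<le> (\<Sum>i<m. \<Sum>k<m. 1)"
    using bd by (intro sum_mono) (auto intro: power_le_one)
  finally have sum_r: "(\<Sum>i<m. r i) \<le> real m * real m" by simp
  have "(\<Prod>i<m. r i) powr (1 / m) \<le> (\<Sum>i<m. r i) / m"
    using arith_geom_mean[of "{..<m}" r] r(1) False
    by (auto simp: sum_divide_distrib lessThan_empty_iff bot_nat_def)
  also have "\<dots> \<le> real m"
    using sum_r False by (simp add: divide_simps)
  finally have "((\<Prod>i<m. r i) powr (1 / m)) ^ m \<le> real m ^ m"
    by (intro power_mono) auto
  moreover have "(p powr (1 / m)) ^ m = p" if "0 \<le> p" for p :: real
    using False that by (cases "p = 0") (auto simp: powr_realpow[symmetric] powr_powr)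
  moreover have "0 \<le> (\<Prod>i<m. r i)"
    using r(1) by (intro prod_nonneg) auto
  ultimately have "(norm (Determinant.det A))\<^sup>2 \<le> real m ^ m"
    using prod_r by simp
  also have "\<dots> = (sqrt (real m) ^ m)\<^sup>2"
    by (simp add: power2_eq_square power_mult_distrib[symmetric])
  finally show ?thesis
    by (rule power2_le_imp_le) simp
qed

section \<open>Kernels dominated by weights\<close>

text \<open>The weights play the role of the conjugation by a multiplication operator. \<open>f\<close> and \<open>g\<close> belong to
  different spaces; only \<open>weighted_space\<close> ties the two weights of one space together.\<close>

definition kern :: "'a measure \<Rightarrow> ('a \<Rightarrow> real) \<Rightarrow> 'b measure \<Rightarrow> ('b \<Rightarrow> real) \<Rightarrow> ('a \<Rightarrow> 'b \<Rightarrow> complex) \<Rightarrow> bool"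
  where "kern M f N g A \<longleftrightarrow>
    (\<lambda>p. A (fst p) (snd p)) \<in> borel_measurable (M \<Otimes>\<^sub>M N) \<and>
    (\<exists>C\<ge>0. \<forall>x\<in>space M. \<forall>y\<in>space N. norm (A x y) \<le> C * (f x * g y))"

definition kcomp :: "'b measure \<Rightarrow> ('a \<Rightarrow> 'b \<Rightarrow> complex) \<Rightarrow> ('b \<Rightarrow> 'c \<Rightarrow> complex) \<Rightarrow> 'a \<Rightarrow> 'c \<Rightarrow> complex"
  where "kcomp N A B x y = (\<integral>z. A x z * B z y \<partial>N)"

definition ktrace :: "'a measure \<Rightarrow> ('a \<Rightarrow> 'a \<Rightarrow> complex) \<Rightarrow> complex"
  where "ktrace M A = (\<integral>x. A x x \<partial>M)"

lemma kernI:
  assumes "(\<lambda>p. A (fst p) (snd p)) \<in> borel_measurable (M \<Otimes>\<^sub>M N)" "0 \<le> C"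
    and "\<And>x y. x \<in> space M \<Longrightarrow> y \<in> space N \<Longrightarrow> norm (A x y) \<le> C * (f x * g y)"
  shows "kern M f N g A"
  using assms unfolding kern_def by blast

lemma kern_meas:
  assumes "kern M f N g A" "h \<in> measurable K M" "k \<in> measurable K N"
  shows "(\<lambda>x. A (h x) (k x)) \<in> borel_measurable K"
proof -
  have "(\<lambda>x. (\<lambda>p. A (fst p) (snd p)) (h x, k x)) \<in> borel_measurable K"
    using assms by (intro measurable_compose[OF measurable_Pair]) (auto simp: kern_def)
  then show ?thesis by simp
qed

lemma kern_transpose:
  assumes "kern M f N g A"
  shows "kern N g M f (\<lambda>y x. A x y)"
proof -
  obtain C where "0 \<le> C" "\<And>x y. x \<in> space M \<Longrightarrow> y \<in> space N \<Longrightarrow> norm (A x y) \<le> C * (f x * g y)"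
    using assms unfolding kern_def by blast
  then show ?thesis
    using kern_meas[OF assms measurable_snd measurable_fst]
    by (intro kernI[of _ _ _ C]) (auto simp: mult.commute[of "g _"])
qed

lemma kern_cong:
  assumes "kern M f N g A" "\<And>x y. x \<in> space M \<Longrightarrow> y \<in> space N \<Longrightarrow> B x y = A x y"
  shows "kern M f N g B"
proof -
  obtain C where C: "0 \<le> C" "\<And>x y. x \<in> space M \<Longrightarrow> y \<in> space N \<Longrightarrow> norm (A x y) \<le> C * (f x * g y)"
    using assms(1) unfolding kern_def by blast
  have "(\<lambda>p. B (fst p) (snd p)) \<in> borel_measurable (M \<Otimes>\<^sub>M N)
      \<longleftrightarrow> (\<lambda>p. A (fst p) (snd p)) \<in> borel_measurable (M \<Otimes>\<^sub>M N)"
    using assms(2) by (intro measurable_cong) (auto simp: space_pair_measure)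
  then show ?thesis
    using assms C by (intro kernI[of _ _ _ C]) (auto simp: kern_def)
qed

lemma kern_add:
  assumes A: "kern M f N g A" and B: "kern M f N g B"
  shows "kern M f N g (\<lambda>x y. A x y + B x y)"
proof -
  obtain C where C: "0 \<le> C" "\<And>x y. x \<in> space M \<Longrightarrow> y \<in> space N \<Longrightarrow> norm (A x y) \<le> C * (f x * g y)"
    using A unfolding kern_def by blast
  obtain D where D: "0 \<le> D" "\<And>x y. x \<in> space M \<Longrightarrow> y \<in> space N \<Longrightarrow> norm (B x y) \<le> D * (f x * g y)"
    using B unfolding kern_def by blast
  show ?thesis
  proof (intro kernI[of _ _ _ "C + D"])
    show "(\<lambda>p. A (fst p) (snd p) + B (fst p) (snd p)) \<in> borel_measurable (M \<Otimes>\<^sub>M N)"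
      using kern_meas[OF A measurable_fst measurable_snd] kern_meas[OF B measurable_fst measurable_snd]
      by (rule borel_measurable_add)
    show "norm (A x y + B x y) \<le> (C + D) * (f x * g y)" if "x \<in> space M" "y \<in> space N" for x y
      using norm_triangle_ineq[of "A x y" "B x y"] C(2)[OF that] D(2)[OF that] by (simp add: distrib_right)
  qed (use C D in auto)
qed

lemma kern_scale:
  assumes A: "kern M f N g A"
  shows "kern M f N g (\<lambda>x y. c * A x y)"
proof -
  obtain C where C: "0 \<le> C" "\<And>x y. x \<in> space M \<Longrightarrow> y \<in> space N \<Longrightarrow> norm (A x y) \<le> C * (f x * g y)"
    using A unfolding kern_def by blast
  show ?thesis
  proof (intro kernI[of _ _ _ "norm c * C"])
    show "(\<lambda>p. c * A (fst p) (snd p)) \<in> borel_measurable (M \<Otimes>\<^sub>M N)"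
      using kern_meas[OF A measurable_fst measurable_snd] by (intro borel_measurable_times) auto
    show "norm (c * A x y) \<le> (norm c * C) * (f x * g y)" if "x \<in> space M" "y \<in> space N" for x y
      using mult_left_mono[OF C(2)[OF that] norm_ge_zero[of c]] by (simp add: norm_mult mult.assoc)
  qed (use C in auto)
qed

lemma kern_minus: "kern M f N g A \<Longrightarrow> kern M f N g (\<lambda>x y. - A x y)"
  using kern_scale[of M f N g A "-1"] by simp

lemma kern_diff:
  "kern M f N g A \<Longrightarrow> kern M f N g B \<Longrightarrow> kern M f N g (\<lambda>x y. A x y - B x y)"
  using kern_add[of M f N g A "\<lambda>x y. - B x y"] kern_minus[of M f N g B] by simp

lemma kern_zero: "kern M f N g (\<lambda>x y. 0)"
  by (rule kernI[of _ _ _ 0]) auto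

lemma norm_integral_le:
  fixes h :: "'a \<Rightarrow> complex"
  assumes "integrable M h" "integrable M k" "\<And>x. x \<in> space M \<Longrightarrow> norm (h x) \<le> k x"
  shows "norm (\<integral>x. h x \<partial>M) \<le> (\<integral>x. k x \<partial>M)"
  using assms by (intro order_trans[OF integral_norm_bound integral_mono]) auto

lemma mult_mono3:
  fixes a b c a' b' c' :: real
  assumes "a \<le> a'" "b \<le> b'" "c \<le> c'" "0 \<le> a" "0 \<le> b" "0 \<le> c"
  shows "a * b * c \<le> a' * b' * c'"
  using assms by (intro mult_mono mult_nonneg_nonneg) auto

lemma integrable_product:
  fixes h :: "'a \<Rightarrow> real" and k :: "'b \<Rightarrow> real"
  assumes "sigma_finite_measure M" "sigma_finite_measure N" "integrable M h" "integrable N k"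
  shows "integrable (M \<Otimes>\<^sub>M N) (\<lambda>p. h (fst p) * k (snd p))"
proof -
  interpret M: sigma_finite_measure M by fact
  interpret N: sigma_finite_measure N by fact
  interpret pair_sigma_finite M N ..
  have [measurable]: "h \<in> borel_measurable M" "k \<in> borel_measurable N" using assms by auto
  show ?thesis
    using assms by (intro Fubini_integrable) (auto simp: abs_mult)
qed

text \<open>In a composition over \<open>M\<close> the left factor contributes \<open>g\<close> and
  the right factor \<open>f\<close>, so \<open>f * g\<close> is the dominating function. Zeros are
  allowed, which lets a weight encode a cutoff, as \<open>fb\<close> does later.\<close>

locale weighted_space = sigma_finite_measure M for M :: "'a measure" +
  fixes f g :: "'a \<Rightarrow> real"
  assumes f_meas [measurable]: "f \<in> borel_measurable M"
    and g_meas [measurable]: "g \<in> borel_measurable M"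
    and f_nonneg: "0 \<le> f x" and g_nonneg: "0 \<le> g x"
    and fg_integrable: "integrable M (\<lambda>x. f x * g x)"
begin

lemma kcomp_integrable:
  assumes A: "kern L f' M g A" and B: "kern M f N g' B" and x: "x \<in> space L" and y: "y \<in> space N"
  shows "integrable M (\<lambda>z. A x z * B z y)"
proof -
  obtain C where C: "0 \<le> C" "\<And>x y. x \<in> space L \<Longrightarrow> y \<in> space M \<Longrightarrow> norm (A x y) \<le> C * (f' x * g y)"
    using A unfolding kern_def by blast
  obtain D where D: "0 \<le> D" "\<And>x y. x \<in> space M \<Longrightarrow> y \<in> space N \<Longrightarrow> norm (B x y) \<le> D * (f x * g' y)"
    using B unfolding kern_def by blast
  note [measurable] = kern_meas[OF A] kern_meas[OF B]
  show ?thesis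
  proof (rule Bochner_Integration.integrable_bound)
    show "integrable M (\<lambda>z. (C * D * f' x * g' y) * (f z * g z))"
      using fg_integrable by simp
    show "(\<lambda>z. A x z * B z y) \<in> borel_measurable M"
      using x y by measurable
    have "norm (A x z) * norm (B z y) \<le> (C * (f' x * g z)) * (D * (f z * g' y))" if "z \<in> space M" for z
      by (intro mult_mono C(2) D(2) x y that) (auto intro: order_trans[OF norm_ge_zero C(2)[OF x that]])
    moreover have "(C * (f' x * g z)) * (D * (f z * g' y)) \<le> norm ((C * D * f' x * g' y) * (f z * g z))" for z
      unfolding real_norm_def by (rule order_trans[OF _ abs_ge_self]) (simp add: algebra_simps)
    ultimately show "AE z in M. norm (A x z * B z y) \<le> norm ((C * D * f' x * g' y) * (f z * g z))"
      by (intro AE_I2) (auto simp: norm_mult intro: order_trans)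
  qed
qed

lemma kern_kcomp:
  assumes A: "kern L f' M g A" and B: "kern M f N g' B"
  shows "kern L f' N g' (kcomp M A B)"
proof -
  obtain C where C: "0 \<le> C" "\<And>x y. x \<in> space L \<Longrightarrow> y \<in> space M \<Longrightarrow> norm (A x y) \<le> C * (f' x * g y)"
    using A unfolding kern_def by blast
  obtain D where D: "0 \<le> D" "\<And>x y. x \<in> space M \<Longrightarrow> y \<in> space N \<Longrightarrow> norm (B x y) \<le> D * (f x * g' y)"
    using B unfolding kern_def by blast
  note [measurable] = kern_meas[OF A] kern_meas[OF B]
  show ?thesis
  proof (intro kernI[of _ _ _ "C * D * (\<integral>z. f z * g z \<partial>M)"])
    show "(\<lambda>p. kcomp M A B (fst p) (snd p)) \<in> borel_measurable (L \<Otimes>\<^sub>M N)"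
      unfolding kcomp_def by measurable
    show "0 \<le> C * D * (\<integral>z. f z * g z \<partial>M)"
      using C D f_nonneg g_nonneg by (intro mult_nonneg_nonneg integral_nonneg_AE) auto
    fix x y assume x: "x \<in> space L" and y: "y \<in> space N"
    have "norm (kcomp M A B x y) \<le> (\<integral>z. (C * D * f' x * g' y) * (f z * g z) \<partial>M)"
      unfolding kcomp_def
    proof (rule norm_integral_le)
      show "integrable M (\<lambda>z. A x z * B z y)" by (rule kcomp_integrable[OF A B x y])
      show "integrable M (\<lambda>z. (C * D * f' x * g' y) * (f z * g z))"
        using fg_integrable by simp
      fix z assume z: "z \<in> space M"
      have "norm (A x z) * norm (B z y) \<le> (C * (f' x * g z)) * (D * (f z * g' y))"
        by (intro mult_mono C(2) D(2) x y z) (auto intro: order_trans[OF norm_ge_zero C(2)[OF x z]])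
      then show "norm (A x z * B z y) \<le> (C * D * f' x * g' y) * (f z * g z)"
        by (simp add: norm_mult algebra_simps)
    qed
    also have "\<dots> = (C * D * f' x * g' y) * (\<integral>z. f z * g z \<partial>M)"
      by (rule integral_mult_right_zero)
    finally show "norm (kcomp M A B x y) \<le> C * D * (\<integral>z. f z * g z \<partial>M) * (f' x * g' y)"
      by (simp only: ac_simps)
  qed
qed

text \<open>The three bounds separate the variables, so the integrand over both middle spaces is
  dominated by a product of two integrable functions and Fubini applies. The weights occur only in
  the hypotheses; every use may choose them anew.\<close>

lemma kcomp_assoc:
  assumes "weighted_space N f2 g2"
    and A: "kern L f1 M g A" and B: "kern M f N g2 B" and D: "kern N f2 P g3 D"
    and x: "x \<in> space L" and y: "y \<in> space P"
  shows "kcomp N (kcomp M A B) D x y = kcomp M A (kcomp N B D) x y"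
proof -
  interpret N: weighted_space N f2 g2 by fact
  interpret MN: pair_sigma_finite M N ..
  obtain a where a: "0 \<le> a" "\<And>x y. x \<in> space L \<Longrightarrow> y \<in> space M \<Longrightarrow> norm (A x y) \<le> a * (f1 x * g y)"
    using A unfolding kern_def by blast
  obtain b where b: "0 \<le> b" "\<And>x y. x \<in> space M \<Longrightarrow> y \<in> space N \<Longrightarrow> norm (B x y) \<le> b * (f x * g2 y)"
    using B unfolding kern_def by blast
  obtain d where d: "0 \<le> d" "\<And>x y. x \<in> space N \<Longrightarrow> y \<in> space P \<Longrightarrow> norm (D x y) \<le> d * (f2 x * g3 y)"
    using D unfolding kern_def by blast
  note [measurable] = kern_meas[OF A] kern_meas[OF B] kern_meas[OF D]
  have int: "integrable (M \<Otimes>\<^sub>M N) (\<lambda>(z, w). A x z * B z w * D w y)"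
  proof (rule Bochner_Integration.integrable_bound)
    show "integrable (M \<Otimes>\<^sub>M N)
        (\<lambda>p. (a * b * d * f1 x * g3 y) * ((f (fst p) * g (fst p)) * (f2 (snd p) * g2 (snd p))))"
      using integrable_product[OF _ _ fg_integrable N.fg_integrable] 
      by (simp add: sigma_finite_measure_axioms N.sigma_finite_measure_axioms)
    show "(\<lambda>(z, w). A x z * B z w * D w y) \<in> borel_measurable (M \<Otimes>\<^sub>M N)"
      using x y by measurable
    have "norm (A x z * B z w * D w y) \<le> norm ((a * b * d * f1 x * g3 y) * ((f z * g z) * (f2 w * g2 w)))"
      if z: "z \<in> space M" and w: "w \<in> space N" for z w
    proof -
      have "norm (A x z * B z w * D w y) \<le> (a * (f1 x * g z)) * (b * (f z * g2 w)) * (d * (f2 w * g3 y))"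
        unfolding norm_mult using a(2)[OF x z] b(2)[OF z w] d(2)[OF w y]
        by (intro mult_mono3) auto
      also have "\<dots> \<le> norm ((a * b * d * f1 x * g3 y) * ((f z * g z) * (f2 w * g2 w)))"
        unfolding real_norm_def by (rule order_trans[OF _ abs_ge_self]) (simp add: algebra_simps)
      finally show ?thesis .
    qed
    then show "AE p in M \<Otimes>\<^sub>M N. norm (case p of (z, w) \<Rightarrow> A x z * B z w * D w y)
       \<le> norm ((a * b * d * f1 x * g3 y) * ((f (fst p) * g (fst p)) * (f2 (snd p) * g2 (snd p))))"
      by (intro AE_I2) (auto simp: space_pair_measure)
  qed
  have "kcomp N (kcomp M A B) D x y = (\<integral>w. \<integral>z. A x z * B z w * D w y \<partial>M \<partial>N)"
    unfolding kcomp_def by simp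
  also have "\<dots> = (\<integral>z. \<integral>w. A x z * B z w * D w y \<partial>N \<partial>M)"
    by (rule MN.Fubini_integral) (use int in simp)
  also have "\<dots> = kcomp M A (kcomp N B D) x y"
    unfolding kcomp_def by (simp add: mult.assoc)
  finally show ?thesis .
qed

lemma ktrace_kcomp_commute:
  assumes "weighted_space N f2 g2" and A: "kern M f N g2 A" and B: "kern N f2 M g B"
  shows "ktrace M (kcomp N A B) = ktrace N (kcomp M B A)"
proof -
  interpret N: weighted_space N f2 g2 by fact
  interpret MN: pair_sigma_finite M N ..
  obtain a where a: "0 \<le> a" "\<And>x y. x \<in> space M \<Longrightarrow> y \<in> space N \<Longrightarrow> norm (A x y) \<le> a * (f x * g2 y)"
    using A unfolding kern_def by blast
  obtain b where b: "0 \<le> b" "\<And>x y. x \<in> space N \<Longrightarrow> y \<in> space M \<Longrightarrow> norm (B x y) \<le> b * (f2 x * g y)"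
    using B unfolding kern_def by blast
  note [measurable] = kern_meas[OF A] kern_meas[OF B]
  have int: "integrable (M \<Otimes>\<^sub>M N) (\<lambda>(x, z). A x z * B z x)"
  proof (rule Bochner_Integration.integrable_bound)
    show "integrable (M \<Otimes>\<^sub>M N) (\<lambda>p. (a * b) * ((f (fst p) * g (fst p)) * (f2 (snd p) * g2 (snd p))))"
      using integrable_product[OF _ _ fg_integrable N.fg_integrable]
      by (simp add: sigma_finite_measure_axioms N.sigma_finite_measure_axioms)
    show "(\<lambda>(x, z). A x z * B z x) \<in> borel_measurable (M \<Otimes>\<^sub>M N)"
      by measurable
    have "norm (A x z * B z x) \<le> norm ((a * b) * ((f x * g x) * (f2 z * g2 z)))"
      if x: "x \<in> space M" and z: "z \<in> space N" for x z
    proof -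
      have "norm (A x z * B z x) \<le> (a * (f x * g2 z)) * (b * (f2 z * g x))"
        unfolding norm_mult using a(2)[OF x z] b(2)[OF z x]
        by (intro mult_mono) (auto intro: order_trans[OF norm_ge_zero])
      also have "\<dots> \<le> norm ((a * b) * ((f x * g x) * (f2 z * g2 z)))"
        unfolding real_norm_def by (rule order_trans[OF _ abs_ge_self]) (simp add: algebra_simps)
      finally show ?thesis .
    qed
    then show "AE p in M \<Otimes>\<^sub>M N. norm (case p of (x, z) \<Rightarrow> A x z * B z x)
       \<le> norm ((a * b) * ((f (fst p) * g (fst p)) * (f2 (snd p) * g2 (snd p))))"
      by (intro AE_I2) (auto simp: space_pair_measure)
  qed
  have "ktrace M (kcomp N A B) = (\<integral>x. \<integral>z. A x z * B z x \<partial>N \<partial>M)"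
    unfolding ktrace_def kcomp_def by simp
  also have "\<dots> = (\<integral>z. \<integral>x. A x z * B z x \<partial>M \<partial>N)"
    by (rule MN.Fubini_integral[symmetric]) (use int in simp)
  also have "\<dots> = ktrace N (kcomp M B A)"
    unfolding ktrace_def kcomp_def by (simp add: mult.commute)
  finally show ?thesis .
qed

lemma kcomp_add_left:
  assumes "kern L f' M g A" "kern L f' M g A'" "kern M f N g' B" "x \<in> space L" "y \<in> space N"
  shows "kcomp M (\<lambda>x y. A x y + A' x y) B x y = kcomp M A B x y + kcomp M A' B x y"
  unfolding kcomp_def distrib_right using assms
  by (intro Bochner_Integration.integral_add kcomp_integrable)

lemma kcomp_add_right:
  assumes "kern L f' M g A" "kern M f N g' B" "kern M f N g' B'" "x \<in> space L" "y \<in> space N"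
  shows "kcomp M A (\<lambda>x y. B x y + B' x y) x y = kcomp M A B x y + kcomp M A B' x y"
  unfolding kcomp_def distrib_left using assms
  by (intro Bochner_Integration.integral_add kcomp_integrable)

lemma kcomp_diff_right:
  assumes "kern L f' M g A" "kern M f N g' B" "kern M f N g' B'" "x \<in> space L" "y \<in> space N"
  shows "kcomp M A (\<lambda>x y. B x y - B' x y) x y = kcomp M A B x y - kcomp M A B' x y"
  unfolding kcomp_def right_diff_distrib using assms
  by (intro Bochner_Integration.integral_diff kcomp_integrable)

end

lemma kcomp_scale_right: "kcomp M A (\<lambda>x y. c * B x y) x y = c * kcomp M A B x y"
proof -
  have "(\<lambda>z. A x z * (c * B z y)) = (\<lambda>z. c * (A x z * B z y))"
    by (auto simp: fun_eq_iff)
  then show ?thesis by (simp add: kcomp_def)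
qed

lemma kcomp_cong:
  assumes "\<And>z. z \<in> space M \<Longrightarrow> A x z = A' x z" "\<And>z. z \<in> space M \<Longrightarrow> B z y = B' z y"
  shows "kcomp M A B x y = kcomp M A' B' x y"
  unfolding kcomp_def using assms by (intro Bochner_Integration.integral_cong) auto

lemma ktrace_cong: "(\<And>x. x \<in> space M \<Longrightarrow> A x x = B x x) \<Longrightarrow> ktrace M A = ktrace M B"
  unfolding ktrace_def by (intro Bochner_Integration.integral_cong) auto

section \<open>Fredholm coefficients\<close>

text \<open>Each row may carry its own kernel, because the expansion below follows one row that
  differs from the others. The index set is arbitrary, because integrating out a variable removes an
  arbitrary index.\<close>

definition pdet :: "nat set \<Rightarrow> (nat \<Rightarrow> 'a \<Rightarrow> 'a \<Rightarrow> complex) \<Rightarrow> (nat \<Rightarrow> 'a) \<Rightarrow> complex" where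
  "pdet S R x = (\<Sum>p | p permutes S. of_int (sign p) * (\<Prod>i\<in>S. R i (x i) (x (p i))))"

lemma fredholm_minor_eq_pdet: "fredholm_minor A m x = pdet {..<m} (\<lambda>_. A) x"
proof -
  have "(\<Prod>i<m. Matrix.mat m m (\<lambda>(i, j). A (x i) (x j)) $$ (i, p i)) = (\<Prod>i<m. A (x i) (x (p i)))"
    if "p permutes {..<m}" for p
    using that permutes_in_image[OF that] by (intro prod.cong) auto
  then show ?thesis
    unfolding fredholm_minor_def pdet_def Determinant.det_def
    by (simp add: lessThan_atLeast0[symmetric])
qed

text \<open>The reason why weights act like a conjugation: a permutation only rearranges the column
  weights, so all terms of a determinant share one dominating function.\<close>

lemma prod_permutes_weight:
  fixes g :: "'a \<Rightarrow> real"
  assumes "p permutes S"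
  shows "(\<Prod>i\<in>S. f (x i) * g (x (p i))) = (\<Prod>i\<in>S. f (x i) * g (x i))"
  using prod.permute[OF assms, of "\<lambda>i. g (x i)"] by (simp add: prod.distrib o_def)

context weighted_space
begin

sublocale product_sigma_finite "\<lambda>_ :: nat. M" ..

abbreviation PM :: "nat set \<Rightarrow> (nat \<Rightarrow> 'a) measure" where "PM S \<equiv> Pi\<^sub>M S (\<lambda>_. M)"

definition dI :: "nat set \<Rightarrow> (nat \<Rightarrow> 'a \<Rightarrow> 'a \<Rightarrow> complex) \<Rightarrow> complex" where
  "dI S R = (\<integral>x. pdet S R x \<partial>PM S)"

lemma weight_integrable: "finite S \<Longrightarrow> integrable (PM S) (\<lambda>x. \<Prod>i\<in>S. f (x i) * g (x i))"
  by (rule product_integrable_prod) (auto intro: fg_integrable)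

lemma weight_integral:
  "finite S \<Longrightarrow> (\<integral>x. (\<Prod>i\<in>S. f (x i) * g (x i)) \<partial>PM S) = (\<integral>z. f z * g z \<partial>M) ^ card S"
  by (subst product_integral_prod) (auto intro: fg_integrable)

lemma perm_term_measurable:
  assumes S: "finite S" and R: "\<And>i. i \<in> S \<Longrightarrow> kern M f M g (R i)" and p: "p permutes S"
  shows "(\<lambda>x. \<Prod>i\<in>S. R i (x i) (x (p i))) \<in> borel_measurable (PM S)"
proof (rule borel_measurable_prod)
  fix i assume i: "i \<in> S"
  then have "p i \<in> S" using permutes_in_image[OF p] by simp
  then show "(\<lambda>x. R i (x i) (x (p i))) \<in> borel_measurable (PM S)"
    using i by (intro kern_meas[OF R[OF i]] measurable_component_singleton)
qed

lemma perm_term_integrable: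
  assumes S: "finite S" and R: "\<And>i. i \<in> S \<Longrightarrow> kern M f M g (R i)" and p: "p permutes S"
  shows "integrable (PM S) (\<lambda>x. \<Prod>i\<in>S. R i (x i) (x (p i)))"
proof -
  have "\<forall>i\<in>S. \<exists>C\<ge>0. \<forall>x\<in>space M. \<forall>y\<in>space M. norm (R i x y) \<le> C * (f x * g y)"
    using R unfolding kern_def by blast
  then obtain C where C: "\<And>i. i \<in> S \<Longrightarrow> 0 \<le> C i"
      "\<And>i x y. i \<in> S \<Longrightarrow> x \<in> space M \<Longrightarrow> y \<in> space M \<Longrightarrow> norm (R i x y) \<le> C i * (f x * g y)"
    by metis
  show ?thesis
  proof (rule Bochner_Integration.integrable_bound)
    show "integrable (PM S) (\<lambda>x. (\<Prod>i\<in>S. C i) * (\<Prod>i\<in>S. f (x i) * g (x i)))"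
      using weight_integrable[OF S] by simp
    show "AE x in PM S. norm (\<Prod>i\<in>S. R i (x i) (x (p i))) \<le> norm ((\<Prod>i\<in>S. C i) * (\<Prod>i\<in>S. f (x i) * g (x i)))"
    proof (rule AE_I2)
      fix x assume x: "x \<in> space (PM S)"
      have xi: "x i \<in> space M" if "i \<in> S" for i
        using x that by (auto simp: space_PiM)
      have "norm (\<Prod>i\<in>S. R i (x i) (x (p i))) \<le> (\<Prod>i\<in>S. C i * (f (x i) * g (x (p i))))"
        unfolding prod_norm[symmetric] using xi permutes_in_image[OF p] C by (intro prod_mono) auto
      also have "\<dots> = (\<Prod>i\<in>S. C i) * (\<Prod>i\<in>S. f (x i) * g (x i))"
        unfolding prod.distrib[of C] by (simp add: prod_permutes_weight[OF p])
      finally show "norm (\<Prod>i\<in>S. R i (x i) (x (p i))) \<le> norm ((\<Prod>i\<in>S. C i) * (\<Prod>i\<in>S. f (x i) * g (x i)))"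
        by (simp del: norm_mult)
    qed
qed (rule perm_term_measurable[OF assms])
qed

lemma pdet_integrable:
  assumes "finite S" "\<And>i. i \<in> S \<Longrightarrow> kern M f M g (R i)"
  shows "integrable (PM S) (pdet S R)"
  unfolding pdet_def using assms
  by (intro Bochner_Integration.integrable_sum integrable_mult_right perm_term_integrable) auto

lemma dI_eq_sum:
  assumes "finite S" "\<And>i. i \<in> S \<Longrightarrow> kern M f M g (R i)"
  shows "dI S R = (\<Sum>p | p permutes S. of_int (sign p) * (\<integral>x. (\<Prod>i\<in>S. R i (x i) (x (p i))) \<partial>PM S))"
  unfolding dI_def pdet_def using assms
  by (subst Bochner_Integration.integral_sum)
    (auto intro!: Bochner_Integration.integrable_sum integrable_mult_right perm_term_integrable)

lemma dI_cong:
  assumes "\<And>i x y. i \<in> S \<Longrightarrow> x \<in> space M \<Longrightarrow> y \<in> space M \<Longrightarrow> R i x y = R' i x y"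
  shows "dI S R = dI S R'"
  unfolding dI_def
proof (rule Bochner_Integration.integral_cong[OF refl])
  fix x assume x: "x \<in> space (PM S)"
  have "(\<Prod>i\<in>S. R i (x i) (x (p i))) = (\<Prod>i\<in>S. R' i (x i) (x (p i)))" if p: "p permutes S" for p
    using x permutes_in_image[OF p] by (intro prod.cong refl assms) (auto simp: space_PiM PiE_iff)
  then show "pdet S R x = pdet S R' x"
    unfolding pdet_def by simp
qed

text \<open>Fubini in the variable \<open>x\<^sub>b\<close> that follows \<open>a\<close> in a cycle: it disappears and the row of \<open>a\<close> is
  composed with \<open>A\<close>.\<close>

lemma integrate_out_next:
  assumes S: "finite S" and aS: "a \<notin> S" and bS: "b \<in> S" and p: "p permutes S"
    and A: "kern M f M g A" and Q: "kern M f M g Q"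
  defines "t \<equiv> Transposition.transpose a b"
  shows "(\<integral>x. (\<Prod>i\<in>insert a S. ((\<lambda>_. A)(a := Q)) i (x i) (x ((t \<circ> p) i))) \<partial>PM (insert a S))
    = (\<integral>x. (\<Prod>i\<in>insert a (S - {b}). ((\<lambda>_. A)(a := kcomp M Q A)) i (x i) (x ((t \<circ> p \<circ> t) i)))
         \<partial>PM (insert a (S - {b})))"
proof -
  define J where "J = insert a (S - {b})"
  have ab: "a \<noteq> b" using aS bS by auto
  have J: "finite J" "b \<notin> J" "insert b J = insert a S"
    using S aS bS ab by (auto simp: J_def)
  have tp: "(t \<circ> p) permutes insert a S"
    unfolding t_def by (rule permutes_compose[OF permutes_subset[OF p]]) (use bS in \<open>auto intro: permutes_swap_id\<close>)
  have pa: "p a = a" using p aS by (simp add: permutes_not_in)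
  have tS: "t j \<in> J" if "j \<in> S" for j
    using that ab aS by (auto simp: t_def J_def Transposition.transpose_def)
  have int: "integrable (PM (insert b J)) (\<lambda>x. \<Prod>i\<in>insert a S. ((\<lambda>_. A)(a := Q)) i (x i) (x ((t \<circ> p) i)))"
    unfolding J(3) by (rule perm_term_integrable[OF _ _ tp]) (use S A Q in auto)
  have "(\<integral>x. (\<Prod>i\<in>insert a S. ((\<lambda>_. A)(a := Q)) i (x i) (x ((t \<circ> p) i))) \<partial>PM (insert a S))
      = (\<integral>w. \<integral>z. (\<Prod>i\<in>insert a S. ((\<lambda>_. A)(a := Q)) i ((w(b := z)) i) ((w(b := z)) ((t \<circ> p) i))) \<partial>M \<partial>PM J)"
    unfolding J(3)[symmetric]
    by (rule product_integral_insert[OF J(1,2)]) (use int J(3) in simp)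
  also have "\<dots> = (\<integral>w. (\<Prod>i\<in>J. ((\<lambda>_. A)(a := kcomp M Q A)) i (w i) (w ((t \<circ> p \<circ> t) i))) \<partial>PM J)"
  proof (intro Bochner_Integration.integral_cong refl)
    fix w
    have tpa: "t (p a) = b" by (simp add: pa t_def)
    \<comment> \<open>The variable \<open>x b\<close> occurs exactly twice, as the column of row
      \<open>a\<close> and as the row \<open>b\<close>; its integral is therefore a composition.
      Since \<open>p\<close> fixes \<open>a\<close>, conjugating by \<open>t\<close> lets
      \<open>a\<close> take the place of \<open>b\<close> in its cycle.\<close>
    have tneq: "t (p i) \<noteq> b" if "i \<in> S" for i
      using tS[of "p i"] permutes_in_image[OF p, of i] that J(2) by auto
    have "(\<Prod>i\<in>insert a S. ((\<lambda>_. A)(a := Q)) i ((w(b := z)) i) ((w(b := z)) ((t \<circ> p) i)))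
        = (Q (w a) z * A z (w (t (p b)))) * (\<Prod>i\<in>S - {b}. A (w i) (w (t (p i))))" for z
    proof -
      have "(\<Prod>i\<in>S - {b}. ((\<lambda>_. A)(a := Q)) i ((w(b := z)) i) ((w(b := z)) ((t \<circ> p) i)))
          = (\<Prod>i\<in>S - {b}. A (w i) (w (t (p i))))"
        using aS tneq by (intro prod.cong) auto
      moreover have "prod F (insert a S) = F a * (F b * prod F (S - {b}))" for F :: "nat \<Rightarrow> complex"
        using S aS prod.remove[OF S bS, of F] by simp
      ultimately show ?thesis
        using ab tneq[OF bS] tpa by simp
    qed
    moreover have "(\<Prod>i\<in>J. ((\<lambda>_. A)(a := kcomp M Q A)) i (w i) (w ((t \<circ> p \<circ> t) i)))
        = kcomp M Q A (w a) (w (t (p b))) * (\<Prod>i\<in>S - {b}. A (w i) (w (t (p i))))"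
    proof -
      have "(\<Prod>i\<in>S - {b}. ((\<lambda>_. A)(a := kcomp M Q A)) i (w i) (w ((t \<circ> p \<circ> t) i)))
          = (\<Prod>i\<in>S - {b}. A (w i) (w (t (p i))))"
        using aS by (intro prod.cong) (auto simp: t_def Transposition.transpose_def)
      then show ?thesis
        unfolding J_def using S aS by (subst prod.insert) (auto simp: t_def)
    qed
    ultimately show "(\<integral>z. (\<Prod>i\<in>insert a S. ((\<lambda>_. A)(a := Q)) i ((w(b := z)) i) ((w(b := z)) ((t \<circ> p) i))) \<partial>M)
        = (\<Prod>i\<in>J. ((\<lambda>_. A)(a := kcomp M Q A)) i (w i) (w ((t \<circ> p \<circ> t) i)))"
      by (simp add: kcomp_def)
  qed
  finally show ?thesis unfolding J_def .
qed

text \<open>A fixed point is a cycle of length one: its variable enters only through the diagonal of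
  \<open>Q\<close> and integrates to a trace.\<close>

lemma integrate_out_fixed:
  assumes S: "finite S" and aS: "a \<notin> S" and p: "p permutes S"
    and A: "kern M f M g A" and Q: "kern M f M g Q"
  shows "(\<integral>x. (\<Prod>i\<in>insert a S. ((\<lambda>_. A)(a := Q)) i (x i) (x (p i))) \<partial>PM (insert a S))
    = ktrace M Q * (\<integral>x. (\<Prod>i\<in>S. A (x i) (x (p i))) \<partial>PM S)"
proof -
  have pa: "p a = a" using p aS by (simp add: permutes_not_in)
  have "(\<integral>x. (\<Prod>i\<in>insert a S. ((\<lambda>_. A)(a := Q)) i (x i) (x (p i))) \<partial>PM (insert a S))
      = (\<integral>w. \<integral>z. (\<Prod>i\<in>insert a S. ((\<lambda>_. A)(a := Q)) i ((w(a := z)) i) ((w(a := z)) (p i))) \<partial>M \<partial>PM S)"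
    by (rule product_integral_insert[OF S aS], rule perm_term_integrable)
      (use S A Q permutes_subset[OF p] in auto)
  also have "\<dots> = (\<integral>w. ktrace M Q * (\<Prod>i\<in>S. A (w i) (w (p i))) \<partial>PM S)"
  proof (intro Bochner_Integration.integral_cong refl)
    fix w
    have "(\<Prod>i\<in>S. ((\<lambda>_. A)(a := Q)) i ((w(a := z)) i) ((w(a := z)) (p i))) = (\<Prod>i\<in>S. A (w i) (w (p i)))" for z
    proof (rule prod.cong)
      fix i assume i: "i \<in> S"
      then have "p i \<in> S" using permutes_in_image[OF p] by simp
      then show "((\<lambda>_. A)(a := Q)) i ((w(a := z)) i) ((w(a := z)) (p i)) = A (w i) (w (p i))"
        using i aS by auto
    qed simp
    then have "(\<Prod>i\<in>insert a S. ((\<lambda>_. A)(a := Q)) i ((w(a := z)) i) ((w(a := z)) (p i)))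
        = Q z z * (\<Prod>i\<in>S. A (w i) (w (p i)))" for z
      by (subst prod.insert[OF S aS]) (simp add: pa)
    then show "(\<integral>z. (\<Prod>i\<in>insert a S. ((\<lambda>_. A)(a := Q)) i ((w(a := z)) i) ((w(a := z)) (p i))) \<partial>M)
        = ktrace M Q * (\<Prod>i\<in>S. A (w i) (w (p i)))"
      by (simp add: ktrace_def)
  qed
  also have "\<dots> = ktrace M Q * (\<integral>x. (\<Prod>i\<in>S. A (x i) (x (p i))) \<partial>PM S)"
    by (rule integral_mult_right_zero)
  finally show ?thesis .
qed

text \<open>A permutation of \<open>insert a S\<close> is a transposition of \<open>a\<close> with
  some \<open>b\<close> after a permutation of \<open>S\<close>. For \<open>b = a\<close> the index
  \<open>a\<close> is fixed and splits off a trace. Otherwise \<open>b\<close> follows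
  \<open>a\<close> in its cycle and is integrated out; the transposition gives the minus sign.
  Iterating this leaves only traces of \<open>Q\<close> times powers of \<open>A\<close>.\<close>

lemma dI_expand:
  assumes S: "finite S" and aS: "a \<notin> S" and A: "kern M f M g A" and Q: "kern M f M g Q"
  shows "dI (insert a S) ((\<lambda>_. A)(a := Q))
    = ktrace M Q * dI S (\<lambda>_. A) - (\<Sum>b\<in>S. dI (insert a (S - {b})) ((\<lambda>_. A)(a := kcomp M Q A)))"
proof -
  let ?I = "\<lambda>p. (\<integral>x. (\<Prod>i\<in>insert a S. ((\<lambda>_. A)(a := Q)) i (x i) (x (p i))) \<partial>PM (insert a S))"
  have QA: "kern M f M g (kcomp M Q A)" by (rule kern_kcomp[OF Q A])
  have perm: "permutation p" if "p permutes S" for p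
    using that S by (auto simp: permutation_permutes)
  have "dI (insert a S) ((\<lambda>_. A)(a := Q)) = (\<Sum>p | p permutes insert a S. of_int (sign p) * ?I p)"
    by (rule dI_eq_sum) (use S A Q in auto)
  also have "\<dots> = (\<Sum>b\<in>insert a S. \<Sum>q | q permutes S. of_int (sign (Transposition.transpose a b \<circ> q)) * ?I (Transposition.transpose a b \<circ> q))"
    by (rule sum_over_permutations_insert[OF S aS])
  also have "\<dots> = (\<Sum>q | q permutes S. of_int (sign q) * ?I q)
      + (\<Sum>b\<in>S. \<Sum>q | q permutes S. of_int (sign (Transposition.transpose a b \<circ> q)) * ?I (Transposition.transpose a b \<circ> q))"
    using S aS by simp
  also have "(\<Sum>q | q permutes S. of_int (sign q) * ?I q) = ktrace M Q * dI S (\<lambda>_. A)"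
    unfolding dI_eq_sum[OF S A, simplified] sum_distrib_left
    by (intro sum.cong refl) (simp add: integrate_out_fixed[OF S aS _ A Q, simplified] mult.left_commute)
  also have "(\<Sum>b\<in>S. \<Sum>q | q permutes S. of_int (sign (Transposition.transpose a b \<circ> q)) * ?I (Transposition.transpose a b \<circ> q))
      = (\<Sum>b\<in>S. - dI (insert a (S - {b})) ((\<lambda>_. A)(a := kcomp M Q A)))"
  proof (rule sum.cong[OF refl])
    fix b assume b: "b \<in> S"
    define t where "t = Transposition.transpose a b"
    define J where "J = insert a (S - {b})"
    have ab: "a \<noteq> b" using aS b by auto
    have tt2: "t (t y) = y" for y by (simp add: t_def)
    have tS: "t ` S = J" and tJ: "t ` J = S"
      using aS b by (auto simp: t_def J_def Transposition.transpose_def image_iff split: if_splits)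
    \<comment> \<open>The surviving permutations are reindexed by conjugation with the involution
      \<open>t\<close>, which preserves the sign and carries permutations of \<open>S\<close> to
      permutations of \<open>J\<close>.\<close>
    have conj: "(t \<circ> q \<circ> t) permutes t ` X" if q: "q permutes X" for q X
    proof -
      have "bij (t \<circ> q \<circ> t)"
        by (intro bij_comp permutes_bij[OF q]) (auto simp: t_def)
      moreover have "(t \<circ> q \<circ> t) x = x" if "x \<notin> t ` X" for x
      proof -
        have "t x \<notin> X" using that tt2 by (metis image_eqI)
        then show ?thesis using q by (simp add: permutes_not_in) (simp add: t_def)
      qed
      ultimately show ?thesis by (simp only: permutes_def bij_iff) simp
    qed
    let ?G = "\<lambda>p. (\<integral>x. (\<Prod>i\<in>J. ((\<lambda>_. A)(a := kcomp M Q A)) i (x i) (x (p i))) \<partial>PM J)"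
    have "(\<Sum>q | q permutes S. of_int (sign (t \<circ> q)) * ?I (t \<circ> q))
        = (\<Sum>q | q permutes S. - (of_int (sign (t \<circ> q \<circ> t)) * ?G (t \<circ> q \<circ> t)))"
    proof (rule sum.cong[OF refl])
      fix q assume "q \<in> {q. q permutes S}"
      then have q: "q permutes S" by simp
      have "sign (t \<circ> q) = - sign q" "sign (t \<circ> q \<circ> t) = sign q"
        using ab perm[OF q] unfolding t_def
        by (simp_all add: sign_compose permutation_compose permutation_swap_id sign_swap_id)
      moreover have "?I (t \<circ> q) = ?G (t \<circ> q \<circ> t)"
        unfolding t_def J_def by (rule integrate_out_next[OF S aS b q A Q])
      ultimately show "of_int (sign (t \<circ> q)) * ?I (t \<circ> q) = - (of_int (sign (t \<circ> q \<circ> t)) * ?G (t \<circ> q \<circ> t))"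
        by simp
    qed
    also have "\<dots> = - (\<Sum>p | p permutes J. of_int (sign p) * ?G p)"
      unfolding sum_negf
    proof (intro arg_cong[of _ _ uminus] sum.reindex_bij_witness[where i = "\<lambda>p. t \<circ> p \<circ> t" and j = "\<lambda>q. t \<circ> q \<circ> t"])
      show "t \<circ> (t \<circ> q \<circ> t) \<circ> t = q" for q
        by (rule ext) (simp add: tt2)
      then show "t \<circ> (t \<circ> q \<circ> t) \<circ> t = q" for q .
      show "t \<circ> p \<circ> t \<in> {q. q permutes S}" if "p \<in> {p. p permutes J}" for p
        using conj[of p J] that by (simp add: tJ)
      show "t \<circ> q \<circ> t \<in> {p. p permutes J}" if "q \<in> {q. q permutes S}" for q
        using conj[of q S] that by (simp add: tS)
    qed simp
    also have "\<dots> = - dI J ((\<lambda>_. A)(a := kcomp M Q A))"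
      by (subst dI_eq_sum) (use S A QA in \<open>auto simp: J_def\<close>)
    finally show "(\<Sum>q | q permutes S. of_int (sign (Transposition.transpose a b \<circ> q)) * ?I (Transposition.transpose a b \<circ> q))
        = - dI (insert a (S - {b})) ((\<lambda>_. A)(a := kcomp M Q A))"
      unfolding t_def J_def .
  qed
  finally show ?thesis unfolding sum_negf by (simp only: diff_conv_add_uminus)
qed

end

section \<open>Hadamard estimates and convergence of the Fredholm series\<close>

lemma power_le_fact_exp: "real m ^ m \<le> fact m * exp (real m)"
proof -
  have "real m ^ m / fact m \<le> (\<Sum>n. real m ^ n /\<^sub>R fact n)"
    using sum_le_suminf[OF summable_exp_generic[of "real m"], of "{m}"]
    by (simp add: divide_inverse_commute)
  then show ?thesis
    by (simp add: exp_def field_simps)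
qed

text \<open>By m^m \<le> m! e^m the square root of m^m costs only half of the factorial, and the
  remaining 1 / sqrt(m!) still beats every geometric growth.\<close>

lemma summable_hadamard_bound: "summable (\<lambda>m. K ^ m * sqrt (real m) ^ m / fact m :: real)"
proof -
  define L where "L = \<bar>K\<bar> * exp (1 / 2)"
  have L: "0 \<le> L" by (simp add: L_def)
  have bd: "norm (K ^ m * sqrt (real m) ^ m / fact m) \<le> L ^ m / sqrt (fact m)" for m
  proof -
    have "sqrt (real m) ^ m = sqrt (real m ^ m)" by (simp add: real_sqrt_power)
    also have "\<dots> \<le> sqrt (fact m * exp (real m))"
      by (rule real_sqrt_le_mono[OF power_le_fact_exp])
    also have "\<dots> = sqrt (fact m) * exp (1 / 2) ^ m"
    proof -
      have "sqrt (exp (real m)) = exp (1 / 2) ^ m"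
        by (rule real_sqrt_unique) (simp_all add: power_mult[symmetric] exp_of_nat_mult[symmetric])
      then show ?thesis by (simp add: real_sqrt_mult)
    qed
    finally have "\<bar>K\<bar> ^ m * sqrt (real m) ^ m / fact m \<le> \<bar>K\<bar> ^ m * (sqrt (fact m) * exp (1 / 2) ^ m) / fact m"
      by (intro divide_right_mono mult_left_mono) auto
    also have "\<dots> = L ^ m * (sqrt (fact m) / fact m)"
      by (simp add: L_def power_mult_distrib)
    also have "sqrt (fact m) / fact m = 1 / (sqrt (fact m) :: real)"
      by (simp add: field_simps)
    finally show ?thesis by (simp add: power_abs abs_mult)
  qed
  have "summable (\<lambda>m. L ^ m / sqrt (fact m))"
  proof (rule summable_ratio_test[of "1 / 2"])
    \<comment> \<open>From this index on, the ratio \<open>L / sqrt (Suc m)\<close> of consecutive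
      terms is at most 1/2.\<close>
    fix m assume "nat \<lceil>(2 * L)\<^sup>2\<rceil> \<le> m"
    then have "(2 * L)\<^sup>2 \<le> real (Suc m)" by linarith
    then have "sqrt ((2 * L)\<^sup>2) \<le> sqrt (real (Suc m))" by (rule real_sqrt_le_mono)
    moreover have "sqrt ((2 * L)\<^sup>2) = 2 * L" by (rule real_sqrt_unique) (use L in auto)
    ultimately have "2 * L \<le> sqrt (real (Suc m))" by (simp only:)
    then have "L / sqrt (real (Suc m)) \<le> 1 / 2" by (simp add: divide_simps)
    then have "(L / sqrt (real (Suc m))) * (L ^ m / sqrt (fact m)) \<le> (1 / 2) * (L ^ m / sqrt (fact m))"
      using L by (intro mult_right_mono) auto
    then show "norm (L ^ Suc m / sqrt (fact (Suc m))) \<le> 1 / 2 * norm (L ^ m / sqrt (fact m))"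
      using L by (simp add: real_sqrt_mult)
  qed simp
  then show ?thesis
    by (rule summable_comparison_test[rotated]) (use bd in auto)
qed

context weighted_space
begin

text \<open>Dividing entry (i, j) by its bound \<open>c i j\<close> leaves entries of modulus at
  most 1, to which Hadamard's bound applies, and takes the same factor out of every permutation
  term.\<close>

lemma pdet_bound:
  assumes C: "0 \<le> C"
    and R: "\<And>i x y. i < m \<Longrightarrow> x \<in> space M \<Longrightarrow> y \<in> space M \<Longrightarrow> norm (R i x y) \<le> C * (f x * g y)"
    and x: "x \<in> space (PM {..<m})"
  shows "norm (pdet {..<m} R x) \<le> C ^ m * sqrt (real m) ^ m * (\<Prod>i<m. f (x i) * g (x i))"
proof -
  have xi: "x i \<in> space M" if "i < m" for i
    using x that by (auto simp: space_PiM)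
  define c where "c i j = C * (f (x i) * g (x j))" for i j
  have c: "0 \<le> c i j" for i j
    using C f_nonneg g_nonneg by (simp add: c_def)
  define B where "B = mat m m (\<lambda>(i, j). R i (x i) (x j) / of_real (c i j))"
  have B: "B \<in> carrier_mat m m" by (simp add: B_def)
  have Rc: "norm (R i (x i) (x j)) \<le> c i j" if "i < m" "j < m" for i j
    using R[of i "x i" "x j"] xi that by (simp add: c_def)
  \<comment> \<open>Where a weight vanishes so does the entry, and the quotient has the default
    value 0; the factorization survives.\<close>
  have RB: "R i (x i) (x j) = of_real (c i j) * B $$ (i, j)" if "i < m" "j < m" for i j
    using Rc[OF that] that by (cases "c i j = 0") (auto simp: B_def)
  have "norm (Determinant.det B) \<le> sqrt (real m) ^ m"
  proof (rule norm_det_le[OF B])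
    fix i j assume "i < m" "j < m"
    then show "norm (B $$ (i, j)) \<le> 1"
      using Rc c[of i j] by (auto simp: B_def norm_divide divide_le_eq_1)
  qed
  moreover have "pdet {..<m} R x = of_real (C ^ m * (\<Prod>i<m. f (x i) * g (x i))) * Determinant.det B"
  proof -
    have "(\<Prod>i<m. R i (x i) (x (p i))) = of_real (C ^ m * (\<Prod>i<m. f (x i) * g (x i))) * (\<Prod>i<m. B $$ (i, p i))"
      if p: "p permutes {..<m}" for p
    proof -
      have "(\<Prod>i<m. R i (x i) (x (p i))) = (\<Prod>i<m. of_real (c i (p i)) * B $$ (i, p i))"
        using permutes_in_image[OF p] by (intro prod.cong RB) auto
      also have "\<dots> = of_real (\<Prod>i<m. c i (p i)) * (\<Prod>i<m. B $$ (i, p i))"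
        by (simp add: prod.distrib)
      also have "(\<Prod>i<m. c i (p i)) = C ^ m * (\<Prod>i<m. f (x i) * g (x (p i)))"
        unfolding c_def by (subst prod.distrib) simp
      also have "(\<Prod>i<m. f (x i) * g (x (p i))) = (\<Prod>i<m. f (x i) * g (x i))"
        by (rule prod_permutes_weight[OF p])
      finally show ?thesis .
    qed
    then show ?thesis
      unfolding pdet_def det_def'[OF B] sum_distrib_left
      by (intro sum.cong) (auto simp: lessThan_atLeast0)
  qed
  moreover have "0 \<le> C ^ m * (\<Prod>i<m. f (x i) * g (x i))"
    using C f_nonneg g_nonneg by (intro mult_nonneg_nonneg prod_nonneg) auto
  ultimately have "norm (pdet {..<m} R x) \<le> (C ^ m * (\<Prod>i<m. f (x i) * g (x i))) * sqrt (real m) ^ m"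
    by (simp only: norm_mult norm_of_real abs_of_nonneg mult_left_mono)
  then show ?thesis by (simp only: ac_simps)
qed

abbreviation (input) weight_mass :: real where "weight_mass \<equiv> (\<integral>z. f z * g z \<partial>M)"

lemma dI_bound:
  assumes C: "0 \<le> C"
    and R: "\<And>i x y. i < m \<Longrightarrow> x \<in> space M \<Longrightarrow> y \<in> space M \<Longrightarrow> norm (R i x y) \<le> C * (f x * g y)"
    and kR: "\<And>i. i < m \<Longrightarrow> kern M f M g (R i)"
  shows "norm (dI {..<m} R) \<le> (C * weight_mass) ^ m * sqrt (real m) ^ m"
    and "(\<integral>x. norm (pdet {..<m} R x) \<partial>PM {..<m}) \<le> (C * weight_mass) ^ m * sqrt (real m) ^ m"
proof -
  have int: "integrable (PM {..<m}) (pdet {..<m} R)"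
    using kR by (intro pdet_integrable) auto
  have "(\<integral>x. norm (pdet {..<m} R x) \<partial>PM {..<m})
      \<le> (\<integral>x. C ^ m * sqrt (real m) ^ m * (\<Prod>i<m. f (x i) * g (x i)) \<partial>PM {..<m})"
    using int weight_integrable[of "{..<m}"]
    by (intro integral_mono integrable_norm integrable_mult_right pdet_bound C R) auto
  also have "\<dots> = (C * weight_mass) ^ m * sqrt (real m) ^ m"
    using weight_integral[of "{..<m}"] by (simp add: power_mult_distrib)
  finally show le: "(\<integral>x. norm (pdet {..<m} R x) \<partial>PM {..<m}) \<le> (C * weight_mass) ^ m * sqrt (real m) ^ m" .
  show "norm (dI {..<m} R) \<le> (C * weight_mass) ^ m * sqrt (real m) ^ m"
    unfolding dI_def by (rule order_trans[OF integral_norm_bound le])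
qed

lemma fredholm_det_eq_dI: "fredholm_det M A = (\<Sum>m. (- 1) ^ m / fact m * dI {..<m} (\<lambda>_. A))"
  unfolding fredholm_det_def dI_def by (simp add: fredholm_minor_eq_pdet[abs_def])

lemma fredholm_convergent_kern:
  assumes A: "kern M f M g A"
  shows "fredholm_convergent M A"
proof -
  obtain C where C: "0 \<le> C" "\<And>x y. x \<in> space M \<Longrightarrow> y \<in> space M \<Longrightarrow> norm (A x y) \<le> C * (f x * g y)"
    using A unfolding kern_def by blast
  have "summable (\<lambda>m. (\<integral>x. norm (pdet {..<m} (\<lambda>_. A) x) \<partial>PM {..<m}) / fact m)"
  proof (rule summable_comparison_test'[OF summable_hadamard_bound[of "C * weight_mass"], of 0])
    fix m
    show "norm ((\<integral>x. norm (pdet {..<m} (\<lambda>_. A) x) \<partial>PM {..<m}) / fact m)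
        \<le> (C * weight_mass) ^ m * sqrt (real m) ^ m / fact m"
      using dI_bound(2)[OF C(1), of m "\<lambda>_. A"] C(2) A
      by (simp add: divide_right_mono)
  qed
  moreover have "fredholm_minor A m = pdet {..<m} (\<lambda>_. A)" for m
    by (rule ext) (rule fredholm_minor_eq_pdet)
  ultimately show ?thesis
    unfolding fredholm_convergent_def using A by (auto intro: pdet_integrable)
qed

lemma fredholm_series_summable:
  assumes A: "kern M f M g A"
  shows "summable (\<lambda>m. (- 1) ^ m / fact m * dI {..<m} (\<lambda>_. A))"
proof (rule summable_norm_cancel, rule summable_comparison_test')
  show "summable (\<lambda>m. (\<integral>x. norm (fredholm_minor A m x) \<partial>PM {..<m}) / fact m)"
    using fredholm_convergent_kern[OF A] by (simp add: fredholm_convergent_def)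
  show "norm (norm ((- 1) ^ m / fact m * dI {..<m} (\<lambda>_. A)))
      \<le> (\<integral>x. norm (fredholm_minor A m x) \<partial>PM {..<m}) / fact m" if "0 \<le> m" for m
    unfolding dI_def fredholm_minor_eq_pdet[abs_def]
    by (simp add: norm_mult norm_divide norm_power divide_right_mono integral_norm_bound)
qed

lemma dI_empty: "dI {} R = 1"
  unfolding dI_def pdet_def by (simp add: PiM_empty lebesgue_integral_count_space_finite)

end

text \<open>By \<open>dI_expand\<close>, these integrals are universal polynomials in the traces of the words below.\<close>

lemma dI_eq_of_traces:
  assumes w1: "weighted_space M1 f1 g1" and w2: "weighted_space M2 f2 g2"
    and A1: "kern M1 f1 M1 g1 A1" and A2: "kern M2 f2 M2 g2 A2"
    and trA: "\<And>k. ktrace M1 (((\<lambda>Q. kcomp M1 Q A1) ^^ k) A1) = ktrace M2 (((\<lambda>Q. kcomp M2 Q A2) ^^ k) A2)"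
  shows "finite S1 \<Longrightarrow> finite S2 \<Longrightarrow> card S1 = card S2 \<Longrightarrow> a1 \<notin> S1 \<Longrightarrow> a2 \<notin> S2 \<Longrightarrow>
    kern M1 f1 M1 g1 Q1 \<Longrightarrow> kern M2 f2 M2 g2 Q2 \<Longrightarrow>
    (\<And>k. ktrace M1 (((\<lambda>Q. kcomp M1 Q A1) ^^ k) Q1) = ktrace M2 (((\<lambda>Q. kcomp M2 Q A2) ^^ k) Q2)) \<Longrightarrow>
    weighted_space.dI M1 (insert a1 S1) ((\<lambda>_. A1)(a1 := Q1))
      = weighted_space.dI M2 (insert a2 S2) ((\<lambda>_. A2)(a2 := Q2))"
proof (induction "card S1" arbitrary: S1 S2 a1 a2 Q1 Q2 rule: less_induct)
  case less
  interpret W1: weighted_space M1 f1 g1 by fact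
  interpret W2: weighted_space M2 f2 g2 by fact
  have step: "W1.dI (insert a1' (S1 - {b1})) ((\<lambda>_. A1)(a1' := Q1')) = W2.dI (insert a2' (S2 - {b2})) ((\<lambda>_. A2)(a2' := Q2'))"
    if "b1 \<in> S1" "b2 \<in> S2" "a1' \<notin> S1 - {b1}" "a2' \<notin> S2 - {b2}" "kern M1 f1 M1 g1 Q1'" "kern M2 f2 M2 g2 Q2'"
      "\<And>k. ktrace M1 (((\<lambda>Q. kcomp M1 Q A1) ^^ k) Q1') = ktrace M2 (((\<lambda>Q. kcomp M2 Q A2) ^^ k) Q2')"
    for b1 b2 a1' a2' Q1' Q2'
    by (rule less.hyps[OF card_Diff1_less[OF less.prems(1)]])
      ((use less.prems(1-3) that(1,2) in auto)[4], (rule that)+)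
  \<comment> \<open>When all rows are \<open>A\<close>, any one of them can play the distinguished
    row with \<open>Q = A\<close>; the index set then loses an element and the induction hypothesis
    applies.\<close>
  have dI_eq: "W1.dI S1 (\<lambda>_. A1) = W2.dI S2 (\<lambda>_. A2)"
  proof (cases "S1 = {}")
    case True
    then have "S2 = {}" using less.prems(2,3) by simp
    with True show ?thesis by (simp add: W1.dI_empty W2.dI_empty)
  next
    case False
    then obtain b1 where b1: "b1 \<in> S1" by blast
    obtain b2 where b2: "b2 \<in> S2"
      using False less.prems(1,2,3) by fastforce
    have "W1.dI (insert b1 (S1 - {b1})) ((\<lambda>_. A1)(b1 := A1)) = W2.dI (insert b2 (S2 - {b2})) ((\<lambda>_. A2)(b2 := A2))"
      by (rule step) (use b1 b2 A1 A2 trA in auto)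
    moreover have "((\<lambda>_. A1)(b1 := A1)) = (\<lambda>_. A1)" "((\<lambda>_. A2)(b2 := A2)) = (\<lambda>_. A2)"
      by auto
    ultimately show ?thesis
      using b1 b2 by (simp add: insert_absorb)
  qed
  \<comment> \<open>The induction hypothesis sees only the cardinality of the index sets, so the
    summands may be matched by any bijection.\<close>
  obtain h where h: "bij_betw h S1 S2"
    using less.prems(1,2,3) finite_same_card_bij by blast
  have "(\<Sum>b\<in>S1. W1.dI (insert a1 (S1 - {b})) ((\<lambda>_. A1)(a1 := kcomp M1 Q1 A1)))
      = (\<Sum>b\<in>S1. W2.dI (insert a2 (S2 - {h b})) ((\<lambda>_. A2)(a2 := kcomp M2 Q2 A2)))"
  proof (rule sum.cong[OF refl], rule step)
    fix b assume "b \<in> S1"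
    then show "h b \<in> S2" using h by (auto simp: bij_betw_def)
    show "ktrace M1 (((\<lambda>Q. kcomp M1 Q A1) ^^ k) (kcomp M1 Q1 A1)) = ktrace M2 (((\<lambda>Q. kcomp M2 Q A2) ^^ k) (kcomp M2 Q2 A2))" for k
      using less.prems(8)[of "Suc k"] by (simp only: funpow_Suc_right o_apply)
  qed (use less.prems A1 A2 in \<open>auto intro: W1.kern_kcomp W2.kern_kcomp\<close>)
  also have "\<dots> = (\<Sum>b\<in>S2. W2.dI (insert a2 (S2 - {b})) ((\<lambda>_. A2)(a2 := kcomp M2 Q2 A2)))"
    by (rule sum.reindex_bij_betw[OF h])
  finally show ?case
    unfolding W1.dI_expand[OF less.prems(1,4) A1 less.prems(6)] W2.dI_expand[OF less.prems(2,5) A2 less.prems(7)]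
    using dI_eq less.prems(8)[of 0] by simp
qed

lemma fredholm_det_eq_of_traces:
  assumes w1: "weighted_space M1 f1 g1" and w2: "weighted_space M2 f2 g2"
    and A1: "kern M1 f1 M1 g1 A1" and A2: "kern M2 f2 M2 g2 A2"
    and trA: "\<And>k. ktrace M1 (((\<lambda>Q. kcomp M1 Q A1) ^^ k) A1) = ktrace M2 (((\<lambda>Q. kcomp M2 Q A2) ^^ k) A2)"
  shows "fredholm_det M1 A1 = fredholm_det M2 A2"
proof -
  interpret W1: weighted_space M1 f1 g1 by fact
  interpret W2: weighted_space M2 f2 g2 by fact
  have "W1.dI {..<m} (\<lambda>_. A1) = W2.dI {..<m} (\<lambda>_. A2)" for m
  proof (cases m)
    case 0
    then show ?thesis by (simp add: W1.dI_empty W2.dI_empty)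
  next
    case (Suc k)
    have "W1.dI (insert k {..<k}) ((\<lambda>_. A1)(k := A1)) = W2.dI (insert k {..<k}) ((\<lambda>_. A2)(k := A2))"
      by (rule dI_eq_of_traces[OF w1 w2 A1 A2 trA]) (use A1 A2 trA in auto)
    moreover have "((\<lambda>_. A1)(k := A1)) = (\<lambda>_. A1)" "((\<lambda>_. A2)(k := A2)) = (\<lambda>_. A2)"
      by auto
    ultimately show ?thesis
      using Suc by (simp add: lessThan_Suc)
  qed
  then show ?thesis
    by (simp add: W1.fredholm_det_eq_dI W2.fredholm_det_eq_dI)
qed

text \<open>With V_k = R (P R)^k one has (P R)^(k+1) = P V_k and (R P)^(k+1) = V_k P. Their traces
  agree by Fubini, hence so do the determinants, although the two operators live on different
  spaces.\<close>

lemma fredholm_det_cyclic: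
  assumes w1: "weighted_space M1 f1 g1" and w2: "weighted_space M2 f2 g2"
    and P: "kern M1 f1 M2 g2 P" and R: "kern M2 f2 M1 g1 R"
  shows "fredholm_det M1 (kcomp M2 P R) = fredholm_det M2 (kcomp M1 R P)"
proof -
  interpret W1: weighted_space M1 f1 g1 by fact
  interpret W2: weighted_space M2 f2 g2 by fact
  let ?A1 = "kcomp M2 P R" and ?A2 = "kcomp M1 R P"
  have A1: "kern M1 f1 M1 g1 ?A1" by (rule W2.kern_kcomp[OF P R])
  have A2: "kern M2 f2 M2 g2 ?A2" by (rule W1.kern_kcomp[OF R P])
  define V where "V k = ((\<lambda>V. kcomp M1 V ?A1) ^^ k) R" for k
  have VSuc: "V (Suc k) = kcomp M1 (V k) ?A1" for k by (simp add: V_def)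
  have V: "kern M2 f2 M1 g1 (V k)" for k
  proof (induction k)
    case (Suc k)
    then show ?case unfolding VSuc by (rule W1.kern_kcomp[OF _ A1])
  qed (simp add: V_def R)
  have pow1: "((\<lambda>Q. kcomp M1 Q ?A1) ^^ k) ?A1 x y = kcomp M2 P (V k) x y"
    if "x \<in> space M1" "y \<in> space M1" for k x y
    using that
  proof (induction k arbitrary: x y)
    case (Suc k)
    have "((\<lambda>Q. kcomp M1 Q ?A1) ^^ Suc k) ?A1 x y = kcomp M1 (kcomp M2 P (V k)) ?A1 x y"
      unfolding funpow.simps o_apply by (rule kcomp_cong) (use Suc in auto)
    also have "\<dots> = kcomp M2 P (V (Suc k)) x y"
      unfolding VSuc by (rule W2.kcomp_assoc[OF w1 P V A1 Suc.prems])
    finally show ?case .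
  qed (simp add: V_def)
  have pow2: "((\<lambda>Q. kcomp M2 Q ?A2) ^^ k) ?A2 x y = kcomp M1 (V k) P x y"
    if "x \<in> space M2" "y \<in> space M2" for k x y
    using that
  proof (induction k arbitrary: x y)
    case (Suc k)
    have "((\<lambda>Q. kcomp M2 Q ?A2) ^^ Suc k) ?A2 x y = kcomp M2 (kcomp M1 (V k) P) ?A2 x y"
      unfolding funpow.simps o_apply by (rule kcomp_cong) (use Suc in auto)
    also have "\<dots> = kcomp M1 (V k) (kcomp M2 P ?A2) x y"
      by (rule W1.kcomp_assoc[OF w2 V P A2 Suc.prems])
    also have "\<dots> = kcomp M1 (V k) (kcomp M1 ?A1 P) x y"
      by (rule kcomp_cong[OF refl]) (rule W2.kcomp_assoc[OF w1 P R P _ Suc.prems(2), symmetric])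
    also have "\<dots> = kcomp M1 (V (Suc k)) P x y"
      unfolding VSuc by (rule W1.kcomp_assoc[OF w1 V A1 P Suc.prems, symmetric])
    finally show ?case .
  qed (simp add: V_def)
  show ?thesis
  proof (rule fredholm_det_eq_of_traces[OF w1 w2 A1 A2])
    fix k
    have "ktrace M1 (((\<lambda>Q. kcomp M1 Q ?A1) ^^ k) ?A1) = ktrace M1 (kcomp M2 P (V k))"
      by (rule ktrace_cong) (rule pow1)
    also have "\<dots> = ktrace M2 (kcomp M1 (V k) P)"
      by (rule W1.ktrace_kcomp_commute[OF w2 P V])
    also have "\<dots> = ktrace M2 (((\<lambda>Q. kcomp M2 Q ?A2) ^^ k) ?A2)"
      by (rule ktrace_cong) (rule pow2[symmetric])
    finally show "ktrace M1 (((\<lambda>Q. kcomp M1 Q ?A1) ^^ k) ?A1) = ktrace M2 (((\<lambda>Q. kcomp M2 Q ?A2) ^^ k) ?A2)" .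
  qed
qed

section \<open>Derivatives of the Fredholm coefficients and invariance under unipotent
  factors\<close>

definition row_mix :: "nat set \<Rightarrow> (nat \<Rightarrow> 'a \<Rightarrow> 'a \<Rightarrow> complex) \<Rightarrow> (nat \<Rightarrow> 'a \<Rightarrow> 'a \<Rightarrow> complex)
    \<Rightarrow> (nat \<Rightarrow> 'a \<Rightarrow> 'a \<Rightarrow> complex) \<Rightarrow> real \<Rightarrow> nat \<Rightarrow> 'a \<Rightarrow> 'a \<Rightarrow> complex" where
  "row_mix T U V R s = (\<lambda>i. if i \<in> T then (\<lambda>x y. U i x y + complex_of_real s * V i x y) else R i)"

context weighted_space
begin

lemma dI_row_add:
  assumes S: "finite S" and a: "a \<in> S" and R: "\<And>i. i \<in> S \<Longrightarrow> kern M f M g (R i)"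
    and U: "kern M f M g U" and V: "kern M f M g V"
  shows "dI S (R(a := \<lambda>x y. U x y + c * V x y)) = dI S (R(a := U)) + c * dI S (R(a := V))"
proof -
  have "pdet S (R(a := \<lambda>x y. U x y + c * V x y)) = (\<lambda>x. pdet S (R(a := U)) x + c * pdet S (R(a := V)) x)"
  proof
    fix x
    have "(\<Prod>i\<in>S. (R(a := W)) i (x i) (x (p i))) = W (x a) (x (p a)) * (\<Prod>i\<in>S - {a}. R i (x i) (x (p i)))" for W p
    proof -
      have "(\<Prod>i\<in>S - {a}. (R(a := W)) i (x i) (x (p i))) = (\<Prod>i\<in>S - {a}. R i (x i) (x (p i)))"
        by (intro prod.cong) auto
      then show ?thesis using prod.remove[OF S a, of "\<lambda>i. (R(a := W)) i (x i) (x (p i))"] by simp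
    qed
    then show "pdet S (R(a := \<lambda>x y. U x y + c * V x y)) x = pdet S (R(a := U)) x + c * pdet S (R(a := V)) x"
      unfolding pdet_def sum_distrib_left sum.distrib[symmetric]
      by (intro sum.cong refl) (simp add: algebra_simps del: fun_upd_apply)
  qed
  moreover have "integrable (PM S) (pdet S (R(a := U)))" "integrable (PM S) (pdet S (R(a := V)))"
    using S R U V by (auto intro!: pdet_integrable)
  ultimately show ?thesis
    unfolding dI_def by (simp del: fun_upd_apply)
qed

text \<open>Product rule for a multilinear function. The induction is over the set \<open>T\<close>
  of moving rows: row \<open>a\<close> is split into its fixed part and \<open>s\<close> times its
  direction, and in both parts only the rows in the smaller set still move.\<close>

lemma dI_has_derivative:
  assumes S: "finite S" and UV: "\<And>i. i \<in> S \<Longrightarrow> kern M f M g (U i)" "\<And>i. i \<in> S \<Longrightarrow> kern M f M g (V i)"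
  shows "finite T \<Longrightarrow> T \<subseteq> S \<Longrightarrow> (\<And>i. i \<in> S \<Longrightarrow> kern M f M g (R i)) \<Longrightarrow>
    ((\<lambda>s. dI S (row_mix T U V R s)) has_vector_derivative
      (\<Sum>b\<in>T. dI S ((row_mix T U V R s)(b := V b)))) (at s)"
proof (induction T arbitrary: R rule: finite_induct)
  case (insert a T)
  have aS: "a \<in> S" and TS: "T \<subseteq> S" using insert.prems by auto
  have kr: "kern M f M g (row_mix T' U V R' s i)"
    if "i \<in> S" "T' \<subseteq> S" "\<And>i. i \<in> S \<Longrightarrow> kern M f M g (R' i)" for T' R' s i
    using that UV by (auto simp: row_mix_def intro!: kern_add kern_scale)
  have kRa: "kern M f M g ((R(a := W)) i)" if "i \<in> S" "kern M f M g W" for i W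
    using that insert.prems(2) by auto
  have upd: "row_mix (insert a T) U V R s = (row_mix T U V R s)(a := \<lambda>x y. U a x y + complex_of_real s * V a x y)" for s
    by (auto simp: row_mix_def)
  have updW: "(row_mix T U V R s)(a := W) = row_mix T U V (R(a := W)) s"
      "(row_mix (insert a T) U V R s)(a := W) = row_mix T U V (R(a := W)) s" for s W
    using insert.hyps(2) by (auto simp: row_mix_def)
  have eq: "dI S (row_mix (insert a T) U V R s)
      = dI S (row_mix T U V (R(a := U a)) s) + of_real s * dI S (row_mix T U V (R(a := V a)) s)" for s
    unfolding upd updW(1)[symmetric]
    by (rule dI_row_add[OF S aS]) (use UV aS kr[OF _ TS insert.prems(2)] in auto)
  have eq2: "dI S ((row_mix (insert a T) U V R s)(b := V b))
      = dI S ((row_mix T U V (R(a := U a)) s)(b := V b)) + of_real s * dI S ((row_mix T U V (R(a := V a)) s)(b := V b))"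
    if b: "b \<in> T" for b
  proof -
    have ab: "a \<noteq> b" using b insert.hyps(2) by auto
    have kb: "kern M f M g (((row_mix T U V R s)(b := V b)) i)" if "i \<in> S" for i
      using kr[OF that TS insert.prems(2)] UV(2) that by auto
    show ?thesis
      using dI_row_add[OF S aS kb UV(1)[OF aS] UV(2)[OF aS], where c = "of_real s"]
      unfolding upd updW(1)[symmetric] by (simp only: fun_upd_twist[OF ab])
  qed
  have IH: "((\<lambda>s. dI S (row_mix T U V (R(a := W)) s)) has_vector_derivative
      (\<Sum>b\<in>T. dI S ((row_mix T U V (R(a := W)) s)(b := V b)))) (at s)" if "kern M f M g W" for W
    by (rule insert.IH[OF TS]) (rule kRa[OF _ that])
  have "(complex_of_real has_vector_derivative of_real 1) (at s)"
    by (rule bounded_linear.has_vector_derivative[OF bounded_linear_of_real has_vector_derivative_id])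
  then have of_real_deriv: "(complex_of_real has_vector_derivative 1) (at s)" by simp
  have "((\<lambda>s. dI S (row_mix T U V (R(a := U a)) s) + of_real s * dI S (row_mix T U V (R(a := V a)) s)) has_vector_derivative
      (\<Sum>b\<in>T. dI S ((row_mix T U V (R(a := U a)) s)(b := V b)))
      + (of_real s * (\<Sum>b\<in>T. dI S ((row_mix T U V (R(a := V a)) s)(b := V b)))
         + 1 * dI S (row_mix T U V (R(a := V a)) s))) (at s)"
    by (intro has_vector_derivative_add has_vector_derivative_mult IH UV aS of_real_deriv)
  moreover have "(\<Sum>b\<in>insert a T. dI S ((row_mix (insert a T) U V R s)(b := V b)))
      = (\<Sum>b\<in>T. dI S ((row_mix T U V (R(a := U a)) s)(b := V b)))
      + (of_real s * (\<Sum>b\<in>T. dI S ((row_mix T U V (R(a := V a)) s)(b := V b)))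
         + 1 * dI S (row_mix T U V (R(a := V a)) s))"
    using insert.hyps by (simp add: eq2 updW(2) sum.distrib sum_distrib_left del: fun_upd_apply)
  ultimately show ?case
    unfolding eq by (simp only:)
qed (simp add: row_mix_def)

text \<open>Multiplying \<open>I - A\<close> by the unipotent operator \<open>I - E\<close>. Along the segment
  \<open>A + s (E - E A)\<close> the derivative of the partial sums telescopes, because \<open>E\<close> composed with the
  kernel does not depend on \<open>s\<close>.\<close>

lemma fredholm_det_shear:
  assumes A: "kern M f M g A" and E: "kern M f M g E" and trE: "ktrace M E = 0"
    and EE: "\<And>x y. x \<in> space M \<Longrightarrow> y \<in> space M \<Longrightarrow> kcomp M E E x y = 0"
  shows "fredholm_det M (\<lambda>x y. A x y + (E x y - kcomp M E A x y)) = fredholm_det M A"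
proof -
  define F where "F = kcomp M E A"
  have F: "kern M f M g F" unfolding F_def by (rule kern_kcomp[OF E A])
  define Q where "Q = (\<lambda>x y. E x y - F x y)"
  have Q: "kern M f M g Q" unfolding Q_def by (rule kern_diff[OF E F])
  define As where "As s = (\<lambda>x y. A x y + complex_of_real s * Q x y)" for s
  have As: "kern M f M g (As s)" for s
    unfolding As_def by (intro kern_add kern_scale A Q)
  have EAs: "kcomp M E (As s) x y = F x y" if x: "x \<in> space M" and y: "y \<in> space M" for s x y
  proof -
    have "kcomp M E F x y = kcomp M (kcomp M E E) A x y"
      unfolding F_def by (rule kcomp_assoc[OF weighted_space_axioms E E A x y, symmetric])
    also have "\<dots> = kcomp M (\<lambda>_ _. 0) A x y"
      using EE x by (intro kcomp_cong) auto
    finally have EF: "kcomp M E F x y = 0" by (simp add: kcomp_def)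
    have "kcomp M E (As s) x y = kcomp M E A x y + kcomp M E (\<lambda>x y. complex_of_real s * Q x y) x y"
      unfolding As_def by (rule kcomp_add_right[OF E A kern_scale[OF Q] x y])
    also have "kcomp M E (\<lambda>x y. complex_of_real s * Q x y) x y = of_real s * (kcomp M E E x y - kcomp M E F x y)"
      unfolding kcomp_scale_right Q_def by (simp add: kcomp_diff_right[OF E E F x y])
    finally show ?thesis
      using EF EE[OF x y] by (simp add: F_def)
  qed
  define J where "J s m = dI (insert m {..<m}) ((\<lambda>_. As s)(m := F))" for s m
  have J_eq: "dI (insert a S) ((\<lambda>_. As s)(a := F)) = J s m" if "finite S" "card S = m" "a \<notin> S" for a S s m
    unfolding J_def
    by (rule dI_eq_of_traces[OF weighted_space_axioms weighted_space_axioms As As]) (use that F in auto)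
  \<comment> \<open>Expansion along the row \<open>E\<close>: the trace term is zero, and each of
    the \<open>m\<close> other terms has the row \<open>E\<close> composed with \<open>As s\<close>,
    which is \<open>F\<close>, on one variable fewer. The row \<open>- F\<close> contributes the
    last term. For \<open>m = 0\<close> the factor 0 makes the truncated \<open>m - 1\<close>
    harmless.\<close>
  have row: "dI (insert a S) ((\<lambda>_. As s)(a := Q)) = - (of_nat m * J s (m - 1)) - J s m"
    if S: "finite S" "card S = m" "a \<notin> S" for a S s m
  proof -
    have "dI (insert a S) ((\<lambda>_. As s)(a := \<lambda>x y. E x y + (-1) * F x y))
        = dI (insert a S) ((\<lambda>_. As s)(a := E)) + (-1) * dI (insert a S) ((\<lambda>_. As s)(a := F))"
      by (rule dI_row_add) (use S As E F in auto)
    moreover have "(\<lambda>x y. E x y + (-1) * F x y) = Q" by (simp add: Q_def)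
    moreover have "dI (insert a S) ((\<lambda>_. As s)(a := E)) = - (\<Sum>b\<in>S. J s (m - 1))"
    proof -
      have "dI (insert a (S - {b})) ((\<lambda>_. As s)(a := kcomp M E (As s))) = J s (m - 1)" if "b \<in> S" for b
      proof -
        have "dI (insert a (S - {b})) ((\<lambda>_. As s)(a := kcomp M E (As s))) = dI (insert a (S - {b})) ((\<lambda>_. As s)(a := F))"
          by (rule dI_cong) (auto simp: EAs)
        also have "\<dots> = J s (m - 1)"
          by (rule J_eq) (use S that in auto)
        finally show ?thesis .
      qed
      then show ?thesis
        using dI_expand[OF S(1,3) As E] trE by simp
    qed
    ultimately show ?thesis
      using J_eq[OF S] S by simp
  qed
  define D where "D s m = (- 1) ^ m / fact m * dI {..<m} (\<lambda>_. As s)" for s m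
  define c where "c s m = (- 1) ^ m / fact m * J s m" for s m
  \<comment> \<open>All \<open>Suc m\<close> rows contribute equally, which reduces the factorial,
    and the result is a difference of consecutive \<open>c\<close>. The case \<open>m = 0\<close> is
    separate because \<open>m - 1\<close> would again be 0.\<close>
  have dD: "((\<lambda>s. D s (Suc m)) has_vector_derivative (if m = 0 then c s 0 else c s m - c s (m - 1))) (at s)" for m s
  proof -
    define r where "r = row_mix {..<Suc m} (\<lambda>_. A) (\<lambda>_. Q) (\<lambda>_. A)"
    have "((\<lambda>s. dI {..<Suc m} (r s)) has_vector_derivative (\<Sum>b<Suc m. dI {..<Suc m} ((r s)(b := Q)))) (at s)"
      unfolding r_def by (rule dI_has_derivative) (use A Q in auto)
    moreover have "dI {..<Suc m} (r s) = dI {..<Suc m} (\<lambda>_. As s)" for s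
      by (rule dI_cong) (simp add: As_def r_def row_mix_def)
    moreover have "dI {..<Suc m} ((r s)(b := Q)) = - (of_nat m * J s (m - 1)) - J s m" if b: "b < Suc m" for b
    proof -
      have "dI {..<Suc m} ((r s)(b := Q)) = dI {..<Suc m} ((\<lambda>_. As s)(b := Q))"
        by (rule dI_cong) (simp add: As_def r_def row_mix_def)
      also have "\<dots> = dI (insert b ({..<Suc m} - {b})) ((\<lambda>_. As s)(b := Q))"
        using b by (simp add: insert_absorb del: fun_upd_apply)
      also have "\<dots> = - (of_nat m * J s (m - 1)) - J s m"
        by (rule row) (use b in auto)
      finally show ?thesis .
    qed
    ultimately have "((\<lambda>s. dI {..<Suc m} (\<lambda>_. As s)) has_vector_derivative
        of_nat (Suc m) * (- (of_nat m * J s (m - 1)) - J s m)) (at s)"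
      by simp
    then have "((\<lambda>s. D s (Suc m)) has_vector_derivative
        (- 1) ^ Suc m / fact (Suc m) * (of_nat (Suc m) * (- (of_nat m * J s (m - 1)) - J s m))) (at s)"
      unfolding D_def by (rule has_vector_derivative_mult_right)
    moreover have "(- 1) ^ Suc m / fact (Suc m) * (of_nat (Suc m) * (- (of_nat m * J s (m - 1)) - J s m))
        = (if m = 0 then c s 0 else c s m - c s (m - 1))"
    proof -
      have "(- 1) ^ Suc m / fact (Suc m) * (of_nat (Suc m) * (- (of_nat m * J s (m - 1)) - J s m))
          = (- 1) ^ m / fact m * (of_nat m * J s (m - 1) + J s m)"
        by (simp add: field_simps del: of_nat_Suc)
      also have "\<dots> = (if m = 0 then c s 0 else c s m - c s (m - 1))"
        by (cases m) (simp_all add: c_def field_simps del: of_nat_Suc)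
      finally show ?thesis .
    qed
    ultimately show ?thesis by simp
  qed
  have dSum: "((\<lambda>s. \<Sum>m<Suc (Suc n). D s m) has_vector_derivative c s n) (at s)" for n s
  proof (induction n)
    case 0
    have "((\<lambda>s. D s 0) has_vector_derivative 0) (at s)" by (simp add: D_def dI_empty)
    then have "((\<lambda>s. D s 0 + D s (Suc 0)) has_vector_derivative 0 + c s 0) (at s)"
      using dD[of 0 s] by (intro has_vector_derivative_add) auto
    then show ?case by simp
  next
    case (Suc n)
    have "((\<lambda>s. (\<Sum>m<Suc (Suc n). D s m) + D s (Suc (Suc n))) has_vector_derivative c s n + (c s (Suc n) - c s n)) (at s)"
      using dD[of "Suc n" s] by (intro has_vector_derivative_add Suc) simp
    then show ?case by simp
  qed
  obtain a where a: "0 \<le> a" "\<And>x y. x \<in> space M \<Longrightarrow> y \<in> space M \<Longrightarrow> norm (A x y) \<le> a * (f x * g y)"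
    using A unfolding kern_def by blast
  obtain q where q: "0 \<le> q" "\<And>x y. x \<in> space M \<Longrightarrow> y \<in> space M \<Longrightarrow> norm (Q x y) \<le> q * (f x * g y)"
    using Q unfolding kern_def by blast
  obtain e where e: "0 \<le> e" "\<And>x y. x \<in> space M \<Longrightarrow> y \<in> space M \<Longrightarrow> norm (F x y) \<le> e * (f x * g y)"
    using F unfolding kern_def by blast
  define C where "C = a + q + e"
  have C: "0 \<le> C" using a q e by (simp add: C_def)
  have fg: "0 \<le> f x * g y" for x y using f_nonneg g_nonneg by simp
  have Fb: "norm (F x y) \<le> C * (f x * g y)" if "x \<in> space M" "y \<in> space M" for x y
  proof -
    have "e * (f x * g y) \<le> C * (f x * g y)"
      using a q fg by (intro mult_right_mono) (auto simp: C_def)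
    then show ?thesis using e(2)[OF that] by linarith
  qed
  have Asb: "norm (As s x y) \<le> C * (f x * g y)" if "x \<in> space M" "y \<in> space M" and s: "0 \<le> s" "s \<le> 1" for s x y
  proof -
    have "norm (As s x y) \<le> norm (A x y) + s * norm (Q x y)"
      unfolding As_def using norm_triangle_ineq[of "A x y" "of_real s * Q x y"] s by (simp add: norm_mult)
    also have "s * norm (Q x y) \<le> 1 * norm (Q x y)" using s by (intro mult_right_mono) auto
    also have "norm (A x y) + 1 * norm (Q x y) \<le> a * (f x * g y) + q * (f x * g y)"
      using a(2) q(2) that by (intro add_mono) auto
    also have "\<dots> \<le> C * (f x * g y)"
      using e(1) fg[of x y] by (simp add: C_def distrib_right)
    finally show ?thesis by simp
  qed
  \<comment> \<open>\<open>J s n\<close> integrates over n + 1 variables but \<open>c s n\<close>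
    divides it only by n!. The missing n + 1 is bounded by 2^(n+1), hence the factor 2.\<close>
  define B where "B m = (2 * (C * weight_mass)) ^ m * sqrt (real m) ^ m / fact m" for m
  have W: "0 \<le> C * weight_mass"
    using C fg by (intro mult_nonneg_nonneg integral_nonneg_AE) auto
  have cB: "norm (c s n) \<le> B (Suc n)" if s: "0 \<le> s" "s \<le> 1" for s n
  proof -
    have "norm (J s n) \<le> (C * weight_mass) ^ Suc n * sqrt (real (Suc n)) ^ Suc n"
      unfolding J_def lessThan_Suc[symmetric]
      by (rule dI_bound(1)[OF C]) (use Fb Asb s As F in auto)
    then have "norm (c s n) \<le> (C * weight_mass) ^ Suc n * sqrt (real (Suc n)) ^ Suc n / fact n"
      by (simp add: c_def norm_mult norm_divide norm_power divide_right_mono)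
    also have "\<dots> = real (Suc n) * ((C * weight_mass) ^ Suc n * sqrt (real (Suc n)) ^ Suc n / fact (Suc n))"
      by (simp add: field_simps del: of_nat_Suc)
    also have "\<dots> \<le> 2 ^ Suc n * ((C * weight_mass) ^ Suc n * sqrt (real (Suc n)) ^ Suc n / fact (Suc n))"
    proof (rule mult_right_mono)
      show "real (Suc n) \<le> 2 ^ Suc n"
        using less_exp[of "Suc n"] by (metis less_imp_le of_nat_le_iff of_nat_numeral of_nat_power)
      show "0 \<le> (C * weight_mass) ^ Suc n * sqrt (real (Suc n)) ^ Suc n / fact (Suc n)"
        by (rule divide_nonneg_nonneg, rule mult_nonneg_nonneg, rule zero_le_power[OF W], auto)
    qed
    also have "\<dots> = B (Suc n)" by (simp only: B_def power_mult_distrib ac_simps times_divide_eq_right)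
    finally show ?thesis .
  qed
  \<comment> \<open>Mean value inequality on [0, 1]. The bound is uniform in \<open>s\<close> and is
    a term of a summable series, so it tends to zero.\<close>
  have diff: "norm ((\<Sum>m<Suc (Suc n). D 1 m) - (\<Sum>m<Suc (Suc n). D 0 m)) \<le> B (Suc n)" for n
  proof -
    have "continuous_on {0..1} (\<lambda>s. \<Sum>m<Suc (Suc n). D s m)"
      by (intro continuous_at_imp_continuous_on ballI has_vector_derivative_continuous[OF dSum])
    then obtain s where s: "s \<in> {0<..<1}"
      "norm ((\<Sum>m<Suc (Suc n). D 1 m) - (\<Sum>m<Suc (Suc n). D 0 m)) \<le> norm ((1 - 0) *\<^sub>R c s n)"
      using mvt_general[of 0 1 "\<lambda>s. \<Sum>m<Suc (Suc n). D s m" "\<lambda>s h. h *\<^sub>R c s n"]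
        dSum[unfolded has_vector_derivative_def] by auto
    then show ?thesis using cB[of s n] by auto
  qed
  have "(\<lambda>n. \<Sum>m<n. D 1 m) \<longlonglongrightarrow> (\<Sum>m. D 1 m)" and "(\<lambda>n. \<Sum>m<n. D 0 m) \<longlonglongrightarrow> (\<Sum>m. D 0 m)"
    unfolding D_def by (intro summable_LIMSEQ fredholm_series_summable As)+
  then have "(\<lambda>n. (\<Sum>m<n. D 1 m) - (\<Sum>m<n. D 0 m)) \<longlonglongrightarrow> (\<Sum>m. D 1 m) - (\<Sum>m. D 0 m)"
    by (rule tendsto_diff)
  then have "(\<lambda>n. (\<Sum>m<n+2. D 1 m) - (\<Sum>m<n+2. D 0 m)) \<longlonglongrightarrow> (\<Sum>m. D 1 m) - (\<Sum>m. D 0 m)"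
    by (rule LIMSEQ_ignore_initial_segment)
  moreover have "(\<lambda>n. (\<Sum>m<n+2. D 1 m) - (\<Sum>m<n+2. D 0 m)) \<longlonglongrightarrow> 0"
  proof (rule Lim_null_comparison)
    show "\<forall>\<^sub>F n in sequentially. norm ((\<Sum>m<n+2. D 1 m) - (\<Sum>m<n+2. D 0 m)) \<le> B (Suc n)"
      using diff by simp
    show "(\<lambda>n. B (Suc n)) \<longlonglongrightarrow> 0"
      unfolding B_def by (intro LIMSEQ_Suc summable_LIMSEQ_zero summable_hadamard_bound)
  qed
  ultimately have "(\<Sum>m. D 1 m) = (\<Sum>m. D 0 m)"
    using LIMSEQ_unique by fastforce
  moreover have "As 0 = A" "As 1 = (\<lambda>x y. A x y + (E x y - kcomp M E A x y))"
    by (simp_all add: As_def Q_def F_def)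
  ultimately show ?thesis
    unfolding fredholm_det_eq_dI D_def by simp
qed

end

section \<open>The heat kernel\<close>

text \<open>The imaginary part of \<open>z\<close> is handled by the characteristic function. The
  real part then comes from translating the density by \<open>\<alpha>\<close>, which multiplies it
  by exp(\<open>\<alpha>\<close> t - \<open>\<alpha>\<close>^2 / 2).\<close>

lemma std_normal_exp:
  fixes z :: complex
  shows "has_bochner_integral lborel (\<lambda>t. of_real (std_normal_density t) * exp (of_real t * z)) (exp (z\<^sup>2 / 2))"
proof -
  define \<alpha> \<beta> where "\<alpha> = Re z" and "\<beta> = Im z"
  have z: "z = of_real \<alpha> + \<i> * of_real \<beta>" by (simp add: \<alpha>_def \<beta>_def complex_eq)
  have "has_bochner_integral lborel (\<lambda>s. std_normal_density s *\<^sub>R iexp (\<beta> * s)) (of_real (exp (- (\<beta>\<^sup>2) / 2)))"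
  proof -
    have int: "integrable std_normal_distribution (\<lambda>s. iexp (\<beta> * s))"
      using real_dist_normal_dist by (intro finite_measure.integrable_const_bound[where B = 1])
        (auto simp: real_distribution_def prob_space_def)
    then have "integrable lborel (\<lambda>s. std_normal_density s *\<^sub>R iexp (\<beta> * s))"
      by (subst (asm) integrable_density) auto
    moreover have "(\<integral>s. std_normal_density s *\<^sub>R iexp (\<beta> * s) \<partial>lborel) = char std_normal_distribution \<beta>"
      unfolding char_def by (subst integral_density) auto
    ultimately show ?thesis
      by (simp add: has_bochner_integral_iff char_std_normal_distribution)
  qed
  then have "has_bochner_integral lborel (\<lambda>t. std_normal_density (- \<alpha> + 1 * t) *\<^sub>R iexp (\<beta> * (- \<alpha> + 1 * t)))
      (of_real (exp (- (\<beta>\<^sup>2) / 2)) /\<^sub>R \<bar>1\<bar>)"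
    by (subst (asm) lborel_has_bochner_integral_real_affine_iff[of 1 _ _ "- \<alpha>"]) auto
  then have "has_bochner_integral lborel
      (\<lambda>t. exp (of_real (\<alpha>\<^sup>2 / 2) + \<i> * of_real (\<alpha> * \<beta>)) * (std_normal_density (- \<alpha> + 1 * t) *\<^sub>R iexp (\<beta> * (- \<alpha> + 1 * t))))
      (exp (of_real (\<alpha>\<^sup>2 / 2) + \<i> * of_real (\<alpha> * \<beta>)) * (of_real (exp (- (\<beta>\<^sup>2) / 2)) /\<^sub>R \<bar>1\<bar>))"
    by (rule has_bochner_integral_mult_right)
  moreover have "exp (of_real (\<alpha>\<^sup>2 / 2) + \<i> * of_real (\<alpha> * \<beta>)) * (std_normal_density (- \<alpha> + 1 * t) *\<^sub>R iexp (\<beta> * (- \<alpha> + 1 * t)))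
      = of_real (std_normal_density t) * exp (of_real t * z)" for t
  proof -
    have "std_normal_density (t - \<alpha>) = std_normal_density t * exp (\<alpha> * t - \<alpha>\<^sup>2 / 2)"
      unfolding std_normal_density_def by (simp add: exp_add[symmetric] power2_eq_square field_simps)
    then have "exp (of_real (\<alpha>\<^sup>2 / 2) + \<i> * of_real (\<alpha> * \<beta>)) * (std_normal_density (- \<alpha> + 1 * t) *\<^sub>R iexp (\<beta> * (- \<alpha> + 1 * t)))
      = of_real (std_normal_density t) * (exp (of_real (\<alpha>\<^sup>2 / 2) + \<i> * of_real (\<alpha> * \<beta>)) * exp (of_real (\<alpha> * t - \<alpha>\<^sup>2 / 2)) * iexp (\<beta> * (t - \<alpha>)))"
      by (simp add: scaleR_conv_of_real flip: exp_of_real)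
    also have "exp (of_real (\<alpha>\<^sup>2 / 2) + \<i> * of_real (\<alpha> * \<beta>)) * exp (of_real (\<alpha> * t - \<alpha>\<^sup>2 / 2)) * iexp (\<beta> * (t - \<alpha>))
        = exp (of_real t * z)"
      unfolding exp_add[symmetric] z by (rule arg_cong[of _ _ exp]) (simp add: algebra_simps)
    finally show ?thesis .
  qed
  moreover have "exp (of_real (\<alpha>\<^sup>2 / 2) + \<i> * of_real (\<alpha> * \<beta>)) * (of_real (exp (- (\<beta>\<^sup>2) / 2)) /\<^sub>R \<bar>1\<bar>) = exp (z\<^sup>2 / 2)"
  proof -
    have "exp (of_real (\<alpha>\<^sup>2 / 2) + \<i> * of_real (\<alpha> * \<beta>)) * (of_real (exp (- (\<beta>\<^sup>2) / 2)) /\<^sub>R \<bar>1\<bar>)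
       = exp (of_real (\<alpha>\<^sup>2 / 2) + \<i> * of_real (\<alpha> * \<beta>)) * exp (of_real (- (\<beta>\<^sup>2) / 2))"
      by (simp flip: exp_of_real)
    also have "\<dots> = exp (z\<^sup>2 / 2)"
      unfolding exp_add[symmetric] z
      by (rule arg_cong[of _ _ exp]) (simp add: power2_eq_square field_simps)
    finally show ?thesis .
  qed
  ultimately show ?thesis by simp
qed

lemma heat_kernel_nonneg: "0 < r \<Longrightarrow> 0 \<le> heat_kernel r x y"
  unfolding heat_kernel_def by simp

lemma heat_kernel_measurable [measurable (raw)]:
  assumes [measurable]: "f \<in> borel_measurable M" "g \<in> borel_measurable M"
  shows "(\<lambda>x. heat_kernel r (f x) (g x)) \<in> borel_measurable M"
proof -
  have "(\<lambda>x. exp (- ((f x - g x)\<^sup>2 * c)) * d) \<in> borel_measurable M" for c d :: real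
    by measurable
  then show ?thesis by (simp only: heat_kernel_def divide_inverse)
qed

text \<open>Exponentials are eigenfunctions of the heat operator, also for complex frequency. The
  heat kernel is the normal density of variance 2 r, which explains the scale \<open>c\<close> in
  the proof.\<close>

lemma heat_kernel_exp:
  fixes z :: complex
  assumes r: "0 < r"
  shows "has_bochner_integral lborel (\<lambda>y. of_real (heat_kernel r x y) * exp (of_real y * z))
    (exp (of_real x * z + of_real r * z\<^sup>2))"
proof -
  define c where "c = sqrt (2 * r)"
  have c: "0 < c" "c\<^sup>2 = 2 * r" using r by (simp_all add: c_def)
  have "has_bochner_integral lborel (\<lambda>t. of_real (std_normal_density t) * exp (of_real t * (of_real c * z)))
      (exp ((of_real c * z)\<^sup>2 / 2))"
    by (rule std_normal_exp)
  then have "has_bochner_integral lborel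
      (\<lambda>y. of_real (std_normal_density (- x / c + (1 / c) * y)) * exp (of_real (- x / c + (1 / c) * y) * (of_real c * z)))
      (exp ((of_real c * z)\<^sup>2 / 2) /\<^sub>R \<bar>1 / c\<bar>)"
    by (subst (asm) lborel_has_bochner_integral_real_affine_iff[of "1 / c" _ _ "- x / c"]) (use c in auto)
  then have "has_bochner_integral lborel
      (\<lambda>y. (of_real (1 / c) * exp (of_real x * z)) * (of_real (std_normal_density (- x / c + (1 / c) * y))
         * exp (of_real (- x / c + (1 / c) * y) * (of_real c * z))))
      ((of_real (1 / c) * exp (of_real x * z)) * (exp ((of_real c * z)\<^sup>2 / 2) /\<^sub>R \<bar>1 / c\<bar>))"
    by (rule has_bochner_integral_mult_right)
  moreover have "(of_real (1 / c) * exp (of_real x * z)) * (of_real (std_normal_density (- x / c + (1 / c) * y))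
         * exp (of_real (- x / c + (1 / c) * y) * (of_real c * z))) = of_real (heat_kernel r x y) * exp (of_real y * z)" for y
  proof -
    have "(- x / c + (1 / c) * y)\<^sup>2 = (x - y)\<^sup>2 / (2 * r)"
      unfolding c(2)[symmetric] using c(1) by (simp add: field_simps power2_eq_square)
    moreover have "sqrt (4 * pi * r) = sqrt (2 * pi) * c"
      unfolding c_def by (simp add: real_sqrt_mult[symmetric])
    ultimately have "heat_kernel r x y = (1 / c) * std_normal_density (- x / c + (1 / c) * y)"
      unfolding heat_kernel_def std_normal_density_def by simp
    moreover have "exp (of_real x * z) * exp (of_real (- x / c + (1 / c) * y) * (of_real c * z)) = exp (of_real y * z)"
      unfolding exp_add[symmetric] using c by (intro arg_cong[of _ _ exp]) (simp add: field_simps)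
    ultimately show ?thesis by (simp add: mult.assoc mult.left_commute[of "exp (of_real x * z)"])
  qed
  moreover have "(of_real (1 / c) * exp (of_real x * z)) * (exp ((of_real c * z)\<^sup>2 / 2) /\<^sub>R \<bar>1 / c\<bar>)
      = exp (of_real x * z + of_real r * z\<^sup>2)"
  proof -
    have "(of_real c * z)\<^sup>2 / 2 = of_real r * z\<^sup>2"
      using c(2) by (simp add: power_mult_distrib flip: of_real_power)
    then show ?thesis using c(1) by (simp add: exp_add scaleR_conv_of_real)
  qed
  ultimately show ?thesis by simp
qed

lemma heat_kernel_exp_real:
  assumes r: "0 < r"
  shows "has_bochner_integral lborel (\<lambda>y. heat_kernel r x y * exp (b * y)) (exp (b * x + r * b\<^sup>2))"
proof -
  have "has_bochner_integral lborel (\<lambda>y. of_real (heat_kernel r x y) * exp (of_real y * complex_of_real b))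
    (exp (of_real x * of_real b + of_real r * (of_real b)\<^sup>2))"
    by (rule heat_kernel_exp[OF r])
  then have "has_bochner_integral lborel (\<lambda>y. complex_of_real (heat_kernel r x y * exp (b * y)))
      (of_real (exp (b * x + r * b\<^sup>2)))"
    by (simp add: exp_of_real[symmetric] mult.commute)
  then show ?thesis
    unfolding has_bochner_integral_iff complex_of_real_integrable_eq integral_complex_of_real of_real_eq_iff .
qed

text \<open>Semigroup law: centred normal variables of variances 2 r and 2 s add up to variance 2 (r
  + s).\<close>

lemma heat_kernel_convolution:
  assumes r: "0 < r" and s: "0 < s"
  shows "(\<integral>y. complex_of_real (heat_kernel r x y) * of_real (heat_kernel s y z) \<partial>lborel) = of_real (heat_kernel (r + s) x z)"
proof -
  define \<sigma> \<tau> where "\<sigma> = sqrt (2 * r)" and "\<tau> = sqrt (2 * s)"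
  have st: "0 < \<sigma>" "0 < \<tau>" "\<sigma>\<^sup>2 = 2 * r" "\<tau>\<^sup>2 = 2 * s" using r s by (simp_all add: \<sigma>_def \<tau>_def)
  have nd: "heat_kernel r' x y = normal_density 0 (sqrt (2 * r')) (x - y)" if "0 < r'" for r' x y
    unfolding heat_kernel_def normal_density_def using that by (simp add: mult.assoc mult.left_commute)
  have "(\<integral>\<^sup>+y. ennreal (normal_density 0 \<sigma> ((x - z) - y) * normal_density 0 \<tau> y) \<partial>lborel)
      = ennreal (normal_density 0 (sqrt (\<sigma>\<^sup>2 + \<tau>\<^sup>2)) (x - z))"
    using conv_normal_density_zero_mean[OF st(1,2)] by (rule fun_cong)
  then have "has_bochner_integral lborel (\<lambda>y. normal_density 0 \<sigma> ((x - z) - y) * normal_density 0 \<tau> y)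
      (normal_density 0 (sqrt (\<sigma>\<^sup>2 + \<tau>\<^sup>2)) (x - z))"
    by (intro has_bochner_integral_nn_integral) (auto intro!: AE_I2 normal_density_nonneg)
  then have "has_bochner_integral lborel (\<lambda>y. normal_density 0 \<sigma> ((x - z) - (- z + 1 * y)) * normal_density 0 \<tau> (- z + 1 * y))
      (normal_density 0 (sqrt (\<sigma>\<^sup>2 + \<tau>\<^sup>2)) (x - z) /\<^sub>R \<bar>1\<bar>)"
    by (subst (asm) lborel_has_bochner_integral_real_affine_iff[of 1 _ _ "- z"]) auto
  moreover have "sqrt (\<sigma>\<^sup>2 + \<tau>\<^sup>2) = sqrt (2 * (r + s))" by (simp add: st)
  ultimately have "has_bochner_integral lborel (\<lambda>y. heat_kernel r x y * heat_kernel s y z) (heat_kernel (r + s) x z)"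
    using r s by (simp add: nd \<sigma>_def \<tau>_def)
  then have "has_bochner_integral lborel (\<lambda>y. complex_of_real (heat_kernel r x y * heat_kernel s y z)) (of_real (heat_kernel (r + s) x z))"
    by (rule has_bochner_integral_of_real)
  then show ?thesis
    unfolding has_bochner_integral_iff by simp
qed

text \<open>The real part of a contour is unbounded on one side, so \<open>e\<^sup>u\<^sup>z\<close> integrated over it is not
  exponentially bounded as \<open>u \<rightarrow> -\<infinity>\<close>; the Gaussian factor below absorbs this growth.\<close>

definition expq :: "real \<Rightarrow> real \<Rightarrow> real \<Rightarrow> real" where
  "expq a \<kappa> u = exp (a * u + \<kappa> * (min 0 u)\<^sup>2)"

lemma expq_measurable [measurable]: "expq a \<kappa> \<in> borel_measurable borel"
  unfolding expq_def by measurable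

lemma min0_sq_le: "(min 0 x)\<^sup>2 \<le> 2 * (min 0 y)\<^sup>2 + 2 * (x - y)\<^sup>2" for x y :: real
proof -
  have "\<bar>min 0 x\<bar> \<le> \<bar>min 0 y\<bar> + \<bar>x - y\<bar>" by auto
  then have "\<bar>min 0 x\<bar>\<^sup>2 \<le> (\<bar>min 0 y\<bar> + \<bar>x - y\<bar>)\<^sup>2" by (intro power_mono) auto
  also have "\<dots> \<le> 2 * \<bar>min 0 y\<bar>\<^sup>2 + 2 * \<bar>x - y\<bar>\<^sup>2"
    using sum_squares_bound[of "\<bar>min 0 y\<bar>" "\<bar>x - y\<bar>"] unfolding power2_sum by linarith
  finally show ?thesis by simp
qed

text \<open>Half of the Gaussian exponent can be spent on a weight; what is left is the heat kernel
  of twice the time.\<close>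

lemma heat_kernel_double:
  assumes "0 < r"
  shows "heat_kernel r x y * exp ((x - y)\<^sup>2 / (8 * r)) = sqrt 2 * heat_kernel (2 * r) x y"
proof -
  have "exp (- ((x - y)\<^sup>2 / (4 * r))) * exp ((x - y)\<^sup>2 / (8 * r)) = exp (- ((x - y)\<^sup>2 / (4 * (2 * r))))"
    unfolding exp_add[symmetric] using assms by (intro arg_cong[of _ _ exp]) (simp add: field_simps)
  moreover have "sqrt (4 * pi * (2 * r)) = sqrt 2 * sqrt (4 * pi * r)"
    by (simp add: real_sqrt_mult[symmetric])
  ultimately show ?thesis
    unfolding heat_kernel_def by simp
qed

lemma heat_kernel_expq_le:
  assumes r: "0 < r" and le: "\<kappa> * (min 0 y)\<^sup>2 \<le> \<kappa>' * (min 0 x)\<^sup>2 + (x - y)\<^sup>2 / (8 * r)"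
  shows "heat_kernel r x y * expq a \<kappa> y \<le> sqrt 2 * exp (\<kappa>' * (min 0 x)\<^sup>2) * (heat_kernel (2 * r) x y * exp (a * y))"
proof -
  have "heat_kernel r x y * expq a \<kappa> y
      \<le> heat_kernel r x y * exp (a * y + (\<kappa>' * (min 0 x)\<^sup>2 + (x - y)\<^sup>2 / (8 * r)))"
    unfolding expq_def using le by (intro mult_left_mono heat_kernel_nonneg r) auto
  also have "\<dots> = (heat_kernel r x y * exp ((x - y)\<^sup>2 / (8 * r))) * exp (\<kappa>' * (min 0 x)\<^sup>2) * exp (a * y)"
    by (simp add: exp_add algebra_simps)
  finally show ?thesis
    unfolding heat_kernel_double[OF r] by (simp add: ac_simps)
qed

text \<open>In passing from \<open>y\<close> to \<open>x\<close> a growing weight doubles its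
  coefficient and a decaying one halves it. The size conditions keep the error term within the half
  exponent that \<open>heat_kernel_double\<close> provides.\<close>

lemma expq_exponent_le:
  fixes x y :: real
  assumes r: "0 < r" and h: "0 \<le> \<kappa> \<and> 16 * r * \<kappa> \<le> 1 \<and> \<kappa>' = 2 * \<kappa> \<or> \<kappa> \<le> 0 \<and> 8 * r * (- \<kappa>) \<le> 1 \<and> \<kappa>' = \<kappa> / 2"
  shows "\<kappa> * (min 0 y)\<^sup>2 \<le> \<kappa>' * (min 0 x)\<^sup>2 + (x - y)\<^sup>2 / (8 * r)"
  using h
proof (elim disjE conjE)
  assume k: "0 \<le> \<kappa>" "16 * r * \<kappa> \<le> 1" "\<kappa>' = 2 * \<kappa>"
  have "\<kappa> * (min 0 y)\<^sup>2 \<le> \<kappa> * (2 * (min 0 x)\<^sup>2 + 2 * (y - x)\<^sup>2)"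
    using k(1) min0_sq_le by (intro mult_left_mono)
  also have "\<dots> = \<kappa>' * (min 0 x)\<^sup>2 + (2 * \<kappa>) * (x - y)\<^sup>2"
    by (simp add: k(3) algebra_simps power2_commute[of y x])
  also have "(2 * \<kappa>) * (x - y)\<^sup>2 \<le> (1 / (8 * r)) * (x - y)\<^sup>2"
    using k(2) r by (intro mult_right_mono) (auto simp: field_simps)
  finally show ?thesis by simp
next
  assume k: "\<kappa> \<le> 0" "8 * r * (- \<kappa>) \<le> 1" "\<kappa>' = \<kappa> / 2"
  have "(- \<kappa> / 2) * (min 0 x)\<^sup>2 \<le> (- \<kappa> / 2) * (2 * (min 0 y)\<^sup>2 + 2 * (x - y)\<^sup>2)"
    using k(1) by (intro mult_left_mono min0_sq_le) simp
  then have "\<kappa> * (min 0 y)\<^sup>2 \<le> \<kappa>' * (min 0 x)\<^sup>2 + (- \<kappa>) * (x - y)\<^sup>2"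
    unfolding k(3) by (simp add: algebra_simps)
  also have "(- \<kappa>) * (x - y)\<^sup>2 \<le> (1 / (8 * r)) * (x - y)\<^sup>2"
    using k(2) r by (intro mult_right_mono) (auto simp: field_simps)
  finally show ?thesis by simp
qed

definition heat_ker :: "real \<Rightarrow> real \<Rightarrow> real \<Rightarrow> complex" where
  "heat_ker r x y = complex_of_real (heat_kernel r x y)"

lemma heat_op_eq_kcomp: "heat_op r (\<lambda>y. F y v) x = kcomp lborel (heat_ker r) F x v"
  unfolding heat_op_def kcomp_def heat_ker_def ..

text \<open>The weight in \<open>x\<close> is far too generous for an estimate of the result; these
  weights serve measurability, integrability and associativity. The condition on
  \<open>\<gamma>\<close> says that 2 \<open>\<gamma>\<close> is at most the coefficient 1 / (4 r)
  of the exponent.\<close>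

lemma kern_heat:
  assumes r: "0 < r" and \<gamma>: "0 \<le> \<gamma>" "8 * r * \<gamma> \<le> 1"
  shows "kern lborel (\<lambda>x. exp (2 * \<gamma> * x\<^sup>2)) lborel (\<lambda>y. exp (- (\<gamma> * y\<^sup>2))) (heat_ker r)"
proof (rule kernI[of _ _ _ "1 / sqrt (4 * pi * r)"])
  fix x y :: real
  have "(y\<^sup>2 :: real) \<le> 2 * x\<^sup>2 + 2 * (x - y)\<^sup>2"
    using sum_squares_bound[of x "y - x"] zero_le_power2[of "2 * x - y"] by (simp add: power2_eq_square algebra_simps)
  then have "\<gamma> * y\<^sup>2 \<le> \<gamma> * (2 * x\<^sup>2 + 2 * (x - y)\<^sup>2)"
    using \<gamma>(1) by (rule mult_left_mono)
  moreover have "(2 * \<gamma>) * (x - y)\<^sup>2 \<le> (1 / (4 * r)) * (x - y)\<^sup>2"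
    using \<gamma>(2) r by (intro mult_right_mono) (auto simp: field_simps)
  ultimately have "- ((x - y)\<^sup>2 / (4 * r)) \<le> 2 * \<gamma> * x\<^sup>2 + - (\<gamma> * y\<^sup>2)"
    by (simp add: algebra_simps)
  then have "exp (- ((x - y)\<^sup>2 / (4 * r))) \<le> exp (2 * \<gamma> * x\<^sup>2) * exp (- (\<gamma> * y\<^sup>2))"
    unfolding exp_add[symmetric] by simp
  then show "norm (heat_ker r x y) \<le> 1 / sqrt (4 * pi * r) * (exp (2 * \<gamma> * x\<^sup>2) * exp (- (\<gamma> * y\<^sup>2)))"
    using r heat_kernel_nonneg[OF r, of x y] unfolding heat_ker_def norm_of_real
    by (simp add: heat_kernel_def divide_right_mono)
qed (use r in \<open>auto simp: heat_ker_def[abs_def]\<close>)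

lemma integrable_gaussian: "0 < c \<Longrightarrow> integrable lborel (\<lambda>x. exp (a * x - c * x\<^sup>2) :: real)"
proof -
  assume c: "0 < c"
  have "integrable lborel (\<lambda>y. sqrt (pi / c) * (heat_kernel (1 / (4 * c)) 0 y * exp (a * y)))"
    using heat_kernel_exp_real[of "1 / (4 * c)" 0 a] c by (auto simp: has_bochner_integral_iff)
  moreover have "sqrt (pi / c) * (heat_kernel (1 / (4 * c)) 0 y * exp (a * y)) = exp (a * y - c * y\<^sup>2)" for y
    using c by (simp add: heat_kernel_def exp_diff exp_minus field_simps)
  ultimately show ?thesis by simp
qed

lemma weighted_gaussian:
  assumes "\<kappa> < \<gamma>" "0 < \<gamma>"
  shows "weighted_space lborel (expq a \<kappa>) (\<lambda>y. exp (- (\<gamma> * y\<^sup>2)))"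
proof (unfold_locales)
  define c where "c = \<gamma> - max 0 \<kappa>"
  have c: "0 < c" using assms by (auto simp: c_def)
  show "integrable lborel (\<lambda>x. expq a \<kappa> x * exp (- (\<gamma> * x\<^sup>2)))"
  proof (rule Bochner_Integration.integrable_bound[OF integrable_gaussian[OF c, of a]])
    have "\<kappa> * (min 0 x)\<^sup>2 \<le> max 0 \<kappa> * x\<^sup>2" for x :: real
      by (rule mult_mono) (auto simp: min_def)
    then have "expq a \<kappa> x * exp (- (\<gamma> * x\<^sup>2)) \<le> exp (a * x - c * x\<^sup>2)" for x
      unfolding expq_def exp_add[symmetric] c_def by (simp add: algebra_simps)
    then show "AE x in lborel. norm (expq a \<kappa> x * exp (- (\<gamma> * x\<^sup>2))) \<le> norm (exp (a * x - c * x\<^sup>2))"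
      by (simp add: abs_mult expq_def)
  qed measurable
qed (auto simp: expq_def)

lemma weighted_gaussian2:
  assumes "2 * \<gamma> < \<gamma>'"
  shows "weighted_space lborel (\<lambda>y. exp (2 * \<gamma> * y\<^sup>2)) (\<lambda>y. exp (- (\<gamma>' * y\<^sup>2)))"
proof (unfold_locales)
  have "exp (2 * \<gamma> * y\<^sup>2) * exp (- (\<gamma>' * y\<^sup>2)) = exp (0 * y - (\<gamma>' - 2 * \<gamma>) * y\<^sup>2)" for y :: real
    unfolding exp_add[symmetric] by (simp add: algebra_simps)
  then show "integrable lborel (\<lambda>y. exp (2 * \<gamma> * y\<^sup>2) * exp (- (\<gamma>' * y\<^sup>2)))"
    using integrable_gaussian[of "\<gamma>' - 2 * \<gamma>" 0] assms by simp
qed auto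

lemma weighted_heat:
  assumes r: "0 < r" and k: "8 * r * \<kappa> < 1"
  shows "weighted_space lborel (expq a \<kappa>) (\<lambda>y. exp (- (1 / (8 * r) * y\<^sup>2)))"
  by (rule weighted_gaussian) (use r k in \<open>auto simp: field_simps\<close>)

lemma kcomp_heat_heat:
  assumes r: "0 < r" and s: "0 < s" and \<kappa>: "\<kappa> \<le> 0" and F: "kern lborel (expq a \<kappa>) N p F" and v: "v \<in> space N"
  shows "kcomp lborel (heat_ker r) (kcomp lborel (heat_ker s) F) x v = kcomp lborel (heat_ker (r + s)) F x v"
proof -
  \<comment> \<open>\<open>\<gamma>'\<close> is the largest rate allowed for time r.
    \<open>\<gamma>\<close> must be allowed for time s, and twice \<open>\<gamma>\<close> must stay
    below \<open>\<gamma>'\<close> so that the product of the two middle weights is integrable; 1 /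
    (32 r) achieves this.\<close>
  define \<gamma>' \<gamma> where "\<gamma>' = 1 / (8 * r)" and "\<gamma> = min (1 / (8 * s)) (1 / (32 * r))"
  have g: "0 < \<gamma>'" "0 < \<gamma>" using r s by (auto simp: \<gamma>'_def \<gamma>_def)
  have "2 * \<gamma> \<le> 2 * (1 / (32 * r))" by (simp add: \<gamma>_def)
  also have "\<dots> < \<gamma>'" using r by (simp add: \<gamma>'_def field_simps)
  finally have g2: "2 * \<gamma> < \<gamma>'" .
  have "s * \<gamma> \<le> s * (1 / (8 * s))" using s by (intro mult_left_mono) (auto simp: \<gamma>_def)
  then have g3: "8 * s * \<gamma> \<le> 1" using s by simp
  interpret Y: weighted_space lborel "\<lambda>y. exp (2 * \<gamma> * y\<^sup>2)" "\<lambda>y. exp (- (\<gamma>' * y\<^sup>2))"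
    by (rule weighted_gaussian2[OF g2])
  have w: "weighted_space lborel (expq a \<kappa>) (\<lambda>y. exp (- (\<gamma> * y\<^sup>2)))"
    by (rule weighted_gaussian) (use g \<kappa> in auto)
  have A: "kern lborel (\<lambda>x. exp (2 * \<gamma>' * x\<^sup>2)) lborel (\<lambda>y. exp (- (\<gamma>' * y\<^sup>2))) (heat_ker r)"
    by (rule kern_heat[OF r]) (use r g in \<open>auto simp: \<gamma>'_def\<close>)
  have B: "kern lborel (\<lambda>x. exp (2 * \<gamma> * x\<^sup>2)) lborel (\<lambda>y. exp (- (\<gamma> * y\<^sup>2))) (heat_ker s)"
    by (rule kern_heat[OF s]) (use g g3 in auto)
  have "kcomp lborel (heat_ker r) (kcomp lborel (heat_ker s) F) x v = kcomp lborel (kcomp lborel (heat_ker r) (heat_ker s)) F x v"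
    by (rule Y.kcomp_assoc[OF w A B F _ v, symmetric]) simp
  also have "kcomp lborel (heat_ker r) (heat_ker s) = heat_ker (r + s)"
    by (intro ext) (simp add: kcomp_def heat_ker_def heat_kernel_convolution[OF r s])
  finally show ?thesis .
qed

text \<open>The generous weights of \<open>kern_heat\<close> give existence and measurability. The
  true size follows from a pointwise bound of the integrand: half of the exponent moves the Gaussian
  weight from \<open>y\<close> to \<open>x\<close>, and the rest integrates e^(a y) exactly.\<close>

lemma kern_kcomp_heat:
  assumes r: "0 < r" and h: "0 \<le> \<kappa> \<and> 16 * r * \<kappa> \<le> 1 \<and> \<kappa>' = 2 * \<kappa> \<or> \<kappa> \<le> 0 \<and> 8 * r * (- \<kappa>) \<le> 1 \<and> \<kappa>' = \<kappa> / 2"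
    and F: "kern lborel (expq a \<kappa>) N p F" and p: "\<And>v. 0 \<le> p v"
  shows "kern lborel (expq a \<kappa>') N p (kcomp lborel (heat_ker r) F)"
proof -
  have "8 * r * \<kappa> < 1"
  proof (cases "0 \<le> \<kappa>")
    case True
    then show ?thesis using h by auto
  next
    case False
    then have "r * \<kappa> < 0" using r by (simp add: mult_pos_neg)
    then show ?thesis by simp
  qed
  then interpret weighted_space lborel "expq a \<kappa>" "\<lambda>y. exp (- (1 / (8 * r) * y\<^sup>2))"
    by (rule weighted_heat[OF r])
  have kh: "kern lborel (\<lambda>x. exp (2 * (1 / (8 * r)) * x\<^sup>2)) lborel (\<lambda>y. exp (- (1 / (8 * r) * y\<^sup>2))) (heat_ker r)"
    by (rule kern_heat[OF r]) (use r in auto)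
  have k: "kern lborel (\<lambda>x. exp (2 * (1 / (8 * r)) * x\<^sup>2)) N p (kcomp lborel (heat_ker r) F)"
    by (rule kern_kcomp[OF kh F])
  obtain C where C: "0 \<le> C" "\<And>x y. x \<in> space lborel \<Longrightarrow> y \<in> space N \<Longrightarrow> norm (F x y) \<le> C * (expq a \<kappa> x * p y)"
    using F unfolding kern_def by blast
  show ?thesis
  \<comment> \<open>The factor sqrt 2 comes from doubling the time, and exp(2 r a^2) is the
    eigenvalue of e^(a y) at time 2 r.\<close>
  proof (rule kernI[of _ _ _ "C * sqrt 2 * exp (2 * r * a\<^sup>2)"])
    show "(\<lambda>q. kcomp lborel (heat_ker r) F (fst q) (snd q)) \<in> borel_measurable (lborel \<Otimes>\<^sub>M N)"
      using k by (simp add: kern_def)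
    fix x v assume v: "v \<in> space N"
    let ?D = "C * p v * (sqrt 2 * exp (\<kappa>' * (min 0 x)\<^sup>2))"
    have hb: "has_bochner_integral lborel (\<lambda>y. heat_kernel (2 * r) x y * exp (a * y)) (exp (a * x + 2 * r * a\<^sup>2))"
      by (rule heat_kernel_exp_real) (use r in simp)
    have "norm (kcomp lborel (heat_ker r) F x v) \<le> (\<integral>y. ?D * (heat_kernel (2 * r) x y * exp (a * y)) \<partial>lborel)"
      unfolding kcomp_def
    proof (rule norm_integral_le)
      show "complex_integrable lborel (\<lambda>y. heat_ker r x y * F y v)"
        using kcomp_integrable[OF kh F _ v, of x] by simp
      show "integrable lborel (\<lambda>y. ?D * (heat_kernel (2 * r) x y * exp (a * y)))"
        using hb by (auto simp: has_bochner_integral_iff)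
      fix y
      have "norm (heat_ker r x y * F y v) \<le> heat_kernel r x y * (C * (expq a \<kappa> y * p v))"
        unfolding norm_mult heat_ker_def using C(2)[of y v] v
        by (simp add: heat_kernel_nonneg r mult_left_mono)
      also have "\<dots> = C * p v * (heat_kernel r x y * expq a \<kappa> y)" by (simp add: ac_simps)
      also have "\<dots> \<le> C * p v * (sqrt 2 * exp (\<kappa>' * (min 0 x)\<^sup>2) * (heat_kernel (2 * r) x y * exp (a * y)))"
        using C(1) p by (intro mult_left_mono heat_kernel_expq_le[OF r] expq_exponent_le[OF r h]) auto
      finally show "norm (heat_ker r x y * F y v) \<le> ?D * (heat_kernel (2 * r) x y * exp (a * y))"
        by (simp add: ac_simps)
    qed
    also have "\<dots> = ?D * exp (a * x + 2 * r * a\<^sup>2)"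
      using hb by (simp add: has_bochner_integral_iff)
    also have "\<dots> = C * sqrt 2 * exp (2 * r * a\<^sup>2) * (expq a \<kappa>' x * p v)"
      by (simp add: expq_def exp_add)
    finally show "norm (kcomp lborel (heat_ker r) F x v) \<le> C * sqrt 2 * exp (2 * r * a\<^sup>2) * (expq a \<kappa>' x * p v)" .
  qed (use C in auto)
qed

section \<open>The kernel as a composition\<close>

lemma kern_mono:
  assumes A: "kern M f N g A" and f: "\<And>x. x \<in> space M \<Longrightarrow> 0 \<le> f x \<and> f x \<le> c * f' x"
    and g: "\<And>y. y \<in> space N \<Longrightarrow> 0 \<le> g y \<and> g y \<le> d * g' y" and "0 \<le> c" "0 \<le> d"
  shows "kern M f' N g' A"
proof -
  obtain C where C: "0 \<le> C" "\<And>x y. x \<in> space M \<Longrightarrow> y \<in> space N \<Longrightarrow> norm (A x y) \<le> C * (f x * g y)"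
    using A unfolding kern_def by blast
  show ?thesis
  proof (rule kernI[of _ _ _ "C * c * d"])
    show "(\<lambda>p. A (fst p) (snd p)) \<in> borel_measurable (M \<Otimes>\<^sub>M N)" using A by (simp add: kern_def)
    fix x y assume x: "x \<in> space M" and y: "y \<in> space N"
    have "f x * g y \<le> (c * f' x) * (d * g' y)"
      using f[OF x] g[OF y] by (intro mult_mono) auto
    then have "C * (f x * g y) \<le> C * ((c * f' x) * (d * g' y))"
      using C(1) by (rule mult_left_mono)
    then show "norm (A x y) \<le> C * c * d * (f' x * g' y)"
      using C(2)[OF x y] by (simp add: ac_simps)
  qed (use C assms in auto)
qed

lemma kern_if:
  assumes A: "kern M f N g A" and B: "kern M f N g B" and P: "Measurable.pred M P"
    and f: "\<And>x. 0 \<le> f x" and g: "\<And>y. 0 \<le> g y"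
  shows "kern M f N g (\<lambda>x y. if P x then A x y else B x y)"
proof -
  obtain C where C: "0 \<le> C" "\<And>x y. x \<in> space M \<Longrightarrow> y \<in> space N \<Longrightarrow> norm (A x y) \<le> C * (f x * g y)"
    using A unfolding kern_def by blast
  obtain D where D: "0 \<le> D" "\<And>x y. x \<in> space M \<Longrightarrow> y \<in> space N \<Longrightarrow> norm (B x y) \<le> D * (f x * g y)"
    using B unfolding kern_def by blast
  show ?thesis
  proof (rule kernI[of _ _ _ "C + D"])
    have "Measurable.pred (M \<Otimes>\<^sub>M N) (\<lambda>q. P (fst q))" using P by measurable
    then show "(\<lambda>q. if P (fst q) then A (fst q) (snd q) else B (fst q) (snd q)) \<in> borel_measurable (M \<Otimes>\<^sub>M N)"
      using A B by (intro measurable_If predE) (auto simp: kern_def)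
    fix x y assume xy: "x \<in> space M" "y \<in> space N"
    have "C * (f x * g y) \<le> (C + D) * (f x * g y)" "D * (f x * g y) \<le> (C + D) * (f x * g y)"
      using C(1) D(1) f g by (intro mult_right_mono; simp)+
    then show "norm (if P x then A x y else B x y) \<le> (C + D) * (f x * g y)"
      using C(2)[OF xy] D(2)[OF xy] by auto
  qed (use C D in auto)
qed

lemma kern_sum:
  assumes "finite I" "\<And>i. i \<in> I \<Longrightarrow> kern M f N g (A i)"
  shows "kern M f N g (\<lambda>x y. \<Sum>i\<in>I. A i x y)"
  using assms by (induction I rule: finite_induct) (auto intro: kern_add kern_zero)

text \<open>Cutting off at \<open>c\<close> makes the growth at \<open>-\<infinity>\<close> irrelevant.\<close>

lemma kern_cut:
  assumes F: "kern lborel (expq a \<kappa>) N p F" and S: "S \<in> sets borel" "\<And>u. u \<in> S \<Longrightarrow> c \<le> u" and p: "\<And>v. 0 \<le> p v"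
    and f': "\<And>u. u \<in> S \<Longrightarrow> exp (a * u) \<le> d * f' u" "\<And>u. 0 \<le> f' u" and "0 \<le> d"
  shows "kern lborel f' N p (\<lambda>u v. if u \<in> S then F u v else 0)"
proof -
  obtain C where C: "0 \<le> C" "\<And>x y. x \<in> space lborel \<Longrightarrow> y \<in> space N \<Longrightarrow> norm (F x y) \<le> C * (expq a \<kappa> x * p y)"
    using F unfolding kern_def by blast
  have FM: "(\<lambda>p. F (fst p) (snd p)) \<in> borel_measurable (lborel \<Otimes>\<^sub>M N)" using F by (simp add: kern_def)
  show ?thesis
  proof (rule kernI[of _ _ _ "C * d * exp (\<bar>\<kappa>\<bar> * (min 0 c)\<^sup>2)"])
    have "Measurable.pred (lborel \<Otimes>\<^sub>M N) (\<lambda>q. fst q \<in> S)"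
      using S(1) by measurable
    then show "(\<lambda>q. if fst q \<in> S then F (fst q) (snd q) else 0) \<in> borel_measurable (lborel \<Otimes>\<^sub>M N)"
      by (intro measurable_If[OF FM borel_measurable_const] predE)
    fix u v assume v: "v \<in> space N"
    show "norm (if u \<in> S then F u v else 0) \<le> C * d * exp (\<bar>\<kappa>\<bar> * (min 0 c)\<^sup>2) * (f' u * p v)"
    proof (cases "u \<in> S")
      case True
      have "\<bar>min 0 u\<bar> \<le> \<bar>min 0 c\<bar>" using S(2)[OF True] by auto
      then have "\<bar>min 0 u\<bar>\<^sup>2 \<le> \<bar>min 0 c\<bar>\<^sup>2" by (intro power_mono) auto
      then have "(min 0 u)\<^sup>2 \<le> (min 0 c)\<^sup>2" by simp
      then have "\<kappa> * (min 0 u)\<^sup>2 \<le> \<bar>\<kappa>\<bar> * (min 0 c)\<^sup>2" by (intro mult_mono) auto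
      then have "expq a \<kappa> u \<le> exp (a * u) * exp (\<bar>\<kappa>\<bar> * (min 0 c)\<^sup>2)"
        unfolding expq_def exp_add[symmetric] by simp
      also have "\<dots> \<le> (d * f' u) * exp (\<bar>\<kappa>\<bar> * (min 0 c)\<^sup>2)"
        using f'(1)[OF True] by (intro mult_right_mono) auto
      finally have "C * (expq a \<kappa> u * p v) \<le> C * ((d * f' u) * exp (\<bar>\<kappa>\<bar> * (min 0 c)\<^sup>2) * p v)"
        using C(1) p by (intro mult_left_mono mult_right_mono) auto
      then show ?thesis using C(2)[of u v] v True by (simp add: ac_simps)
    next
      case False
      then show ?thesis using C(1) p f'(2) \<open>0 \<le> d\<close> by auto
    qed
  qed (use C \<open>0 \<le> d\<close> in auto)
qed

text \<open>Young's inequality where \<open>u\<close> is negative; elsewhere the left side is not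
  positive. It trades an excess exponential slope for an arbitrarily small Gaussian growth at
  -infinity.\<close>

lemma linear_le_min0:
  fixes d u \<epsilon> :: real
  assumes "0 \<le> d" "0 < \<epsilon>"
  shows "- (u * d) \<le> \<epsilon> * (min 0 u)\<^sup>2 + d\<^sup>2 / (4 * \<epsilon>)"
proof -
  have "- (u * d) \<le> (- min 0 u) * d" using assms(1) by (auto simp: min_def mult_nonneg_nonneg)
  moreover have "0 \<le> \<epsilon> * (- min 0 u - d / (2 * \<epsilon>))\<^sup>2" using assms by simp
  moreover have "\<epsilon> * (- min 0 u - d / (2 * \<epsilon>))\<^sup>2 = \<epsilon> * (min 0 u)\<^sup>2 - (- min 0 u) * d + d\<^sup>2 / (4 * \<epsilon>)"
    using assms(2) by (simp add: power2_eq_square field_simps)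
  ultimately show ?thesis by linarith
qed

section \<open>Kernels given by exponentials along a contour\<close>

lemma Re_sq_le: "\<bar>Re (x\<^sup>2)\<bar> \<le> (norm x)\<^sup>2"
  using abs_Re_le_cmod[of "x\<^sup>2"] by (simp add: norm_power)

lemma Re_diff_sq_le: "(c - Re x)\<^sup>2 \<le> 2 * c\<^sup>2 + 2 * (norm x)\<^sup>2"
proof -
  have "(c - Re x)\<^sup>2 \<le> 2 * c\<^sup>2 + 2 * (Re x)\<^sup>2"
    using zero_le_power2[of "c + Re x"] by (simp add: power2_eq_square algebra_simps)
  also have "(Re x)\<^sup>2 \<le> (norm x)\<^sup>2"
    using power_mono[OF abs_Re_le_cmod[of x], of 2] by simp
  finally show ?thesis by simp
qed

text \<open>One form for both contours: replacing z by -w and s by -t turns it into the factor in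
  w.\<close>

definition contour_exp :: "(real \<Rightarrow> complex) \<Rightarrow> (real \<Rightarrow> complex) \<Rightarrow> real \<Rightarrow> real \<Rightarrow> real \<Rightarrow> complex" where
  "contour_exp z dz s u \<sigma> = exp (- ((z \<sigma>) ^ 3 / 3) - of_real s * (z \<sigma>)\<^sup>2 + of_real u * z \<sigma>) * dz \<sigma>"

text \<open>Write u Re z as a u - u (a - Re z). The second part has slope of one sign and costs a
  Gaussian in the negative part of u plus a multiple of |z|^2, which the cubic decay absorbs. The
  spare \<open>\<sigma>\<close>^2 in that decay becomes the weight of the parameter.\<close>

lemma kern_contour_exp:
  assumes [measurable]: "z \<in> borel_measurable borel" "dz \<in> borel_measurable borel"
    and dz_le: "\<And>\<sigma>. norm (dz \<sigma>) \<le> L" and Re_z: "\<And>\<sigma>. Re (z \<sigma>) \<le> a"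
    and z_decay: "\<And>A. \<exists>C. \<forall>\<sigma>. - Re ((z \<sigma>) ^ 3 / 3) + A * (norm (z \<sigma>))\<^sup>2 + \<sigma>\<^sup>2 \<le> C"
    and \<epsilon>: "0 < \<epsilon>"
  shows "kern lborel (expq a \<epsilon>) lborel (\<lambda>\<sigma>. exp (- \<sigma>\<^sup>2)) (contour_exp z dz s)"
proof -
  \<comment> \<open>The term |s| pays for s z^2, and 1 / (2 \<open>\<epsilon>\<close>) for the
    square of a - Re z divided by 4 \<open>\<epsilon>\<close>.\<close>
  obtain C where C: "\<And>\<sigma>. - Re ((z \<sigma>) ^ 3 / 3) + (\<bar>s\<bar> + 1 / (2 * \<epsilon>)) * (norm (z \<sigma>))\<^sup>2 + \<sigma>\<^sup>2 \<le> C"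
    using z_decay by blast
  have L_nonneg: "0 \<le> L" using dz_le[of 0] norm_ge_zero order_trans by blast
  show ?thesis
  proof (rule kernI[of _ _ _ "L * exp (C + a\<^sup>2 / (2 * \<epsilon>))"])
    show "(\<lambda>p. contour_exp z dz s (fst p) (snd p)) \<in> borel_measurable (lborel \<Otimes>\<^sub>M lborel)"
      unfolding contour_exp_def by measurable
    fix u \<sigma> :: real
    let ?z = "z \<sigma>"
    have "- s * Re (?z\<^sup>2) \<le> \<bar>s\<bar> * (norm ?z)\<^sup>2"
    proof -
      have "- s * Re (?z\<^sup>2) \<le> \<bar>s\<bar> * \<bar>Re (?z\<^sup>2)\<bar>" by (metis abs_ge_self abs_mult abs_minus_cancel)
      also have "\<dots> \<le> \<bar>s\<bar> * (norm ?z)\<^sup>2" by (intro mult_left_mono Re_sq_le) auto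
      finally show ?thesis .
    qed
    moreover have "- (u * (a - Re ?z)) \<le> \<epsilon> * (min 0 u)\<^sup>2 + (a - Re ?z)\<^sup>2 / (4 * \<epsilon>)"
      by (rule linear_le_min0[OF _ \<epsilon>]) (use Re_z[of \<sigma>] in simp)
    moreover have "(a - Re ?z)\<^sup>2 / (4 * \<epsilon>) \<le> (2 * a\<^sup>2 + 2 * (norm ?z)\<^sup>2) / (4 * \<epsilon>)"
      using \<epsilon> by (intro divide_right_mono Re_diff_sq_le) auto
    moreover have "(2 * a\<^sup>2 + 2 * (norm ?z)\<^sup>2) / (4 * \<epsilon>) = a\<^sup>2 / (2 * \<epsilon>) + (1 / (2 * \<epsilon>)) * (norm ?z)\<^sup>2"
      using \<epsilon> by (simp add: field_simps)
    moreover have "u * Re ?z = u * a + - (u * (a - Re ?z))" by (simp add: algebra_simps)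
    moreover have "(\<bar>s\<bar> + 1 / (2 * \<epsilon>)) * (norm ?z)\<^sup>2 = \<bar>s\<bar> * (norm ?z)\<^sup>2 + (1 / (2 * \<epsilon>)) * (norm ?z)\<^sup>2"
      by (rule distrib_right)
    ultimately have "- Re (?z ^ 3 / 3) - s * Re (?z\<^sup>2) + u * Re ?z
        \<le> (C + a\<^sup>2 / (2 * \<epsilon>)) + (a * u + \<epsilon> * (min 0 u)\<^sup>2) + - \<sigma>\<^sup>2"
      using C[of \<sigma>] by (simp add: mult.commute[of a u])
    then have "norm (exp (- (?z ^ 3 / 3) - of_real s * ?z\<^sup>2 + of_real u * ?z))
        \<le> exp (C + a\<^sup>2 / (2 * \<epsilon>)) * (expq a \<epsilon> u * exp (- \<sigma>\<^sup>2))"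
      by (simp add: norm_exp_eq_Re expq_def exp_add[symmetric] add.assoc)
    then have "norm (exp (- (?z ^ 3 / 3) - of_real s * ?z\<^sup>2 + of_real u * ?z)) * norm (dz \<sigma>)
        \<le> (exp (C + a\<^sup>2 / (2 * \<epsilon>)) * (expq a \<epsilon> u * exp (- \<sigma>\<^sup>2))) * L"
      using dz_le[of \<sigma>] by (intro mult_mono) (auto simp: expq_def)
    then show "norm (contour_exp z dz s u \<sigma>) \<le> L * exp (C + a\<^sup>2 / (2 * \<epsilon>)) * (expq a \<epsilon> u * exp (- \<sigma>\<^sup>2))"
      unfolding contour_exp_def norm_mult by (simp add: ac_simps)
  qed (use L_nonneg in auto)
qed

text \<open>The eigenvalue e^(r z^2) is exactly what changes the factor e^(-(s+r) z^2) into e^(-s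
  z^2).\<close>

lemma heat_contour_exp:
  assumes r: "0 < r"
  shows "kcomp lborel (heat_ker r) (contour_exp z dz (s + r)) x \<sigma> = contour_exp z dz s x \<sigma>"
proof -
  let ?c = "exp (- ((z \<sigma>) ^ 3 / 3) - of_real (s + r) * (z \<sigma>)\<^sup>2) * dz \<sigma>"
  have "heat_ker r x y * contour_exp z dz (s + r) y \<sigma> = ?c * (of_real (heat_kernel r x y) * exp (of_real y * z \<sigma>))" for y
    unfolding contour_exp_def heat_ker_def by (simp add: exp_add ac_simps)
  then have "kcomp lborel (heat_ker r) (contour_exp z dz (s + r)) x \<sigma> = ?c * exp (of_real x * z \<sigma> + of_real r * (z \<sigma>)\<^sup>2)"
    using heat_kernel_exp[OF r, of x "z \<sigma>"] by (simp add: kcomp_def has_bochner_integral_iff)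
  also have "\<dots> = exp ((- ((z \<sigma>) ^ 3 / 3) - of_real (s + r) * (z \<sigma>)\<^sup>2) + (of_real x * z \<sigma> + of_real r * (z \<sigma>)\<^sup>2)) * dz \<sigma>"
    unfolding exp_add[of "_ - _"] by simp
  also have "\<dots> = contour_exp z dz s x \<sigma>"
    unfolding contour_exp_def by (intro arg_cong2[of _ _ _ _ "(*)"] arg_cong[of _ _ exp] refl) (simp add: algebra_simps)
  finally show ?thesis .
qed

text \<open>The order of \<open>a\<close> and \<open>b\<close> is left open so that the original
  contours are an instance as well as the translated ones; \<open>path_setup\<close> adds it.
  \<open>dw\<close> and \<open>dz\<close> stand for the velocities. The decay is required for every
  \<open>A\<close>, because quadratic terms arise both from the times and from the Gaussian
  weights.\<close>

locale contour_pair =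
  fixes w z dw dz :: "real \<Rightarrow> complex" and a b \<delta> L :: real
  assumes w_meas [measurable]: "w \<in> borel_measurable borel" and z_meas [measurable]: "z \<in> borel_measurable borel"
    and dw_meas [measurable]: "dw \<in> borel_measurable borel" and dz_meas [measurable]: "dz \<in> borel_measurable borel"
    and dw_le: "norm (dw \<tau>) \<le> L" and dz_le: "norm (dz \<sigma>) \<le> L"
    and Re_z: "Re (z \<sigma>) \<le> a" and Re_w: "b \<le> Re (w \<tau>)"
    and \<delta>: "0 < \<delta>" and zw_minus: "\<delta> \<le> norm (z \<sigma> - w \<tau>)" and zw_plus: "\<delta> \<le> norm (z \<sigma> + w \<tau>)"
    and w_decay: "\<exists>C. \<forall>\<tau>. Re ((w \<tau>) ^ 3 / 3) + A * (norm (w \<tau>))\<^sup>2 + \<tau>\<^sup>2 \<le> C"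
    and z_decay: "\<exists>C. \<forall>\<sigma>. - Re ((z \<sigma>) ^ 3 / 3) + A * (norm (z \<sigma>))\<^sup>2 + \<sigma>\<^sup>2 \<le> C"
begin

definition Zk :: "real \<Rightarrow> real \<Rightarrow> real \<Rightarrow> complex" where
  "Zk s u \<sigma> = exp (- ((z \<sigma>) ^ 3 / 3) - of_real s * (z \<sigma>)\<^sup>2 + of_real u * z \<sigma>) * dz \<sigma>"

text \<open>The factor \<open>2w / ((z - w)(z + w))\<close> in partial fractions.\<close>

definition Hk :: "real \<Rightarrow> real \<Rightarrow> complex" where
  "Hk \<sigma> \<tau> = 1 / (2 * of_real pi * \<i>)\<^sup>2 * (1 / (z \<sigma> - w \<tau>) - 1 / (z \<sigma> + w \<tau>))"

definition Rk :: "real \<Rightarrow> real \<Rightarrow> real \<Rightarrow> complex" where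
  "Rk t \<tau> v = exp ((w \<tau>) ^ 3 / 3 + of_real t * (w \<tau>)\<^sup>2 - of_real v * w \<tau>) * dw \<tau>"

definition kk :: "real \<Rightarrow> real \<Rightarrow> real \<Rightarrow> complex" where
  "kk s = kcomp lborel (Zk s) Hk"

lemma Zk_eq: "Zk = contour_exp z dz"
  by (intro ext) (simp add: Zk_def contour_exp_def)

lemma Rk_eq: "Rk t \<tau> v = contour_exp (\<lambda>\<tau>. - w \<tau>) dw (- t) v \<tau>"
  by (simp add: Rk_def contour_exp_def)

lemma kern_Z: "0 < \<epsilon> \<Longrightarrow> kern lborel (expq a \<epsilon>) lborel (\<lambda>\<sigma>. exp (- \<sigma>\<^sup>2)) (Zk s)"
  unfolding Zk_eq by (rule kern_contour_exp[OF z_meas dz_meas dz_le Re_z z_decay])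

lemma kern_R: "0 < \<epsilon> \<Longrightarrow> kern lborel (\<lambda>\<tau>. exp (- \<tau>\<^sup>2)) lborel (expq (- b) \<epsilon>) (Rk t)"
  unfolding Rk_eq[abs_def]
  by (rule kern_transpose, rule kern_contour_exp[OF _ dw_meas dw_le])
    (use Re_w w_decay in \<open>auto simp: power3_eq_cube\<close>)

text \<open>The Cauchy factor is bounded by the separation of the contours but need not decay;
  integrability in both parameters comes from its neighbours \<open>Zk\<close> and
  \<open>Rk\<close>.\<close>

lemma kern_H: "kern lborel (\<lambda>_. 1) lborel (\<lambda>_. 1) Hk"
proof (rule kernI[of _ _ _ "norm (1 / (2 * of_real pi * \<i>)\<^sup>2 :: complex) * (2 / \<delta>)"])
  show "(\<lambda>p. Hk (fst p) (snd p)) \<in> borel_measurable (lborel \<Otimes>\<^sub>M lborel)"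
    unfolding Hk_def by measurable
  fix \<sigma> \<tau> :: real
  have "norm (1 / (z \<sigma> - w \<tau>) - 1 / (z \<sigma> + w \<tau>)) \<le> 1 / norm (z \<sigma> - w \<tau>) + 1 / norm (z \<sigma> + w \<tau>)"
    using norm_triangle_ineq4[of "1 / (z \<sigma> - w \<tau>)" "1 / (z \<sigma> + w \<tau>)"] by (simp add: norm_divide)
  also have "\<dots> \<le> 1 / \<delta> + 1 / \<delta>"
    using \<delta> zw_minus zw_plus by (intro add_mono frac_le) auto
  finally have "norm (1 / (z \<sigma> - w \<tau>) - 1 / (z \<sigma> + w \<tau>)) \<le> 2 / \<delta>" by simp
  then show "norm (Hk \<sigma> \<tau>) \<le> norm (1 / (2 * of_real pi * \<i>)\<^sup>2 :: complex) * (2 / \<delta>) * (1 * 1)"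
    unfolding Hk_def norm_mult mult_1_right by (rule mult_left_mono) (rule norm_ge_zero)
qed (use \<delta> in auto)

lemma integrable_exp_neg_sq: "integrable lborel (\<lambda>x::real. exp (- x\<^sup>2))"
  using integrable_gaussian[of 1 0] by simp

lemma weighted_mid: "weighted_space lborel (\<lambda>_. 1) (\<lambda>\<sigma>. exp (- \<sigma>\<^sup>2))"
  by unfold_locales (use integrable_exp_neg_sq in auto)

lemma weighted_Y: "weighted_space lborel (\<lambda>\<tau>. exp (- \<tau>\<^sup>2)) (\<lambda>_. 1)"
  by unfold_locales (use integrable_exp_neg_sq in auto)

lemma kern_k: "0 < \<epsilon> \<Longrightarrow> kern lborel (expq a \<epsilon>) lborel (\<lambda>_. 1) (kk s)"
  unfolding kk_def by (rule weighted_space.kern_kcomp[OF weighted_mid kern_Z kern_H])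

lemma heat_k:
  assumes r: "0 < r"
  shows "kcomp lborel (heat_ker r) (kk (s + r)) x \<tau> = kk s x \<tau>"
proof -
  define \<epsilon> where "\<epsilon> = 1 / (16 * r)"
  have e: "0 < \<epsilon>" "8 * r * \<epsilon> < 1" using r by (auto simp: \<epsilon>_def)
  have "kern lborel (\<lambda>x. exp (2 * (1 / (8 * r)) * x\<^sup>2)) lborel (\<lambda>y. exp (- (1 / (8 * r) * y\<^sup>2))) (heat_ker r)"
    by (rule kern_heat[OF r]) (use r in auto)
  then have "kcomp lborel (heat_ker r) (kk (s + r)) x \<tau> = kcomp lborel (kcomp lborel (heat_ker r) (Zk (s + r))) Hk x \<tau>"
    unfolding kk_def
    by (intro weighted_space.kcomp_assoc[OF weighted_heat[OF r e(2), of a] weighted_mid _ kern_Z[OF e(1)] kern_H, symmetric]) auto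
  moreover have "kcomp lborel (heat_ker r) (Zk (s + r)) = Zk s"
    unfolding Zk_eq by (intro ext heat_contour_exp[OF r])
  ultimately show ?thesis by (simp add: kk_def)
qed

text \<open>The heat kernel is symmetric, so acting from the right is the eigenfunction identity for
  -w, with time -t = -(t + r) + r.\<close>

lemma R_heat:
  assumes r: "0 < r"
  shows "kcomp lborel (Rk t) (heat_ker r) \<tau> v = Rk (t + r) \<tau> v"
proof -
  have "heat_ker r y v = heat_ker r v y" for y
    unfolding heat_ker_def heat_kernel_def by (simp add: power2_commute)
  then have "kcomp lborel (Rk t) (heat_ker r) \<tau> v = kcomp lborel (heat_ker r) (contour_exp (\<lambda>\<tau>. - w \<tau>) dw (- (t + r) + r)) v \<tau>"
    by (simp add: kcomp_def Rk_eq mult.commute)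
  also have "\<dots> = Rk (t + r) \<tau> v"
    unfolding heat_contour_exp[OF r] Rk_eq ..
  finally show ?thesis .
qed

end

section \<open>The path operator\<close>

lemma expq_nonneg: "0 \<le> expq a \<kappa> u" by (simp add: expq_def)

lemma expq_mono: "\<kappa> \<le> \<kappa>' \<Longrightarrow> expq a \<kappa> u \<le> expq a \<kappa>' u"
  unfolding expq_def by (simp add: mult_right_mono)

lemma expq_le_shift:
  assumes "\<alpha>' \<le> \<alpha>" "\<kappa> < \<kappa>'"
  shows "expq (- \<alpha>) \<kappa> v \<le> exp ((\<alpha> - \<alpha>')\<^sup>2 / (4 * (\<kappa>' - \<kappa>))) * expq (- \<alpha>') \<kappa>' v"
proof -
  have "- (v * (\<alpha> - \<alpha>')) \<le> (\<kappa>' - \<kappa>) * (min 0 v)\<^sup>2 + (\<alpha> - \<alpha>')\<^sup>2 / (4 * (\<kappa>' - \<kappa>))"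
    by (rule linear_le_min0) (use assms in auto)
  then show ?thesis
    unfolding expq_def exp_add[symmetric] by (simp add: algebra_simps)
qed

lemma kern_expq_mono:
  assumes "kern lborel (expq a \<kappa>) N p F" "\<kappa> \<le> \<kappa>'" "\<And>v. 0 \<le> p v"
  shows "kern lborel (expq a \<kappa>') N p F"
  using assms by (intro kern_mono[OF assms(1), of 1 _ 1]) (auto simp: expq_nonneg expq_mono)

lemma kern_restrict:
  assumes F: "kern lborel f N p F" and S: "S \<in> sets borel" and f: "\<And>u. 0 \<le> f u" and p: "\<And>v. 0 \<le> p v"
  shows "kern lborel f N p (\<lambda>u v. if u \<in> S then F u v else 0)"
proof (rule kern_if[OF F kern_zero _ f p])
  show "Measurable.pred lborel (\<lambda>u. u \<in> S)" using S by measurable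
qed

text \<open>On a set bounded below the Gaussian factor is bounded above and away from zero, so any
  prescribed decay at -infinity is available.\<close>

lemma kern_cut_expq:
  assumes F: "kern lborel (expq a \<kappa>) N p F" and S: "S \<in> sets borel" "\<And>u. u \<in> S \<Longrightarrow> c \<le> u"
    and p: "\<And>v. 0 \<le> p v" and \<kappa>': "\<kappa>' \<le> 0"
  shows "kern lborel (expq a \<kappa>') N p (\<lambda>u v. if u \<in> S then F u v else 0)"
proof (rule kern_cut[OF F S p, where d = "exp (- \<kappa>' * (min 0 c)\<^sup>2)"])
  fix u assume "u \<in> S"
  then have "\<bar>min 0 u\<bar> \<le> \<bar>min 0 c\<bar>" using S(2) by fastforce
  then have "\<bar>min 0 u\<bar>\<^sup>2 \<le> \<bar>min 0 c\<bar>\<^sup>2" by (intro power_mono) auto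
  then have "- \<kappa>' * (min 0 u)\<^sup>2 \<le> - \<kappa>' * (min 0 c)\<^sup>2" using \<kappa>' by (intro mult_left_mono) auto
  then show "exp (a * u) \<le> exp (- \<kappa>' * (min 0 c)\<^sup>2) * expq a \<kappa>' u"
    unfolding expq_def exp_add[symmetric] by simp
qed (auto simp: expq_nonneg)

text \<open>Of the exponent (x - y)^2 / (4 r), one half pays for the slope \<open>\<alpha>\<close>,
  leaving the constant exp(2 r \<open>\<alpha>\<close>^2) by completing the square, and the other
  half for the Gaussian weights.\<close>

lemma kern_heat_expq:
  assumes r: "0 < r" and \<beta>: "0 \<le> \<beta>" "16 * r * \<beta> \<le> 1"
  shows "kern lborel (expq \<alpha> (- \<beta>)) lborel (expq (- \<alpha>) (2 * \<beta>)) (heat_ker r)"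
proof (rule kernI[of _ _ _ "exp (2 * r * \<alpha>\<^sup>2) / sqrt (4 * pi * r)"])
  fix x y :: real
  have "\<beta> * (min 0 x)\<^sup>2 \<le> \<beta> * (2 * (min 0 y)\<^sup>2 + 2 * (x - y)\<^sup>2)"
    using \<beta>(1) min0_sq_le by (intro mult_left_mono)
  moreover have "(2 * \<beta>) * (x - y)\<^sup>2 \<le> (1 / (8 * r)) * (x - y)\<^sup>2"
    using \<beta>(2) r by (intro mult_right_mono) (auto simp: field_simps)
  moreover have "- \<alpha> * (x - y) \<le> 2 * r * \<alpha>\<^sup>2 + (1 / (8 * r)) * (x - y)\<^sup>2"
  proof -
    have "0 \<le> (4 * r * \<alpha> + (x - y))\<^sup>2 / (8 * r)" using r by simp
    also have "\<dots> = 2 * r * \<alpha>\<^sup>2 + \<alpha> * (x - y) + (1 / (8 * r)) * (x - y)\<^sup>2"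
      using r by (simp add: power2_eq_square field_simps)
    finally show ?thesis by simp
  qed
  ultimately have "- ((x - y)\<^sup>2 / (4 * r)) \<le> 2 * r * \<alpha>\<^sup>2 + (\<alpha> * x + (- \<beta>) * (min 0 x)\<^sup>2) + (- \<alpha> * y + 2 * \<beta> * (min 0 y)\<^sup>2)"
    using r by (simp add: algebra_simps)
  then have "exp (- ((x - y)\<^sup>2 / (4 * r))) \<le> exp (2 * r * \<alpha>\<^sup>2) * (expq \<alpha> (- \<beta>) x * expq (- \<alpha>) (2 * \<beta>) y)"
    unfolding expq_def exp_add[symmetric] by (simp add: add.assoc)
  then show "norm (heat_ker r x y) \<le> exp (2 * r * \<alpha>\<^sup>2) / sqrt (4 * pi * r) * (expq \<alpha> (- \<beta>) x * expq (- \<alpha>) (2 * \<beta>) y)"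
    using r heat_kernel_nonneg[OF r, of x y] unfolding heat_ker_def norm_of_real
    by (simp add: heat_kernel_def divide_right_mono)
qed (use r in \<open>auto simp: heat_ker_def[abs_def]\<close>)

lemma integrable_expq:
  assumes d: "0 < d" and \<eta>: "0 < \<eta>"
  shows "integrable lborel (expq (- d) (- \<eta>))"
proof (rule Bochner_Integration.integrable_bound)
  have 1: "integrable lborel (exponential_density d)"
  proof -
    interpret prob_space "density lborel (exponential_density d)"
      by (rule prob_space_exponential_density[OF d])
    have "(\<integral>\<^sup>+x. ennreal (exponential_density d x) \<partial>lborel) = 1"
      using emeasure_space_1 by (simp add: emeasure_density)
    then show ?thesis
      using d by (intro integrableI_nonneg) (auto simp: exponential_density_nonneg)
  qed
  show "integrable lborel (\<lambda>u. exponential_density d u / d + exp ((- d) * u - \<eta> * u\<^sup>2))"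
    by (intro Bochner_Integration.integrable_add integrable_divide 1 integrable_gaussian \<eta>)
  show "AE u in lborel. norm (expq (- d) (- \<eta>) u) \<le> norm (exponential_density d u / d + exp ((- d) * u - \<eta> * u\<^sup>2))"
  proof (rule AE_I2)
    fix u :: real
    have "expq (- d) (- \<eta>) u \<le> exponential_density d u / d + exp ((- d) * u - \<eta> * u\<^sup>2)"
      using d by (cases "u < 0") (simp_all add: expq_def exponential_density_def min_def mult.commute)
    then show "norm (expq (- d) (- \<eta>) u) \<le> norm (exponential_density d u / d + exp ((- d) * u - \<eta> * u\<^sup>2))"
      by (simp add: expq_nonneg)
  qed
qed measurable

text \<open>The first inequality gives exponential decay at +infinity, the second one Gaussian decay
  at -infinity.\<close>

lemma weighted_expq:
  assumes "a < b" "\<epsilon> < \<beta>"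
  shows "weighted_space lborel (expq a (- \<beta>)) (expq (- b) \<epsilon>)"
proof (unfold_locales)
  have "expq a (- \<beta>) u * expq (- b) \<epsilon> u = expq (- (b - a)) (- (\<beta> - \<epsilon>)) u" for u
    unfolding expq_def exp_add[symmetric] by (simp add: algebra_simps)
  then show "integrable lborel (\<lambda>u. expq a (- \<beta>) u * expq (- b) \<epsilon> u)"
    using integrable_expq[of "b - a" "\<beta> - \<epsilon>"] assms by simp
qed (auto simp: expq_nonneg)

context weighted_space
begin

lemma kcomp_cong_AE:
  assumes A: "kern L f' M g A" and B: "kern M f N g' B" "kern M f N g' B'" and x: "x \<in> space L" "y \<in> space N"
    and ae: "AE z in M. B z y = B' z y"
  shows "kcomp M A B x y = kcomp M A B' x y"
  unfolding kcomp_def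
  using kcomp_integrable[OF A B(1) x] kcomp_integrable[OF A B(2) x] ae
  by (intro integral_cong_AE) auto

lemma kcomp_sum_right:
  assumes A: "kern L f' M g A" and I: "finite I" and B: "\<And>i. i \<in> I \<Longrightarrow> kern M f N g' (B i)" and x: "x \<in> space L" "y \<in> space N"
  shows "kcomp M A (\<lambda>z y. \<Sum>i\<in>I. B i z y) x y = (\<Sum>i\<in>I. kcomp M A (B i) x y)"
  unfolding kcomp_def sum_distrib_left
  by (rule Bochner_Integration.integral_sum) (rule kcomp_integrable[OF A B x])

lemma kcomp_diff_left:
  assumes "kern L f' M g A" "kern L f' M g A'" "kern M f N g' B" "x \<in> space L" "y \<in> space N"
  shows "kcomp M (\<lambda>x y. A x y - A' x y) B x y = kcomp M A B x y - kcomp M A' B x y"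
  unfolding kcomp_def left_diff_distrib using assms
  by (intro Bochner_Integration.integral_diff kcomp_integrable)

end

text \<open>With \<open>a < b\<close> the weight e^(a u) of \<open>kk\<close> and the weight e^(-b
  u) of \<open>Rk\<close> can be paired on the line.\<close>

locale path_setup = contour_pair +
  fixes n :: nat and t x :: "nat \<Rightarrow> real"
  assumes ab: "a < b" and n1: "1 \<le> n" and t_mono: "strict_mono_on {1..n} t"
begin

definition lev :: "nat \<Rightarrow> real" where "lev i = x i - neg_sq (t i)"

text \<open>The tail of \<open>path_op\<close> behind the projection at level \<open>i\<close>, so
  that an induction can run down from \<open>n\<close>.\<close>

definition Top :: "nat \<Rightarrow> (real \<Rightarrow> complex) \<Rightarrow> real \<Rightarrow> complex" where
  "Top i = foldr (\<lambda>k T. heat_op (t (Suc k) - t k) \<circ> Pbar (lev (Suc k)) \<circ> T) [i..<n] id"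

text \<open>\<open>E i\<close> is \<open>e\<^bsup>(t\<^sub>i\<^sub>+\<^sub>1-t\<^sub>i)\<Delta>\<^esup> P\<^bsub>a\<^sub>i\<^sub>+\<^sub>1\<^esub> \<cdots> P\<^bsub>a\<^sub>n\<^esub>\<close> applied to \<open>k\<^sub>n\<close>, and \<open>\<phi>\<close> solves
  \<open>\<phi> = \<chi>k + N\<phi>\<close>. The cutoffs in \<open>D\<close> and \<open>\<phi>\<close> overlap in the null set \<open>{a\<^sub>i}\<close>, because both \<open>\<chi>\<close> and
  \<open>P\<close> are defined with weak inequalities.\<close>

definition E :: "nat \<Rightarrow> real \<Rightarrow> real \<Rightarrow> complex" where
  "E i u \<tau> = Top i (\<lambda>u'. kk (t n) u' \<tau>) u"

definition D :: "nat \<Rightarrow> real \<Rightarrow> real \<Rightarrow> complex" where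
  "D i u \<tau> = (if u \<in> {..lev i} then E i u \<tau> else 0)"

definition \<phi> :: "nat \<Rightarrow> real \<Rightarrow> real \<Rightarrow> complex" where
  "\<phi> i u \<tau> = (if u \<in> {lev i..} then E i u \<tau> else 0)"

text \<open>The summand 1 keeps \<open>\<rho>\<close> positive for \<open>n = 1\<close> and strictly
  above every time gap.\<close>

definition \<rho> :: real where "\<rho> = t n - t 1 + 1"

text \<open>For all gaps r < \<open>\<rho>\<close> one has 8 r \<open>\<epsilon>\<close> < 1 and 16
  r \<open>\<beta>\<close> \<le> 1, so that heat kernels may act on weights with these rates, and
  the growth \<open>\<epsilon>\<close> stays below the decay \<open>\<beta>\<close>.\<close>

definition \<epsilon> :: real where "\<epsilon> = 1 / (32 * \<rho>)"

definition \<beta> :: real where "\<beta> = 1 / (16 * \<rho>)"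

definition Pt :: "real \<Rightarrow> real \<Rightarrow> complex" where
  "Pt u \<tau> = kk (t 1) u \<tau> - D 1 u \<tau>"

lemma t_le: "i \<in> {1..n} \<Longrightarrow> t 1 \<le> t i \<and> t i \<le> t n"
  using n1 strict_mono_on_leD[OF t_mono, of 1 i] strict_mono_on_leD[OF t_mono, of i n] by auto

lemma t_less: "i \<in> {1..n} \<Longrightarrow> j \<in> {1..n} \<Longrightarrow> i < j \<Longrightarrow> t i < t j"
  using strict_mono_onD[OF t_mono] by blast

lemma t_less_iff: "i \<in> {1..n} \<Longrightarrow> j \<in> {1..n} \<Longrightarrow> t i < t j \<longleftrightarrow> i < j"
  using strict_mono_on_less[OF t_mono] by blast

lemma t_diff_less: "i \<in> {1..n} \<Longrightarrow> j \<in> {1..n} \<Longrightarrow> t j - t i < \<rho>"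
  using t_le[of i] t_le[of j] by (simp add: \<rho>_def)

lemma \<rho>_pos: "0 < \<rho>"
  using t_le[of n] n1 by (simp add: \<rho>_def)

lemma eps_beta: "0 < \<epsilon>" "\<epsilon> < \<beta>" "0 < \<beta>"
  using \<rho>_pos by (auto simp: \<epsilon>_def \<beta>_def field_simps)

lemma Top_n: "Top n = id" by (simp add: Top_def)

lemma Top_step: "i < n \<Longrightarrow> Top i = heat_op (t (Suc i) - t i) \<circ> Pbar (lev (Suc i)) \<circ> Top (Suc i)"
  by (simp add: Top_def upt_conv_Cons)

lemma E_n: "E n = kk (t n)" by (intro ext) (simp add: E_def Top_n)

lemma E_step: "i < n \<Longrightarrow> E i = kcomp lborel (heat_ker (t (Suc i) - t i)) (D (Suc i))"
  by (intro ext) (simp add: E_def Top_step kcomp_def heat_op_def heat_ker_def Pbar_def D_def cong: if_cong)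

lemma heat_kern_at:
  assumes "0 < r"
  shows "kern lborel (\<lambda>x. exp (2 * (1 / (8 * r)) * x\<^sup>2)) lborel (\<lambda>y. exp (- (1 / (8 * r) * y\<^sup>2))) (heat_ker r)"
  by (rule kern_heat) (use assms in auto)

lemma weighted_eps:
  assumes "0 < r" "r < \<rho>"
  shows "weighted_space lborel (expq a \<epsilon>) (\<lambda>y. exp (- (1 / (8 * r) * y\<^sup>2)))"
proof (rule weighted_heat[OF assms(1)])
  have "8 * r * \<epsilon> \<le> 8 * \<rho> * \<epsilon>" using assms eps_beta by (intro mult_right_mono) auto
  also have "\<dots> < 1" using \<rho>_pos by (simp add: \<epsilon>_def)
  finally show "8 * r * \<epsilon> < 1" .
qed

lemma kern_phi:
  assumes "kern lborel (expq a \<epsilon>) lborel (\<lambda>_. 1) (E j)" "\<kappa> \<le> 0"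
  shows "kern lborel (expq a \<kappa>) lborel (\<lambda>_. 1) (\<phi> j)"
  unfolding \<phi>_def[abs_def] by (rule kern_cut_expq[OF assms(1), of _ "lev j"]) (use assms in auto)

text \<open>Being cut off from below, \<open>\<phi> j\<close> may be given the decay 2
  \<open>\<beta>\<close>, which the heat kernel halves.\<close>

lemma kern_heat_phi:
  assumes r: "0 < r" "r < \<rho>" and E: "kern lborel (expq a \<epsilon>) lborel (\<lambda>_. 1) (E j)"
  shows "kern lborel (expq a (- \<beta>)) lborel (\<lambda>_. 1) (kcomp lborel (heat_ker r) (\<phi> j))"
proof (rule kern_kcomp_heat[OF r(1) _ kern_phi[OF E, of "- (2 * \<beta>)"]])
  have "8 * r * (2 * \<beta>) \<le> 8 * \<rho> * (2 * \<beta>)" using r eps_beta by (intro mult_right_mono) auto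
  also have "\<dots> = 1" using \<rho>_pos by (simp add: \<beta>_def)
  finally show "0 \<le> - (2 * \<beta>) \<and> 16 * r * - (2 * \<beta>) \<le> 1 \<and> - \<beta> = 2 * - (2 * \<beta>)
    \<or> - (2 * \<beta>) \<le> 0 \<and> 8 * r * - (- (2 * \<beta>)) \<le> 1 \<and> - \<beta> = - (2 * \<beta>) / 2"
    using eps_beta by simp
qed (use eps_beta in auto)

lemma kern_k_eps: "kern lborel (expq a \<epsilon>) lborel (\<lambda>_. 1) (kk s)"
  by (rule kern_k[OF eps_beta(1)])

text \<open>Almost everywhere \<open>D\<close> is \<open>E\<close> minus \<open>\<phi>\<close>, so
  E_i = e^(r\<Delta>) (E_(i+1) - \<phi>_(i+1)); the evolution of k and the semigroup law give the
  formula. The bound is carried through the same induction because it is read off from the formula: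
  estimating \<open>E_step\<close> directly would double the Gaussian growth at each step, whereas
  every k_i grows with rate \<open>\<epsilon>\<close> and the heat terms even decay.\<close>

lemma E_props:
  assumes "m \<le> n" "1 \<le> m"
  shows "\<forall>i\<in>{m..n}. kern lborel (expq a \<epsilon>) lborel (\<lambda>_. 1) (E i) \<and>
    (\<forall>u \<tau>. E i u \<tau> = kk (t i) u \<tau> - (\<Sum>j\<in>{Suc i..n}. kcomp lborel (heat_ker (t j - t i)) (\<phi> j) u \<tau>))"
  using assms
proof (induction m rule: inc_induct)
  case base
  then show ?case by (simp add: E_n kern_k_eps)
next
  case (step i)
  note IH = step.IH[OF le_SucI[OF step.prems]]
  have i: "i \<in> {1..n}" "Suc i \<in> {1..n}" using step by auto
  define r where "r = t (Suc i) - t i"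
  have r: "0 < r" "r < \<rho>" using t_less[OF i] t_diff_less[OF i] by (auto simp: r_def)
  have kE: "kern lborel (expq a \<epsilon>) lborel (\<lambda>_. 1) (E j)" if "j \<in> {Suc i..n}" for j
    using IH that by blast
  have kE': "kern lborel (expq a \<epsilon>) lborel (\<lambda>_. 1) (E (Suc i))" using kE i by auto
  have kphi: "kern lborel (expq a \<epsilon>) lborel (\<lambda>_. 1) (\<phi> j)" if "j \<in> {Suc i..n}" for j
    by (rule kern_expq_mono[OF kern_phi[OF kE[OF that], of 0]]) (use eps_beta in auto)
  have kheat: "kern lborel (expq a \<epsilon>) lborel (\<lambda>_. 1) (kcomp lborel (heat_ker (t j - t l)) (\<phi> j))"
    if "j \<in> {Suc i..n}" "l \<in> {1..n}" "l < j" for j l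
  proof (rule kern_expq_mono[OF kern_heat_phi[OF _ _ kE[OF that(1)]]])
    have "j \<in> {1..n}" using that by auto
    then show "0 < t j - t l" "t j - t l < \<rho>"
      using t_less[OF that(2) _ that(3)] t_diff_less[OF that(2)] by auto
  qed (use eps_beta in auto)
  interpret W: weighted_space lborel "expq a \<epsilon>" "\<lambda>y. exp (- (1 / (8 * r) * y\<^sup>2))"
    by (rule weighted_eps[OF r])
  note kh = heat_kern_at[OF r(1)]
  have kD: "kern lborel (expq a \<epsilon>) lborel (\<lambda>_. 1) (D (Suc i))"
    unfolding D_def[abs_def] by (rule kern_restrict[OF kE']) (auto simp: expq_nonneg)
  have eq: "E i u \<tau> = kk (t i) u \<tau> - (\<Sum>j\<in>{Suc i..n}. kcomp lborel (heat_ker (t j - t i)) (\<phi> j) u \<tau>)" for u \<tau>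
  proof -
    let ?S = "\<lambda>u \<tau>. \<Sum>j\<in>{Suc (Suc i)..n}. kcomp lborel (heat_ker (t j - t (Suc i))) (\<phi> j) u \<tau>"
    have kS: "kern lborel (expq a \<epsilon>) lborel (\<lambda>_. 1) ?S"
      by (rule kern_sum) (use kheat i in auto)
    have "E i u \<tau> = kcomp lborel (heat_ker r) (D (Suc i)) u \<tau>"
      using step.hyps by (simp add: E_step r_def)
    also have "\<dots> = kcomp lborel (heat_ker r) (\<lambda>u \<tau>. E (Suc i) u \<tau> - \<phi> (Suc i) u \<tau>) u \<tau>"
    proof (rule W.kcomp_cong_AE[OF kh kD])
      show "kern lborel (expq a \<epsilon>) lborel (\<lambda>_. 1) (\<lambda>u \<tau>. E (Suc i) u \<tau> - \<phi> (Suc i) u \<tau>)"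
        using kE' kphi[of "Suc i"] i by (intro kern_diff) auto
      have "AE u in lborel. u \<noteq> lev (Suc i)" by (rule AE_lborel_singleton)
      then show "AE u in lborel. D (Suc i) u \<tau> = E (Suc i) u \<tau> - \<phi> (Suc i) u \<tau>"
        by eventually_elim (auto simp: D_def \<phi>_def)
    qed auto
    also have "\<dots> = kcomp lborel (heat_ker r) (E (Suc i)) u \<tau> - kcomp lborel (heat_ker r) (\<phi> (Suc i)) u \<tau>"
      using kE' kphi[of "Suc i"] i by (intro W.kcomp_diff_right[OF kh]) auto
    also have "kcomp lborel (heat_ker r) (E (Suc i)) u \<tau> = kcomp lborel (heat_ker r) (\<lambda>u \<tau>. kk (t (Suc i)) u \<tau> - ?S u \<tau>) u \<tau>"
      by (rule kcomp_cong) (use IH i in auto)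
    also have "\<dots> = kcomp lborel (heat_ker r) (kk (t (Suc i))) u \<tau> - kcomp lborel (heat_ker r) ?S u \<tau>"
      by (rule W.kcomp_diff_right[OF kh kern_k_eps kS]) auto
    also have "kcomp lborel (heat_ker r) (kk (t (Suc i))) u \<tau> = kk (t i) u \<tau>"
      using heat_k[OF r(1), of "t i"] by (simp add: r_def)
    also have "kcomp lborel (heat_ker r) ?S u \<tau>
        = (\<Sum>j\<in>{Suc (Suc i)..n}. kcomp lborel (heat_ker r) (kcomp lborel (heat_ker (t j - t (Suc i))) (\<phi> j)) u \<tau>)"
      by (rule W.kcomp_sum_right[OF kh, where N = lborel and g' = "\<lambda>_. 1"]) (use kheat i in auto)
    also have "\<dots> = (\<Sum>j\<in>{Suc (Suc i)..n}. kcomp lborel (heat_ker (t j - t i)) (\<phi> j) u \<tau>)"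
    proof (rule sum.cong[OF refl])
      fix j assume j: "j \<in> {Suc (Suc i)..n}"
      then have "kern lborel (expq a 0) lborel (\<lambda>_. 1) (\<phi> j)" using kE[of j] by (intro kern_phi) auto
      then have "kcomp lborel (heat_ker r) (kcomp lborel (heat_ker (t j - t (Suc i))) (\<phi> j)) u \<tau>
          = kcomp lborel (heat_ker (r + (t j - t (Suc i)))) (\<phi> j) u \<tau>"
        using j i t_less[of "Suc i" j] by (intro kcomp_heat_heat[OF r(1)]) auto
      then show "kcomp lborel (heat_ker r) (kcomp lborel (heat_ker (t j - t (Suc i))) (\<phi> j)) u \<tau>
          = kcomp lborel (heat_ker (t j - t i)) (\<phi> j) u \<tau>"
        by (simp add: r_def)
    qed
    finally show ?thesis
      using i by (subst sum.atLeast_Suc_atMost) (auto simp: r_def)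
  qed
  have "kern lborel (expq a \<epsilon>) lborel (\<lambda>_. 1) (E i)"
  proof (rule kern_cong)
    show "kern lborel (expq a \<epsilon>) lborel (\<lambda>_. 1)
        (\<lambda>u \<tau>. kk (t i) u \<tau> - (\<Sum>j\<in>{Suc i..n}. kcomp lborel (heat_ker (t j - t i)) (\<phi> j) u \<tau>))"
      using kheat i by (intro kern_diff kern_k_eps kern_sum) auto
  qed (rule eq)
  moreover have "{i..n} = insert i {Suc i..n}" using i by auto
  ultimately show ?case using eq IH by simp
qed

lemma kern_E: "i \<in> {1..n} \<Longrightarrow> kern lborel (expq a \<epsilon>) lborel (\<lambda>_. 1) (E i)"
  using E_props[of 1] n1 by auto

lemma E_eq: "i \<in> {1..n} \<Longrightarrow>
  E i u \<tau> = kk (t i) u \<tau> - (\<Sum>j\<in>{Suc i..n}. kcomp lborel (heat_ker (t j - t i)) (\<phi> j) u \<tau>)"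
  using E_props[of 1] n1 by auto

lemma kern_D: "i \<in> {1..n} \<Longrightarrow> kern lborel (expq a \<epsilon>) lborel (\<lambda>_. 1) (D i)"
  unfolding D_def[abs_def] by (rule kern_restrict[OF kern_E]) (auto simp: expq_nonneg)

lemma kern_heat_phi': "j \<in> {Suc 1..n} \<Longrightarrow>
  kern lborel (expq a (- \<beta>)) lborel (\<lambda>_. 1) (kcomp lborel (heat_ker (t j - t 1)) (\<phi> j))"
  using t_less[of 1 j] t_diff_less[of 1 j] by (intro kern_heat_phi kern_E) auto

text \<open>The cancellation that yields decay at -infinity: left of \<open>lev 1\<close> the
  growing \<open>kk\<close> drops out and only heat evolutions of cut off functions remain. The
  half-line is open because \<open>D\<close> includes its endpoint.\<close>

lemma Pt_eq:
  "Pt u \<tau> = (\<Sum>j\<in>{Suc 1..n}. kcomp lborel (heat_ker (t j - t 1)) (\<phi> j) u \<tau>) + (if u \<in> {lev 1<..} then E 1 u \<tau> else 0)"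
  using E_eq[of 1 u \<tau>] n1 by (auto simp: Pt_def D_def)

lemma kern_Pt: "kern lborel (expq a (- \<beta>)) lborel (\<lambda>_. 1) Pt"
proof (rule kern_cong[OF _ Pt_eq])
  have "kern lborel (expq a (- \<beta>)) lborel (\<lambda>_. 1) (\<lambda>u \<tau>. if u \<in> {lev 1<..} then E 1 u \<tau> else 0)"
    by (rule kern_cut_expq[OF kern_E, of _ _ "lev 1"]) (use n1 eps_beta in auto)
  then show "kern lborel (expq a (- \<beta>)) lborel (\<lambda>_. 1) (\<lambda>u \<tau>.
      (\<Sum>j\<in>{Suc 1..n}. kcomp lborel (heat_ker (t j - t 1)) (\<phi> j) u \<tau>) + (if u \<in> {lev 1<..} then E 1 u \<tau> else 0))"
    using kern_heat_phi' by (intro kern_add kern_sum) auto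
qed

lemma weighted_Z: "weighted_space lborel (expq a (- \<beta>)) (expq (- b) \<epsilon>)"
  by (rule weighted_expq[OF ab eps_beta(2)])

lemma R_heat_phi:
  assumes j: "j \<in> {Suc 1..n}"
  shows "kcomp lborel (Rk (t 1)) (kcomp lborel (heat_ker (t j - t 1)) (\<phi> j)) \<tau> \<tau>' = kcomp lborel (Rk (t j)) (\<phi> j) \<tau> \<tau>'"
proof -
  define r where "r = t j - t 1"
  have r: "0 < r" using t_less[of 1 j] j by (auto simp: r_def)
  \<comment> \<open>A slope strictly between \<open>a\<close> and \<open>b\<close> lets the heat
    kernel be paired with \<open>\<phi> j\<close> on one side and with \<open>Rk\<close> on the
    other.\<close>
  define \<alpha> where "\<alpha> = (a + b) / 2"
  have \<alpha>: "a < \<alpha>" "\<alpha> < b" using ab by (auto simp: \<alpha>_def)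
  \<comment> \<open>The Gaussian rates interlace: growth \<open>\<gamma>\<close> / 2 of
    \<open>Rk\<close> against decay \<open>\<gamma>\<close>, and growth 2 \<open>\<gamma>\<close> of
    the heat kernel against decay 3 \<open>\<gamma>\<close> of \<open>\<phi> j\<close>.\<close>
  define \<gamma> where "\<gamma> = 1 / (16 * r)"
  have \<gamma>: "0 < \<gamma>" "16 * r * \<gamma> \<le> 1" using r by (auto simp: \<gamma>_def)
  interpret W: weighted_space lborel "expq \<alpha> (- \<gamma>)" "expq (- b) (\<gamma> / 2)"
    by (rule weighted_expq) (use \<alpha> \<gamma> in auto)
  have w2: "weighted_space lborel (expq a (- (3 * \<gamma>))) (expq (- \<alpha>) (2 * \<gamma>))"
    by (rule weighted_expq) (use \<alpha> \<gamma> in auto)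
  have kp: "kern lborel (expq a (- (3 * \<gamma>))) lborel (\<lambda>_. 1) (\<phi> j)"
    by (rule kern_phi[OF kern_E]) (use j \<gamma> in auto)
  have "kcomp lborel (kcomp lborel (Rk (t 1)) (heat_ker r)) (\<phi> j) \<tau> \<tau>' = kcomp lborel (Rk (t 1)) (kcomp lborel (heat_ker r) (\<phi> j)) \<tau> \<tau>'"
    by (rule W.kcomp_assoc[OF w2 kern_R kern_heat_expq kp]) (use r \<gamma> in auto)
  moreover have "kcomp lborel (Rk (t 1)) (heat_ker r) = Rk (t j)"
    by (intro ext) (simp add: R_heat[OF r], simp add: r_def)
  ultimately show ?thesis by (simp add: r_def)
qed

lemma R_Pt: "kcomp lborel (Rk (t 1)) Pt \<tau> \<tau>' = (\<Sum>j\<in>{1..n}. kcomp lborel (Rk (t j)) (\<phi> j) \<tau> \<tau>')"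
proof -
  interpret W: weighted_space lborel "expq a (- \<beta>)" "expq (- b) \<epsilon>" by (rule weighted_Z)
  note kR = kern_R[OF eps_beta(1)]
  have kp: "kern lborel (expq a (- \<beta>)) lborel (\<lambda>_. 1) (\<phi> 1)"
    by (rule kern_phi[OF kern_E]) (use n1 eps_beta in auto)
  have ks: "kern lborel (expq a (- \<beta>)) lborel (\<lambda>_. 1) (\<lambda>u \<tau>. \<Sum>j\<in>{Suc 1..n}. kcomp lborel (heat_ker (t j - t 1)) (\<phi> j) u \<tau>)"
    using kern_heat_phi' by (intro kern_sum) auto
  have "kcomp lborel (Rk (t 1)) Pt \<tau> \<tau>' = kcomp lborel (Rk (t 1))
      (\<lambda>u \<tau>. \<phi> 1 u \<tau> + (\<Sum>j\<in>{Suc 1..n}. kcomp lborel (heat_ker (t j - t 1)) (\<phi> j) u \<tau>)) \<tau> \<tau>'"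
  proof (rule W.kcomp_cong_AE[OF kR kern_Pt kern_add[OF kp ks]])
    have "AE u in lborel. u \<noteq> lev 1" by (rule AE_lborel_singleton)
    then show "AE u in lborel. Pt u \<tau>' = \<phi> 1 u \<tau>' + (\<Sum>j\<in>{Suc 1..n}. kcomp lborel (heat_ker (t j - t 1)) (\<phi> j) u \<tau>')"
      by eventually_elim (auto simp: Pt_eq \<phi>_def)
  qed auto
  also have "\<dots> = kcomp lborel (Rk (t 1)) (\<phi> 1) \<tau> \<tau>'
      + kcomp lborel (Rk (t 1)) (\<lambda>u \<tau>. \<Sum>j\<in>{Suc 1..n}. kcomp lborel (heat_ker (t j - t 1)) (\<phi> j) u \<tau>) \<tau> \<tau>'"
    by (rule W.kcomp_add_right[OF kR kp ks]) auto
  also have "kcomp lborel (Rk (t 1)) (\<lambda>u \<tau>. \<Sum>j\<in>{Suc 1..n}. kcomp lborel (heat_ker (t j - t 1)) (\<phi> j) u \<tau>) \<tau> \<tau>'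
      = (\<Sum>j\<in>{Suc 1..n}. kcomp lborel (Rk (t 1)) (kcomp lborel (heat_ker (t j - t 1)) (\<phi> j)) \<tau> \<tau>')"
    by (rule W.kcomp_sum_right[OF kR]) (use kern_heat_phi' in auto)
  also have "\<dots> = (\<Sum>j\<in>{Suc 1..n}. kcomp lborel (Rk (t j)) (\<phi> j) \<tau> \<tau>')"
    by (rule sum.cong[OF refl R_heat_phi])
  also have "kcomp lborel (Rk (t 1)) (\<phi> 1) \<tau> \<tau>' + \<dots> = (\<Sum>j\<in>{1..n}. kcomp lborel (Rk (t j)) (\<phi> j) \<tau> \<tau>')"
    using n1 by (subst sum.atLeast_Suc_atMost[of 1 n]) auto
  finally show ?thesis .
qed

text \<open>The path operator acts on the first variable only, so associativity moves
  \<open>Rk\<close> out of it, one heat operator at a time.\<close>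

lemma Top_K:
  assumes "m \<le> n" "1 \<le> m"
  shows "Top m (\<lambda>u'. kcomp lborel (kk (t n)) (Rk (t 1)) u' v) u = kcomp lborel (E m) (Rk (t 1)) u v"
  using assms
proof (induction m arbitrary: u rule: inc_induct)
  case base
  then show ?case by (simp add: Top_n E_n)
next
  case (step i)
  have i: "i \<in> {1..n}" "Suc i \<in> {1..n}" using step by auto
  define r where "r = t (Suc i) - t i"
  have r: "0 < r" "r < \<rho>" using t_less[OF i] t_diff_less[OF i] by (auto simp: r_def)
  interpret W: weighted_space lborel "expq a \<epsilon>" "\<lambda>y. exp (- (1 / (8 * r) * y\<^sup>2))"
    by (rule weighted_eps[OF r])
  have "Top i (\<lambda>u'. kcomp lborel (kk (t n)) (Rk (t 1)) u' v) u
      = heat_op r (\<lambda>y. Pbar (lev (Suc i)) (Top (Suc i) (\<lambda>u'. kcomp lborel (kk (t n)) (Rk (t 1)) u' v)) y) u"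
    using step.hyps by (simp add: Top_step r_def)
  also have "(\<lambda>y. Pbar (lev (Suc i)) (Top (Suc i) (\<lambda>u'. kcomp lborel (kk (t n)) (Rk (t 1)) u' v)) y)
      = (\<lambda>y. kcomp lborel (D (Suc i)) (Rk (t 1)) y v)"
    using step.IH[OF le_SucI[OF step.prems]] by (auto simp: Pbar_def kcomp_def D_def fun_eq_iff)
  also have "heat_op r \<dots> u = kcomp lborel (heat_ker r) (kcomp lborel (D (Suc i)) (Rk (t 1))) u v"
    by (rule heat_op_eq_kcomp)
  also have "\<dots> = kcomp lborel (kcomp lborel (heat_ker r) (D (Suc i))) (Rk (t 1)) u v"
    by (rule W.kcomp_assoc[OF weighted_Y heat_kern_at[OF r(1)] kern_D[OF i(2)] kern_R[OF eps_beta(1)], symmetric]) auto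
  also have "kcomp lborel (heat_ker r) (D (Suc i)) = E i"
    using step.hyps by (simp add: E_step r_def)
  finally show ?case .
qed

lemma Pt_R: "kcomp lborel Pt (Rk (t 1)) u v = kcomp lborel (kk (t 1)) (Rk (t 1)) u v
    - path_op t lev n (\<lambda>u'. kcomp lborel (kk (t n)) (Rk (t 1)) u' v) u"
proof -
  have "kcomp lborel Pt (Rk (t 1)) u v = kcomp lborel (kk (t 1)) (Rk (t 1)) u v - kcomp lborel (D 1) (Rk (t 1)) u v"
    unfolding Pt_def[abs_def] using n1
    by (intro weighted_space.kcomp_diff_left[OF weighted_Y kern_k_eps kern_D kern_R[OF eps_beta(1)]]) auto
  also have "kcomp lborel (D 1) (Rk (t 1)) u v = path_op t lev n (\<lambda>u'. kcomp lborel (kk (t n)) (Rk (t 1)) u' v) u"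
  proof -
    have "path_op t lev n = Pbar (lev 1) \<circ> Top 1" by (simp add: path_op_def Top_def)
    then show ?thesis
      using Top_K[of 1 v u] n1 by (simp add: Pbar_def kcomp_def D_def)
  qed
  finally show ?thesis .
qed

end

section \<open>Eliminating the heat kernels\<close>

lemma fredholm_det_cong:
  assumes "weighted_space M f g" "\<And>x y. x \<in> space M \<Longrightarrow> y \<in> space M \<Longrightarrow> A x y = B x y"
  shows "fredholm_det M A = fredholm_det M B"
proof -
  interpret weighted_space M f g by fact
  have "dI {..<m} (\<lambda>_. A) = dI {..<m} (\<lambda>_. B)" for m
    by (rule dI_cong) (rule assms(2))
  then show ?thesis by (simp add: fredholm_det_eq_dI)
qed

lemma kern_shift_left:
  assumes "kern lborel f N g A"
  shows "kern lborel (\<lambda>u. f (u - c)) N g (\<lambda>u y. A (u - c) y)"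
proof -
  obtain C where C: "0 \<le> C" "\<And>x y. x \<in> space lborel \<Longrightarrow> y \<in> space N \<Longrightarrow> norm (A x y) \<le> C * (f x * g y)"
    using assms unfolding kern_def by blast
  have "(\<lambda>q. A (fst q - c) (snd q)) \<in> borel_measurable (lborel \<Otimes>\<^sub>M N)"
    by (rule kern_meas[OF assms]) measurable
  then show ?thesis using C by (intro kernI[of _ _ _ C]) auto
qed

lemma kern_shift_right:
  assumes "kern M f lborel g A"
  shows "kern M f lborel (\<lambda>v. g (v - c)) (\<lambda>x v. A x (v - c))"
  by (rule kern_transpose[OF kern_shift_left[OF kern_transpose[OF assms]]])

lemma measurable_finite_first:
  fixes h :: "nat \<Rightarrow> 'a \<Rightarrow> 'b :: real_normed_vector"
  assumes I: "finite I" and i: "i \<in> measurable M (count_space I)"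
    and h: "\<And>k. k \<in> I \<Longrightarrow> h k \<in> borel_measurable M"
  shows "(\<lambda>x. h (i x) x) \<in> borel_measurable M"
  by (rule measurable_compose_countable'[OF h i countable_finite[OF I]])

lemma kern_finite_left:
  fixes N :: "'b measure" and f :: "nat \<Rightarrow> real \<Rightarrow> real"
  assumes I: "finite I" and A: "\<And>i. i \<in> I \<Longrightarrow> kern lborel (f i) N g (A i)" and f: "\<And>i u. 0 \<le> f i u" and g: "\<And>y. 0 \<le> g y"
  shows "kern (count_space I \<Otimes>\<^sub>M lborel) (\<lambda>p. f (fst p) (snd p)) N g (\<lambda>p y. A (fst p) (snd p) y)"
proof -
  have "\<exists>C\<ge>0. \<forall>x. \<forall>y\<in>space N. norm (A i x y) \<le> C * (f i x * g y)" if "i \<in> I" for i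
    using A[OF that] unfolding kern_def by simp
  then obtain C where C: "\<And>i. i \<in> I \<Longrightarrow> 0 \<le> C i"
      "\<And>i x y. i \<in> I \<Longrightarrow> y \<in> space N \<Longrightarrow> norm (A i x y) \<le> C i * (f i x * g y)"
    by metis
  show ?thesis
  proof (rule kernI[of _ _ _ "sum C I"])
    have 1: "(\<lambda>q. A k (snd (fst q)) (snd q)) \<in> borel_measurable ((count_space I \<Otimes>\<^sub>M lborel) \<Otimes>\<^sub>M N)" if "k \<in> I" for k
      by (rule kern_meas[OF A[OF that]]) measurable
    have 2: "(\<lambda>q. fst (fst q)) \<in> measurable ((count_space I \<Otimes>\<^sub>M lborel) \<Otimes>\<^sub>M N) (count_space I)"
      by measurable
    show "(\<lambda>q. A (fst (fst q)) (snd (fst q)) (snd q)) \<in> borel_measurable ((count_space I \<Otimes>\<^sub>M lborel) \<Otimes>\<^sub>M N)"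
      by (rule measurable_finite_first[OF I 2 1])
    fix p :: "nat \<times> real" and y assume "p \<in> space (count_space I \<Otimes>\<^sub>M lborel)" and y: "y \<in> space N"
    then have p: "fst p \<in> I" by (auto simp: space_pair_measure)
    have "C (fst p) \<le> sum C I" by (rule member_le_sum[OF p]) (use C I in auto)
    then have "C (fst p) * (f (fst p) (snd p) * g y) \<le> sum C I * (f (fst p) (snd p) * g y)"
      using f g by (intro mult_right_mono) auto
    then show "norm (A (fst p) (snd p) y) \<le> sum C I * (f (fst p) (snd p) * g y)"
      using C(2)[OF p y, of "snd p"] by linarith
  qed (use C in \<open>auto intro: sum_nonneg\<close>)
qed

lemma kern_finite_right:
  fixes M :: "'a measure" and g :: "nat \<Rightarrow> real \<Rightarrow> real"
  assumes I: "finite I" and A: "\<And>i. i \<in> I \<Longrightarrow> kern M f lborel (g i) (A i)" and f: "\<And>x. 0 \<le> f x" and g: "\<And>i v. 0 \<le> g i v"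
  shows "kern M f (count_space I \<Otimes>\<^sub>M lborel) (\<lambda>p. g (fst p) (snd p)) (\<lambda>x p. A (fst p) x (snd p))"
  by (rule kern_transpose, rule kern_finite_left[OF I kern_transpose[OF A] g f])

lemma sigma_finite_finite_times_lborel: "finite I \<Longrightarrow> sigma_finite_measure (count_space I \<Otimes>\<^sub>M (lborel :: real measure))"
proof -
  assume I: "finite I"
  interpret sigma_finite_measure "count_space I"
    by (rule sigma_finite_measure_count_space_finite[OF I])
  interpret pair_sigma_finite "count_space I" "lborel :: real measure" ..
  show ?thesis by unfold_locales
qed

lemma integral_finite_times_lborel:
  fixes h :: "nat \<times> real \<Rightarrow> 'b :: {banach, second_countable_topology}"
  assumes I: "finite I" and h: "integrable (count_space I \<Otimes>\<^sub>M lborel) h"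
  shows "(\<integral>p. h p \<partial>(count_space I \<Otimes>\<^sub>M lborel)) = (\<Sum>i\<in>I. \<integral>u. h (i, u) \<partial>lborel)"
proof -
  interpret C: sigma_finite_measure "count_space I"
    by (rule sigma_finite_measure_count_space_finite[OF I])
  interpret pair_sigma_finite "count_space I" "lborel :: real measure" ..
  have "(\<integral>p. h p \<partial>(count_space I \<Otimes>\<^sub>M lborel)) = (\<integral>i. \<integral>u. h (i, u) \<partial>lborel \<partial>count_space I)"
    by (rule integral_fst'[OF h, symmetric])
  then show ?thesis by (simp add: lebesgue_integral_count_space_finite[OF I])
qed

lemma integrable_finite_times_lborel:
  fixes h :: "nat \<Rightarrow> real \<Rightarrow> real"
  assumes I: "finite I" and h: "\<And>i. i \<in> I \<Longrightarrow> integrable lborel (h i)"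
  shows "integrable (count_space I \<Otimes>\<^sub>M lborel) (\<lambda>p. h (fst p) (snd p))"
proof -
  interpret C: sigma_finite_measure "count_space I"
    by (rule sigma_finite_measure_count_space_finite[OF I])
  interpret pair_sigma_finite "count_space I" "lborel :: real measure" ..
  have m: "(\<lambda>p. h (fst p) (snd p)) \<in> borel_measurable (count_space I \<Otimes>\<^sub>M lborel)"
  proof (rule measurable_finite_first[OF I measurable_fst])
    fix k assume "k \<in> I"
    then have "h k \<in> borel_measurable lborel" using h by auto
    then show "(\<lambda>p. h k (snd p)) \<in> borel_measurable (count_space I \<Otimes>\<^sub>M lborel)"
      by (rule measurable_compose[OF measurable_snd])
  qed
  show ?thesis
    by (rule Fubini_integrable[OF m]) (use h I in \<open>auto simp: AE_count_space integrable_count_space\<close>)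
qed

lemma integral_shift: "(\<integral>v. h (v - c) \<partial>lborel) = (\<integral>v. h v \<partial>lborel)" for h :: "real \<Rightarrow> complex"
  using lborel_integral_real_affine[of 1 h "- c"] by simp

section \<open>Weights on the extended space and elimination row by row\<close>

context path_setup
begin

definition XS :: "(nat \<times> real) measure" where "XS = count_space {1..n} \<Otimes>\<^sub>M lborel"

text \<open>Row \<open>i\<close> gets the exponent \<open>b - i * step\<close> and column
  \<open>j\<close> gets \<open>b - (j - 1) * step\<close>. On the diagonal the row exponent is
  smaller by \<open>step\<close>, which gives integrability. For \<open>i < j\<close> it is at least
  the column exponent, as the heat kernel requires.\<close>

definition step :: real where "step = (b - a) / n"

text \<open>The heat kernel is not integrable along its diagonal. It is dominated all the same because the
  exponents decrease with the row index and it only leads to rows of larger index.\<close>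

definition fb :: "nat \<Rightarrow> real \<Rightarrow> real" where
  "fb i u = (if lev i \<le> u then exp ((b - real i * step) * u) else 0)"

text \<open>The Gaussian growth at -infinity costs nothing against \<open>fb\<close>, which vanishes
  below \<open>lev i\<close>, and it absorbs the growth of \<open>Rk\<close> and the differences
  between exponents.\<close>

definition gb :: "nat \<Rightarrow> real \<Rightarrow> real" where
  "gb j v = expq (- (b - (real j - 1) * step)) 1 v"

definition fX :: "nat \<times> real \<Rightarrow> real" where "fX p = fb (fst p) (snd p - neg_sq (t (fst p)))"

definition gX :: "nat \<times> real \<Rightarrow> real" where "gX p = gb (fst p) (snd p - neg_sq (t (fst p)))"

definition PX :: "nat \<times> real \<Rightarrow> real \<Rightarrow> complex" where
  "PX p \<tau> = \<phi> (fst p) (snd p - neg_sq (t (fst p))) \<tau>"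

definition kcut :: "nat \<Rightarrow> real \<Rightarrow> real \<Rightarrow> complex" where
  "kcut i u \<tau> = (if u \<in> {lev i..} then kk (t i) u \<tau> else 0)"

definition kX :: "nat \<times> real \<Rightarrow> real \<Rightarrow> complex" where
  "kX p \<tau> = kcut (fst p) (snd p - neg_sq (t (fst p))) \<tau>"

definition RX :: "real \<Rightarrow> nat \<times> real \<Rightarrow> complex" where
  "RX \<tau> p = Rk (t (fst p)) \<tau> (snd p - neg_sq (t (fst p)))"

definition Nb :: "nat \<Rightarrow> nat \<Rightarrow> real \<Rightarrow> real \<Rightarrow> complex" where
  "Nb i j u v = (if i < j then if u \<in> {lev i..} then - heat_ker (t j - t i) u v else 0 else 0)"

definition NX :: "nat \<times> real \<Rightarrow> nat \<times> real \<Rightarrow> complex" where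
  "NX p q = Nb (fst p) (fst q) (snd p - neg_sq (t (fst p))) (snd q - neg_sq (t (fst q)))"

lemma step_pos: "0 < step" using ab n1 by (simp add: step_def)

lemma step_le: "i \<le> n \<Longrightarrow> a \<le> b - real i * step"
proof -
  assume "i \<le> n"
  then have "real i * step \<le> real n * step" using step_pos by (intro mult_right_mono) auto
  also have "\<dots> = b - a" using n1 by (simp add: step_def)
  finally show ?thesis by simp
qed

lemma fb_nonneg: "0 \<le> fb i u" by (simp add: fb_def)
lemma gb_nonneg: "0 \<le> gb i u" by (simp add: gb_def expq_nonneg)

lemma kern_cut_fb:
  assumes F: "kern lborel (expq a \<kappa>) lborel (\<lambda>_. 1) F" and i: "i \<in> {1..n}"
  shows "kern lborel (fb i) lborel (\<lambda>_. 1) (\<lambda>u \<tau>. if u \<in> {lev i..} then F u \<tau> else 0)"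
proof (rule kern_cut[OF F, where c = "lev i" and d = "exp ((a - (b - real i * step)) * lev i)"])
  fix u assume u: "u \<in> {lev i..}"
  have "(a - (b - real i * step)) * u \<le> (a - (b - real i * step)) * lev i"
    using step_le[of i] i u by (intro mult_left_mono_neg) auto
  then show "exp (a * u) \<le> exp ((a - (b - real i * step)) * lev i) * fb i u"
    using u by (simp add: fb_def exp_add[symmetric] algebra_simps)
qed (auto simp: fb_nonneg)

lemma kern_Nb:
  assumes i: "i \<in> {1..n}" and j: "j \<in> {1..n}"
  shows "kern lborel (fb i) lborel (gb j) (Nb i j)"
proof (cases "i < j")
  case True
  define r where "r = t j - t i"
  have r: "0 < r" using t_less[OF i j True] by (simp add: r_def)
  define \<alpha> where "\<alpha> = b - real i * step"
  \<comment> \<open>The first bound is the condition of \<open>kern_heat_expq\<close>; the second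
    keeps 2 \<open>\<gamma>\<close> below the coefficient 1 in \<open>gb\<close>, so that the
    exponent may be changed.\<close>
  define \<gamma> where "\<gamma> = min (1 / (16 * r)) (1 / 4)"
  have \<gamma>: "0 \<le> \<gamma>" "2 * \<gamma> < 1" using r by (auto simp: \<gamma>_def)
  have "16 * r * \<gamma> \<le> 16 * r * (1 / (16 * r))" using r by (intro mult_left_mono) (auto simp: \<gamma>_def)
  then have \<gamma>': "16 * r * \<gamma> \<le> 1" using r by simp
  have "kern lborel (fb i) lborel (expq (- \<alpha>) (2 * \<gamma>)) (\<lambda>u v. if u \<in> {lev i..} then heat_ker r u v else 0)"
    by (rule kern_cut[OF kern_heat_expq[OF r \<gamma>(1) \<gamma>'], where c = "lev i" and d = 1])
      (auto simp: fb_def \<alpha>_def expq_nonneg)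
  then have "kern lborel (fb i) lborel (gb j) (\<lambda>u v. if u \<in> {lev i..} then heat_ker r u v else 0)"
  proof (rule kern_mono[where c = 1])
    have "(real i) * step \<le> (real j - 1) * step"
      using True step_pos by (intro mult_right_mono) auto
    then have "expq (- \<alpha>) (2 * \<gamma>) v \<le> exp ((\<alpha> - (b - (real j - 1) * step))\<^sup>2 / (4 * (1 - 2 * \<gamma>))) * gb j v" for v
      unfolding gb_def using \<gamma> by (intro expq_le_shift) (auto simp: \<alpha>_def)
    then show "0 \<le> expq (- \<alpha>) (2 * \<gamma>) v \<and> expq (- \<alpha>) (2 * \<gamma>) v
        \<le> exp ((\<alpha> - (b - (real j - 1) * step))\<^sup>2 / (4 * (1 - 2 * \<gamma>))) * gb j v" for v
      by (simp add: expq_nonneg)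
  qed (auto simp: fb_nonneg)
  then have "kern lborel (fb i) lborel (gb j) (\<lambda>u v. - (if u \<in> {lev i..} then heat_ker r u v else 0))"
    by (rule kern_minus)
  then show ?thesis
    by (rule kern_cong) (use True in \<open>auto simp: Nb_def r_def\<close>)
next
  case False
  then show ?thesis by (intro kern_cong[OF kern_zero]) (auto simp: Nb_def)
qed

lemma kern_R_gb:
  assumes j: "j \<in> {1..n}"
  shows "kern lborel (\<lambda>\<tau>. exp (- \<tau>\<^sup>2)) lborel (gb j) (Rk (t j))"
proof (rule kern_mono[OF kern_R[of "1 / 2"], where c = 1])
  have "0 \<le> (real j - 1) * step" using j step_pos by (intro mult_nonneg_nonneg) auto
  then have "expq (- b) (1 / 2) v \<le> exp ((b - (b - (real j - 1) * step))\<^sup>2 / (4 * (1 - 1 / 2))) * gb j v" for v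
    unfolding gb_def by (intro expq_le_shift) auto
  then show "0 \<le> expq (- b) (1 / 2) v \<and> expq (- b) (1 / 2) v
      \<le> exp ((b - (b - (real j - 1) * step))\<^sup>2 / (4 * (1 - 1 / 2))) * gb j v" for v
    by (simp add: expq_nonneg)
qed auto

lemma kern_kX: "kern XS fX lborel (\<lambda>_. 1) kX"
proof -
  have "kern lborel (\<lambda>u. fb i (u - neg_sq (t i))) lborel (\<lambda>_. 1) (\<lambda>u \<tau>. kcut i (u - neg_sq (t i)) \<tau>)" if "i \<in> {1..n}" for i
    unfolding kcut_def[abs_def] by (rule kern_shift_left[OF kern_cut_fb[OF kern_k_eps that]])
  then show ?thesis
    unfolding XS_def fX_def[abs_def] kX_def[abs_def] by (intro kern_finite_left) (auto simp: fb_nonneg)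
qed

lemma kern_PX: "kern XS fX lborel (\<lambda>_. 1) PX"
proof -
  have "kern lborel (\<lambda>u. fb i (u - neg_sq (t i))) lborel (\<lambda>_. 1) (\<lambda>u \<tau>. \<phi> i (u - neg_sq (t i)) \<tau>)" if "i \<in> {1..n}" for i
    unfolding \<phi>_def[abs_def] by (rule kern_shift_left[OF kern_cut_fb[OF kern_E[OF that] that]])
  then show ?thesis
    unfolding XS_def fX_def[abs_def] PX_def[abs_def] by (intro kern_finite_left) (auto simp: fb_nonneg)
qed

lemma kern_RX: "kern lborel (\<lambda>\<tau>. exp (- \<tau>\<^sup>2)) XS gX RX"
proof -
  have "kern lborel (\<lambda>\<tau>. exp (- \<tau>\<^sup>2)) lborel (\<lambda>v. gb j (v - neg_sq (t j))) (\<lambda>\<tau> v. Rk (t j) \<tau> (v - neg_sq (t j)))"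
    if "j \<in> {1..n}" for j
    by (rule kern_shift_right[OF kern_R_gb[OF that]])
  then show ?thesis
    unfolding XS_def gX_def[abs_def] RX_def[abs_def]
    by (intro kern_finite_right[where A = "\<lambda>j \<tau> v. Rk (t j) \<tau> (v - neg_sq (t j))" and g = "\<lambda>j v. gb j (v - neg_sq (t j))"])
      (auto simp: gb_nonneg)
qed

lemma kern_NX: "kern XS fX XS gX NX"
proof -
  have 1: "kern lborel (\<lambda>u. fb i (u - neg_sq (t i))) lborel (\<lambda>v. gb j (v - neg_sq (t j)))
      (\<lambda>u v. Nb i j (u - neg_sq (t i)) (v - neg_sq (t j)))" if "i \<in> {1..n}" "j \<in> {1..n}" for i j
    by (rule kern_shift_right[OF kern_shift_left[OF kern_Nb[OF that]]])
  have 2: "kern lborel (\<lambda>u. fb i (u - neg_sq (t i))) XS gX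
      (\<lambda>u q. Nb i (fst q) (u - neg_sq (t i)) (snd q - neg_sq (t (fst q))))" if "i \<in> {1..n}" for i
    unfolding XS_def gX_def[abs_def]
    by (intro kern_finite_right[where A = "\<lambda>j u v. Nb i j (u - neg_sq (t i)) (v - neg_sq (t j))"
          and g = "\<lambda>j v. gb j (v - neg_sq (t j))"])
      (use 1 that in \<open>auto simp: gb_nonneg fb_nonneg\<close>)
  show ?thesis
    unfolding NX_def[abs_def] fX_def[abs_def] XS_def
    by (intro kern_finite_left[where A = "\<lambda>i u q. Nb i (fst q) (u - neg_sq (t i)) (snd q - neg_sq (t (fst q)))"
          and f = "\<lambda>i u. fb i (u - neg_sq (t i))"])
      (use 2 in \<open>auto simp: gX_def gb_nonneg fb_nonneg XS_def\<close>)
qed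

lemma weighted_X: "weighted_space XS fX gX"
proof -
  interpret sigma_finite_measure XS
    unfolding XS_def by (rule sigma_finite_finite_times_lborel) simp
  show ?thesis
  proof unfold_locales
    have [measurable]: "fb i \<in> borel_measurable borel" "gb i \<in> borel_measurable borel" for i
      unfolding fb_def[abs_def] gb_def[abs_def] by measurable
    show "fX \<in> borel_measurable XS" "gX \<in> borel_measurable XS"
      unfolding fX_def[abs_def] gX_def[abs_def] XS_def
      by (rule measurable_finite_first[where i = fst and I = "{1..n}"]; measurable)+
    show "0 \<le> fX p" "0 \<le> gX p" for p by (simp_all add: fX_def gX_def fb_nonneg gb_nonneg)
    have "integrable lborel (\<lambda>u. fb i u * gb i u)" for i
    proof (rule Bochner_Integration.integrable_bound)
      \<comment> \<open>Above \<open>lev i\<close> the growth in \<open>gb\<close> may be turned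
        into decay of the same rate at the price of this constant.\<close>
      show "integrable lborel (\<lambda>u. exp (2 * (min 0 (lev i))\<^sup>2) * expq (- step) (- 1) u)"
        using integrable_expq[OF step_pos, of 1] by simp
      show "(\<lambda>u. fb i u * gb i u) \<in> borel_measurable lborel" by measurable
      show "AE u in lborel. norm (fb i u * gb i u) \<le> norm (exp (2 * (min 0 (lev i))\<^sup>2) * expq (- step) (- 1) u)"
      proof (rule AE_I2)
        fix u :: real
        have "fb i u * gb i u \<le> exp (2 * (min 0 (lev i))\<^sup>2) * expq (- step) (- 1) u"
        proof (cases "lev i \<le> u")
          case True
          then have "\<bar>min 0 u\<bar>\<^sup>2 \<le> \<bar>min 0 (lev i)\<bar>\<^sup>2" by (intro power_mono) auto
          then show ?thesis
            using True by (simp add: fb_def gb_def expq_def exp_add[symmetric] algebra_simps)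
        qed (simp add: fb_def expq_nonneg)
        then show "norm (fb i u * gb i u) \<le> norm (exp (2 * (min 0 (lev i))\<^sup>2) * expq (- step) (- 1) u)"
          by (simp add: fb_nonneg gb_nonneg expq_nonneg abs_mult)
      qed
    qed
    then have "integrable lborel (\<lambda>u. fb i (- c + 1 * u) * gb i (- c + 1 * u))" for i c
      by (rule lborel_integrable_real_affine) simp
    then show "integrable XS (\<lambda>p. fX p * gX p)"
      unfolding XS_def fX_def gX_def
      by (intro integrable_finite_times_lborel[where h = "\<lambda>i u. fb i (u - neg_sq (t i)) * gb i (u - neg_sq (t i))"]) auto
  qed
qed

lemma kcomp_XS:
  assumes A: "kern K f' XS gX A" and B: "kern XS fX N g' B" and x: "p \<in> space K" "q \<in> space N"
  shows "kcomp XS A B p q = (\<Sum>j\<in>{1..n}. \<integral>v. A p (j, v) * B (j, v) q \<partial>lborel)"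
  unfolding kcomp_def
  using weighted_space.kcomp_integrable[OF weighted_X A B x] unfolding XS_def
  by (intro integral_finite_times_lborel) auto

lemma PX_eq:
  assumes p: "p \<in> space XS"
  shows "PX p \<tau> = kX p \<tau> + kcomp XS NX PX p \<tau>"
proof -
  obtain i u where iu: "p = (i, u)" "i \<in> {1..n}" using p by (auto simp: XS_def space_pair_measure)
  define u' where "u' = u - neg_sq (t i)"
  have "kcomp XS NX PX p \<tau> = (\<Sum>j\<in>{1..n}. \<integral>v. NX p (j, v) * PX (j, v) \<tau> \<partial>lborel)"
    by (rule kcomp_XS[OF kern_NX kern_PX p]) simp
  also have "\<dots> = (\<Sum>j\<in>{1..n}. kcomp lborel (Nb i j) (\<phi> j) u' \<tau>)"
  proof (rule sum.cong[OF refl])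
    fix j
    show "(\<integral>v. NX p (j, v) * PX (j, v) \<tau> \<partial>lborel) = kcomp lborel (Nb i j) (\<phi> j) u' \<tau>"
      using integral_shift[of "\<lambda>v. Nb i j u' v * \<phi> j v \<tau>" "neg_sq (t j)"]
      by (simp add: NX_def PX_def iu u'_def kcomp_def)
  qed
  also have "\<dots> = (\<Sum>j\<in>{Suc i..n}. kcomp lborel (Nb i j) (\<phi> j) u' \<tau>)"
    by (rule sum.mono_neutral_right) (auto simp: kcomp_def Nb_def)
  also have "\<dots> = (if u' \<in> {lev i..} then - (\<Sum>j\<in>{Suc i..n}. kcomp lborel (heat_ker (t j - t i)) (\<phi> j) u' \<tau>) else 0)"
    by (auto simp: kcomp_def Nb_def sum_negf[symmetric] intro!: sum.cong)
  finally show ?thesis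
    using E_eq[OF iu(2), of u' \<tau>] by (auto simp: PX_def kX_def kcut_def \<phi>_def iu(1) u'_def[symmetric])
qed

text \<open>Rows above \<open>m\<close> are already in the final form \<phi>R and the others are
  original. Thus \<open>AX n\<close> is the extended kernel with cutoff, and \<open>AX 0\<close> the
  fully reduced one.\<close>

definition AX :: "nat \<Rightarrow> nat \<times> real \<Rightarrow> nat \<times> real \<Rightarrow> complex" where
  "AX m p q = (if m < fst p then kcomp lborel PX RX p q else NX p q + kcomp lborel kX RX p q)"

lemma kern_AX: "kern XS fX XS gX (AX m)"
proof -
  have k: "kern XS fX XS gX (kcomp lborel PX RX)" "kern XS fX XS gX (kcomp lborel kX RX)"
    by (rule weighted_space.kern_kcomp[OF weighted_Y _ kern_RX]; rule kern_PX kern_kX)+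
  have "Measurable.pred XS (\<lambda>p. m < fst p)" unfolding XS_def by measurable
  then show ?thesis
    unfolding AX_def[abs_def] using k kern_NX
    by (intro kern_if kern_add) (auto simp: fX_def gX_def fb_nonneg gb_nonneg)
qed

text \<open>Row operations with the rows of \<open>NX\<close> clear its upper triangle, from the last row upwards.\<close>

lemma fredholm_det_AX_step:
  assumes m: "1 \<le> m" "m \<le> n"
  shows "fredholm_det XS (AX (m - 1)) = fredholm_det XS (AX m)"
proof -
  interpret X: weighted_space XS fX gX by (rule weighted_X)
  \<comment> \<open>Row \<open>m\<close> of -N. Since N leads only to rows above \<open>m\<close>,
    where \<open>F\<close> vanishes, \<open>F\<close> has zero diagonal and square zero, as the
    shear requires.\<close>
  define F where "F p q = (if fst p = m then - NX p q else 0)" for p q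
  have "Measurable.pred XS (\<lambda>p. fst p = m)" unfolding XS_def by measurable
  then have kF: "kern XS fX XS gX F"
    unfolding F_def[abs_def] using kern_NX
    by (intro kern_if kern_minus kern_zero) (auto simp: fX_def gX_def fb_nonneg gb_nonneg)
  have "fredholm_det XS (\<lambda>p q. AX m p q + (F p q - kcomp XS F (AX m) p q)) = fredholm_det XS (AX m)"
  proof (rule X.fredholm_det_shear[OF kern_AX kF])
    have "(\<lambda>p. F p p) = (\<lambda>_. 0)" by (auto simp: F_def NX_def Nb_def)
    then show "ktrace XS F = 0" by (simp only: ktrace_def integral_zero)
    show "kcomp XS F F p q = 0" for p q
    proof -
      have "(\<lambda>r. F p r * F r q) = (\<lambda>_. 0)" by (auto simp: F_def NX_def Nb_def)
      then show ?thesis by (simp only: kcomp_def integral_zero)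
    qed
  qed
  moreover have "AX (m - 1) p q = AX m p q + (F p q - kcomp XS F (AX m) p q)"
    if p: "p \<in> space XS" and q: "q \<in> space XS" for p q
  proof (cases "fst p = m")
    case True
    \<comment> \<open>Only rows above \<open>m\<close> enter the product, and there
      \<open>AX m\<close> is already \<phi>R; the equation for \<open>PX\<close> then replaces row
      \<open>m\<close>.\<close>
    have N0: "NX p r = 0" if "fst r \<le> m" for r using that True by (simp add: NX_def Nb_def)
    have "kcomp XS F (AX m) p q = - kcomp XS NX (kcomp lborel PX RX) p q"
    proof -
      have "(\<lambda>r. F p r * AX m r q) = (\<lambda>r. - (NX p r * kcomp lborel PX RX r q))"
      proof
        fix r
        show "F p r * AX m r q = - (NX p r * kcomp lborel PX RX r q)"
          using True N0[of r] by (cases "fst r \<le> m") (auto simp: F_def AX_def)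
      qed
      then show ?thesis by (simp add: kcomp_def[of XS])
    qed
    also have "kcomp XS NX (kcomp lborel PX RX) p q = kcomp lborel (kcomp XS NX PX) RX p q"
      by (rule X.kcomp_assoc[OF weighted_Y kern_NX kern_PX kern_RX p q, symmetric])
    finally have 1: "kcomp XS F (AX m) p q = - kcomp lborel (kcomp XS NX PX) RX p q" .
    have "kcomp lborel PX RX p q = kcomp lborel (\<lambda>p \<tau>. kX p \<tau> + kcomp XS NX PX p \<tau>) RX p q"
      by (rule kcomp_cong) (use PX_eq[OF p] in auto)
    also have "\<dots> = kcomp lborel kX RX p q + kcomp lborel (kcomp XS NX PX) RX p q"
      by (rule weighted_space.kcomp_add_left[OF weighted_Y kern_kX X.kern_kcomp[OF kern_NX kern_PX] kern_RX p q])
    finally show ?thesis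
      using True m 1 by (simp add: AX_def F_def)
  next
    case False
    then have "m - 1 < fst p \<longleftrightarrow> m < fst p" by auto
    then show ?thesis using False by (simp add: AX_def F_def kcomp_def)
  qed
  ultimately show ?thesis
    using fredholm_det_cong[OF weighted_X, of "AX (m - 1)" "\<lambda>p q. AX m p q + (F p q - kcomp XS F (AX m) p q)"]
    by simp
qed

lemma fredholm_det_AX: "m \<le> n \<Longrightarrow> fredholm_det XS (AX m) = fredholm_det XS (AX 0)"
proof (induction m)
  case (Suc m)
  then show ?case using fredholm_det_AX_step[of "Suc m"] by simp
qed simp

theorem fredholm_det_path:
  "fredholm_det XS (AX n) = fredholm_det lborel (kcomp lborel Pt (Rk (t 1)))"
proof -
  have "fredholm_det XS (AX n) = fredholm_det XS (AX 0)"
    by (rule fredholm_det_AX) simp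
  also have "\<dots> = fredholm_det XS (kcomp lborel PX RX)"
    by (rule fredholm_det_cong[OF weighted_X]) (auto simp: AX_def XS_def space_pair_measure)
  also have "\<dots> = fredholm_det lborel (kcomp XS RX PX)"
    by (rule fredholm_det_cyclic[OF weighted_X weighted_Y kern_PX kern_RX])
  also have "kcomp XS RX PX = kcomp lborel (Rk (t 1)) Pt"
  proof (intro ext)
    fix \<tau> \<tau>'
    have "kcomp XS RX PX \<tau> \<tau>' = (\<Sum>j\<in>{1..n}. \<integral>v. RX \<tau> (j, v) * PX (j, v) \<tau>' \<partial>lborel)"
      by (rule kcomp_XS[OF kern_RX kern_PX]) auto
    also have "\<dots> = (\<Sum>j\<in>{1..n}. kcomp lborel (Rk (t j)) (\<phi> j) \<tau> \<tau>')"
    proof (rule sum.cong[OF refl])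
      fix j
      show "(\<integral>v. RX \<tau> (j, v) * PX (j, v) \<tau>' \<partial>lborel) = kcomp lborel (Rk (t j)) (\<phi> j) \<tau> \<tau>'"
        using integral_shift[of "\<lambda>v. Rk (t j) \<tau> v * \<phi> j v \<tau>'" "neg_sq (t j)"]
        by (simp add: RX_def PX_def kcomp_def)
    qed
    finally show "kcomp XS RX PX \<tau> \<tau>' = kcomp lborel (Rk (t 1)) Pt \<tau> \<tau>'"
      by (simp only: R_Pt)
  qed
  also have "fredholm_det lborel (kcomp lborel (Rk (t 1)) Pt) = fredholm_det lborel (kcomp lborel Pt (Rk (t 1)))"
    by (rule fredholm_det_cyclic[OF weighted_Y weighted_Z kern_R[OF eps_beta(1)] kern_Pt])
  finally show ?thesis .
qed

lemma fredholm_convergent_path: "fredholm_convergent lborel (kcomp lborel Pt (Rk (t 1)))"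
  by (rule weighted_space.fredholm_convergent_kern[OF weighted_Z
        weighted_space.kern_kcomp[OF weighted_Y kern_Pt kern_R[OF eps_beta(1)]]])

end

section \<open>Contours\<close>

lemma norm_vector_derivative_le:
  fixes \<gamma> :: "real \<Rightarrow> 'a :: real_normed_vector"
  assumes L: "L-lipschitz_on UNIV \<gamma>" and d: "(\<gamma> has_vector_derivative D) (at u)"
  shows "norm D \<le> L"
proof -
  have "((\<lambda>h. (\<gamma> (u + h) - \<gamma> u) /\<^sub>R h) \<longlongrightarrow> D) (at 0)"
  proof -
    have lim: "((\<lambda>h. norm (\<gamma> (u + h) - \<gamma> u - h *\<^sub>R D) / norm h) \<longlongrightarrow> 0) (at 0)"
      using d unfolding has_vector_derivative_def has_derivative_at by simp
    have "norm ((\<gamma> (u + h) - \<gamma> u) /\<^sub>R h - D) \<le> norm (\<gamma> (u + h) - \<gamma> u - h *\<^sub>R D) / norm h" if "h \<noteq> 0" for h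
    proof -
      have "(\<gamma> (u + h) - \<gamma> u) /\<^sub>R h - D = (\<gamma> (u + h) - \<gamma> u - h *\<^sub>R D) /\<^sub>R h"
        using that by (simp add: scaleR_diff_right)
      then show ?thesis by (simp add: divide_inverse_commute)
    qed
    then have "\<forall>\<^sub>F h in at 0. norm ((\<gamma> (u + h) - \<gamma> u) /\<^sub>R h - D) \<le> norm (\<gamma> (u + h) - \<gamma> u - h *\<^sub>R D) / norm h"
      by (auto simp: eventually_at_filter)
    then have "((\<lambda>h. (\<gamma> (u + h) - \<gamma> u) /\<^sub>R h - D) \<longlongrightarrow> 0) (at 0)"
      by (rule Lim_null_comparison[OF _ lim])
    then show ?thesis by (simp add: Lim_null[symmetric])
  qed
  moreover have "norm ((\<gamma> (u + h) - \<gamma> u) /\<^sub>R h) \<le> L" if "h \<noteq> 0" for h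
  proof -
    have "norm (\<gamma> (u + h) - \<gamma> u) \<le> L * \<bar>h\<bar>"
      using lipschitz_onD[OF L, of "u + h" u] by (simp add: dist_norm)
    then show ?thesis using that by (simp add: divide_simps)
  qed
  then have "\<forall>\<^sub>F h in at 0. norm ((\<gamma> (u + h) - \<gamma> u) /\<^sub>R h) \<le> L"
    by (auto simp: eventually_at_filter)
  ultimately show ?thesis
    by (intro Lim_norm_ubound[of "at 0"]) auto
qed

text \<open>A bound for the speed that also covers the finitely many points where the curve is not differentiable.\<close>

lemma ray_contour_speed:
  assumes "ray_contour \<alpha> \<beta> \<gamma>"
  shows "\<exists>L. \<forall>u. norm (vector_derivative \<gamma> (at u)) \<le> L"
    and "(\<lambda>u. vector_derivative \<gamma> (at u)) \<in> borel_measurable borel"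
proof -
  obtain L S where L: "L-lipschitz_on UNIV \<gamma>" and S: "finite S" "\<gamma> C1_differentiable_on (UNIV - S)"
    using assms by (auto simp: ray_contour_def piecewise_C1_differentiable_on_def)
  have d: "\<gamma> differentiable at u" if "u \<notin> S" for u
    using S(2) that by (simp add: C1_differentiable_on_eq)
  have "norm (vector_derivative \<gamma> (at u)) \<le> L + (\<Sum>v\<in>S. norm (vector_derivative \<gamma> (at v)))" for u
  proof (cases "u \<in> S")
    case True
    have "norm (vector_derivative \<gamma> (at u)) \<le> (\<Sum>v\<in>S. norm (vector_derivative \<gamma> (at v)))"
      using S(1) True by (intro member_le_sum) auto
    then show ?thesis using lipschitz_on_nonneg[OF L] by simp
  next
    case False
    have "norm (vector_derivative \<gamma> (at u)) \<le> L"
      using d[OF False] by (intro norm_vector_derivative_le[OF L, of _ u]) (simp only: vector_derivative_works)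
    moreover have "0 \<le> (\<Sum>v\<in>S. norm (vector_derivative \<gamma> (at v)))" by (simp add: sum_nonneg)
    ultimately show ?thesis by simp
  qed
  then show "\<exists>L. \<forall>u. norm (vector_derivative \<gamma> (at u)) \<le> L" by blast
  show "(\<lambda>u. vector_derivative \<gamma> (at u)) \<in> borel_measurable borel"
    using S by (intro borel_measurable_continuous_countable_exceptions[of S])
      (auto simp: C1_differentiable_on_eq Compl_eq_Diff_UNIV countable_finite)
qed

lemma ray_contour_continuous: "ray_contour \<alpha> \<beta> \<gamma> \<Longrightarrow> continuous_on UNIV \<gamma>"
  by (simp add: ray_contour_def piecewise_C1_differentiable_on_def)

lemma ray_contour_asymp:
  assumes "ray_contour \<alpha> \<beta> \<gamma>"
  shows "\<exists>C\<ge>0. \<forall>u. norm (\<gamma> u - of_real \<bar>u\<bar> * cis (if u < 0 then \<alpha> else \<beta>)) \<le> C"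
proof -
  obtain R c d where R: "\<And>u. u \<le> - R \<Longrightarrow> \<gamma> u = c + complex_of_real (- u) * cis \<alpha>"
      "\<And>u. R \<le> u \<Longrightarrow> \<gamma> u = d + complex_of_real u * cis \<beta>"
    using assms unfolding ray_contour_def by blast
  define S where "S = max 1 \<bar>R\<bar>"
  have "bounded (\<gamma> ` {- S..S})"
    by (intro compact_imp_bounded compact_continuous_image continuous_on_subset[OF ray_contour_continuous[OF assms]]) auto
  then obtain B where B: "\<And>u. u \<in> {- S..S} \<Longrightarrow> norm (\<gamma> u) \<le> B"
    unfolding bounded_iff by (metis imageI)
  have "norm (\<gamma> u - of_real \<bar>u\<bar> * cis (if u < 0 then \<alpha> else \<beta>)) \<le> norm c + norm d + (\<bar>B\<bar> + S)" for u
  proof -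
    have S: "1 \<le> S" "\<bar>R\<bar> \<le> S" by (auto simp: S_def)
    consider "u < - S" | "u \<in> {- S..S}" | "S < u" by fastforce
    then show ?thesis
    proof cases
      case 1
      then have "\<gamma> u = c + complex_of_real (- u) * cis \<alpha>" using S by (intro R(1)) auto
      then have "\<gamma> u - of_real \<bar>u\<bar> * cis (if u < 0 then \<alpha> else \<beta>) = c" using 1 S by simp
      then show ?thesis using S by (simp add: add_nonneg_nonneg)
    next
      case 2
      have "norm (\<gamma> u - of_real \<bar>u\<bar> * cis (if u < 0 then \<alpha> else \<beta>)) \<le> norm (\<gamma> u) + \<bar>u\<bar>"
        using norm_triangle_ineq4[of "\<gamma> u" "of_real \<bar>u\<bar> * cis (if u < 0 then \<alpha> else \<beta>)"] by (simp add: norm_mult)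
      also have "\<dots> \<le> \<bar>B\<bar> + S" using B[OF 2] 2 by auto
      finally show ?thesis by (simp add: add_increasing)
    next
      case 3
      then have "\<gamma> u = d + complex_of_real u * cis \<beta>" using S by (intro R(2)) auto
      then have "\<gamma> u - of_real \<bar>u\<bar> * cis (if u < 0 then \<alpha> else \<beta>) = d" using 3 S by simp
      then show ?thesis using S by (simp add: add_nonneg_nonneg)
    qed
  qed
  moreover have "0 \<le> norm c + norm d + (\<bar>B\<bar> + S)" by (simp add: S_def)
  ultimately show ?thesis by blast
qed

text \<open>Beyond \<open>(p + q) / \<kappa> + 1\<close> the cubic term outweighs the others; the
  summand 1 ensures r \<ge> 1 there, so that q r \<le> q r^2.\<close>

lemma cubic_bounded:
  fixes \<kappa> p q :: real
  assumes "0 < \<kappa>" "0 \<le> p" "0 \<le> q" "0 \<le> r"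
  shows "- \<kappa> * r ^ 3 + p * r\<^sup>2 + q * r \<le> p * ((p + q) / \<kappa> + 1)\<^sup>2 + q * ((p + q) / \<kappa> + 1)"
proof (cases "r \<le> (p + q) / \<kappa> + 1")
  case True
  have "p * r\<^sup>2 \<le> p * ((p + q) / \<kappa> + 1)\<^sup>2" "q * r \<le> q * ((p + q) / \<kappa> + 1)"
    using True assms by (intro mult_left_mono power_mono; simp)+
  moreover have "0 \<le> \<kappa> * r ^ 3" using assms by simp
  ultimately show ?thesis by simp
next
  case False
  moreover have "0 \<le> (p + q) / \<kappa>" using assms by simp
  ultimately have "1 \<le> r" "(p + q) / \<kappa> \<le> r" by linarith+
  then have r1: "1 \<le> r" "p + q \<le> \<kappa> * r"
    using assms(1) by (auto simp: field_simps)
  have "q * r \<le> q * r\<^sup>2" using r1(1) assms by (intro mult_left_mono) (auto simp: power2_eq_square)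
  moreover have "(p + q) * r\<^sup>2 \<le> (\<kappa> * r) * r\<^sup>2" using r1(2) by (intro mult_right_mono) auto
  ultimately have "- \<kappa> * r ^ 3 + p * r\<^sup>2 + q * r \<le> 0"
    by (simp add: power3_eq_cube power2_eq_square algebra_simps)
  also have "0 \<le> p * ((p + q) / \<kappa> + 1)\<^sup>2 + q * ((p + q) / \<kappa> + 1)" using assms by simp
  finally show ?thesis .
qed

text \<open>On a ray of angle \<open>\<theta>\<close> the real part of the cube is r^3 cos(3
  \<open>\<theta>\<close>). The curve stays within bounded distance of its rays, which changes the
  cube only by order r^2. The sign \<open>s\<close> covers both contours.\<close>

lemma ray_contour_cubic_decay:
  assumes "ray_contour \<alpha> (- \<alpha>) \<gamma>" and s: "s = 1 \<or> s = - 1" and cs: "s * cos (3 * \<alpha>) < 0"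
  shows "\<exists>B. \<forall>u. s * Re ((\<gamma> u) ^ 3 / 3) + A * (norm (\<gamma> u))\<^sup>2 + u\<^sup>2 \<le> B"
proof -
  obtain C where C: "0 \<le> C" "\<And>u. norm (\<gamma> u - of_real \<bar>u\<bar> * cis (if u < 0 then \<alpha> else - \<alpha>)) \<le> C"
    using ray_contour_asymp[OF assms(1)] by blast
  define \<kappa> where "\<kappa> = - (s * cos (3 * \<alpha>)) / 3"
  have \<kappa>: "0 < \<kappa>" using cs by (simp add: \<kappa>_def)
  \<comment> \<open>Quadratic terms: \<open>C\<close> from the error of the cube, 2 |A| from the
    squared norm, and 1 from u^2.\<close>
  define p where "p = C + 2 * \<bar>A\<bar> + 1"
  define q where "q = C\<^sup>2"
  have pq: "0 \<le> p" "0 \<le> q" using C by (auto simp: p_def q_def)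
  have "s * Re ((\<gamma> u) ^ 3 / 3) + A * (norm (\<gamma> u))\<^sup>2 + u\<^sup>2
      \<le> (p * ((p + q) / \<kappa> + 1)\<^sup>2 + q * ((p + q) / \<kappa> + 1)) + (C ^ 3 / 3 + 2 * \<bar>A\<bar> * C\<^sup>2)" for u
  proof -
    define \<theta> where "\<theta> = (if u < 0 then \<alpha> else - \<alpha>)"
    define r where "r = \<bar>u\<bar>"
    define \<eta> where "\<eta> = \<gamma> u - of_real r * cis \<theta>"
    have r: "0 \<le> r" by (simp add: r_def)
    have \<eta>: "norm \<eta> \<le> C" using C(2)[of u] by (simp add: \<eta>_def \<theta>_def r_def)
    have g: "\<gamma> u = of_real r * cis \<theta> + \<eta>" by (simp add: \<eta>_def)
    define e where "e = of_real (r\<^sup>2) * cis \<theta> ^ 2 * \<eta> + of_real r * cis \<theta> * \<eta>\<^sup>2 + \<eta> ^ 3 / 3"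
    have "(\<gamma> u) ^ 3 / 3 = of_real (r ^ 3 / 3) * cis (3 * \<theta>) + e"
    proof -
      have "cis (3 * \<theta>) = cis \<theta> ^ 3" using Complex.DeMoivre[of \<theta> 3] by simp
      then show ?thesis unfolding g e_def by (simp add: power3_eq_cube power2_eq_square field_simps)
    qed
    then have "Re ((\<gamma> u) ^ 3 / 3) = r ^ 3 / 3 * cos (3 * \<theta>) + Re e" by (simp only: plus_complex.simps Re_complex_of_real Im_complex_of_real times_complex.simps cis.simps)
    moreover have "cos (3 * \<theta>) = cos (3 * \<alpha>)" by (simp add: \<theta>_def)
    ultimately have "s * Re ((\<gamma> u) ^ 3 / 3) = - \<kappa> * r ^ 3 + s * Re e"
      by (simp add: \<kappa>_def distrib_left)
    also have "s * Re e \<le> norm e"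
      using s abs_Re_le_cmod[of e] by auto
    also have "norm e \<le> norm (of_real (r\<^sup>2) * cis \<theta> ^ 2 * \<eta>) + norm (of_real r * cis \<theta> * \<eta>\<^sup>2) + norm (\<eta> ^ 3 / 3)"
      unfolding e_def by (intro norm_triangle_le add_mono norm_triangle_ineq order_refl)
    also have "\<dots> = r\<^sup>2 * norm \<eta> + r * (norm \<eta>)\<^sup>2 + norm \<eta> ^ 3 / 3"
      using r by (simp add: norm_mult norm_power norm_divide)
    also have "\<dots> \<le> r\<^sup>2 * C + r * C\<^sup>2 + C ^ 3 / 3"
      using r \<eta> C(1) by (intro add_mono mult_left_mono divide_right_mono power_mono) auto
    finally have 1: "s * Re ((\<gamma> u) ^ 3 / 3) \<le> - \<kappa> * r ^ 3 + (r\<^sup>2 * C + r * C\<^sup>2 + C ^ 3 / 3)" by simp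
    have "norm (\<gamma> u) \<le> r + C"
      using norm_triangle_ineq[of "of_real r * cis \<theta>" \<eta>] \<eta> r unfolding g by (simp add: norm_mult)
    then have "(norm (\<gamma> u))\<^sup>2 \<le> (r + C)\<^sup>2" by (intro power_mono) auto
    also have "\<dots> \<le> 2 * r\<^sup>2 + 2 * C\<^sup>2"
      using sum_squares_bound[of r C] by (simp add: power2_sum)
    finally have "A * (norm (\<gamma> u))\<^sup>2 \<le> \<bar>A\<bar> * (2 * r\<^sup>2 + 2 * C\<^sup>2)"
      by (intro mult_mono) auto
    moreover have "u\<^sup>2 = r\<^sup>2" by (simp add: r_def)
    ultimately have "s * Re ((\<gamma> u) ^ 3 / 3) + A * (norm (\<gamma> u))\<^sup>2 + u\<^sup>2
        \<le> (- \<kappa> * r ^ 3 + p * r\<^sup>2 + q * r) + (C ^ 3 / 3 + 2 * \<bar>A\<bar> * C\<^sup>2)"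
      using 1 by (simp add: p_def q_def algebra_simps)
    then show ?thesis using cubic_bounded[OF \<kappa> pq r] by linarith
  qed
  then show ?thesis by blast
qed

text \<open>Compactness inside a ball and a direct estimate outside it replace compactness of the
  unbounded contours.\<close>

lemma norm_bounded_below:
  fixes \<psi> :: "'a::euclidean_space \<Rightarrow> complex"
  assumes S: "closed S" and c: "continuous_on S \<psi>" and nz: "\<And>p. p \<in> S \<Longrightarrow> \<psi> p \<noteq> 0"
    and far: "\<And>p. p \<in> S \<Longrightarrow> R \<le> norm p \<Longrightarrow> 1 \<le> norm (\<psi> p)"
  shows "\<exists>\<delta>>0. \<forall>p\<in>S. \<delta> \<le> norm (\<psi> p)"
proof (cases "S \<inter> cball 0 R = {}")
  case True
  then have "1 \<le> norm (\<psi> p)" if "p \<in> S" for p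
    using that by (intro far) fastforce+
  then show ?thesis by (intro exI[of _ 1]) auto
next
  case False
  have "compact (S \<inter> cball 0 R)" using S by (simp add: closed_Int_compact)
  moreover have "continuous_on (S \<inter> cball 0 R) (\<lambda>p. norm (\<psi> p))"
    by (intro continuous_on_norm continuous_on_subset[OF c]) auto
  ultimately obtain p0 where p0: "p0 \<in> S \<inter> cball 0 R" "\<And>p. p \<in> S \<inter> cball 0 R \<Longrightarrow> norm (\<psi> p0) \<le> norm (\<psi> p)"
    using continuous_attains_inf[OF _ False] by blast
  have "min 1 (norm (\<psi> p0)) \<le> norm (\<psi> p)" if "p \<in> S" for p
    using p0(2)[of p] far[OF that] that by (cases "norm p \<le> R") auto
  then show ?thesis
    using nz[of p0] p0(1) by (intro exI[of _ "min 1 (norm (\<psi> p0))"]) auto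
qed

text \<open>Moving the right contour to the right moves its negative to the left, so both orderings
  survive.\<close>

lemma airy21_contours_shift:
  assumes "airy21_contours \<phi>p \<phi>m \<gamma>p \<gamma>m" and c: "0 \<le> c"
  shows "airy21_contours \<phi>p \<phi>m (\<lambda>u. \<gamma>p u + complex_of_real c) \<gamma>m"
proof -
  have rc: "ray_contour \<phi>p (- \<phi>p) \<gamma>p" and l: "left_of \<gamma>m \<gamma>p" "left_of (\<lambda>u. - \<gamma>p u) \<gamma>m"
    using assms by (auto simp: airy21_contours_def)
  have "ray_contour \<phi>p (- \<phi>p) (\<lambda>u. \<gamma>p u + complex_of_real c)"
  proof -
    have "(\<lambda>u. \<gamma>p u + complex_of_real c) piecewise_C1_differentiable_on UNIV"
      using rc by (intro piecewise_C1_differentiable_add) (auto simp: ray_contour_def intro: C1_differentiable_imp_piecewise)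
    moreover have "\<exists>L. L-lipschitz_on UNIV (\<lambda>u. \<gamma>p u + complex_of_real c)"
      using rc by (auto simp: ray_contour_def lipschitz_on_def)
    moreover have "\<exists>R c' d. (\<forall>u\<le>- R. \<gamma>p u + of_real c = c' + complex_of_real (- u) * cis \<phi>p) \<and>
        (\<forall>u\<ge>R. \<gamma>p u + of_real c = d + complex_of_real u * cis (- \<phi>p))"
    proof -
      obtain R c' d where "\<forall>u\<le>- R. \<gamma>p u = c' + complex_of_real (- u) * cis \<phi>p"
          "\<forall>u\<ge>R. \<gamma>p u = d + complex_of_real u * cis (- \<phi>p)"
        using rc unfolding ray_contour_def by blast
      then show ?thesis
        by (intro exI[of _ R] exI[of _ "c' + of_real c"] exI[of _ "d + of_real c"]) auto
    qed
    ultimately show ?thesis unfolding ray_contour_def by blast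
  qed
  moreover have "left_of \<gamma>m (\<lambda>u. \<gamma>p u + complex_of_real c)" "left_of (\<lambda>u. - (\<gamma>p u + complex_of_real c)) \<gamma>m"
    using l c by (fastforce simp: left_of_def)+
  ultimately show ?thesis
    using assms(1) by (simp add: airy21_contours_def)
qed

text \<open>The condition \<open>\<phi>m < \<pi> - \<phi>p\<close> makes the ends of \<open>-\<gamma>p\<close> and \<open>\<gamma>m\<close> diverge.\<close>

lemma airy21_contours_separated:
  assumes cont: "airy21_contours \<phi>p \<phi>m \<gamma>p \<gamma>m"
  shows "\<exists>\<delta>>0. \<forall>\<sigma> \<tau>. \<delta> \<le> norm (\<gamma>m \<sigma> - \<gamma>p \<tau>) \<and> \<delta> \<le> norm (\<gamma>m \<sigma> + \<gamma>p \<tau>)"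
proof -
  have ang: "pi / 3 < \<phi>p" "\<phi>p < pi / 2" "pi / 2 < \<phi>m" "\<phi>m < pi - \<phi>p"
    and rp: "ray_contour \<phi>p (- \<phi>p) \<gamma>p" and rm: "ray_contour (- \<phi>m) \<phi>m \<gamma>m"
    and l: "left_of \<gamma>m \<gamma>p" "left_of (\<lambda>u. - \<gamma>p u) \<gamma>m"
    using cont by (auto simp: airy21_contours_def)
  have pos: "0 < cos \<phi>p" "0 < sin \<phi>p" "0 < sin \<phi>m" "cos \<phi>m < 0" "0 < sin (\<phi>p + \<phi>m)"
    using ang by (auto intro!: cos_gt_zero sin_gt_zero cos_lt_zero_pi)
  obtain Cp where Cp: "\<And>u. norm (\<gamma>p u - of_real \<bar>u\<bar> * cis (if u < 0 then \<phi>p else - \<phi>p)) \<le> Cp"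
    using ray_contour_asymp[OF rp] by blast
  obtain Cm where Cm: "\<And>u. norm (\<gamma>m u - of_real \<bar>u\<bar> * cis (if u < 0 then - \<phi>m else \<phi>m)) \<le> Cm"
    using ray_contour_asymp[OF rm] by blast
  have p: "\<bar>Re (\<gamma>p u) - \<bar>u\<bar> * cos \<phi>p\<bar> \<le> Cp" "\<bar>Im (\<gamma>p u) + u * sin \<phi>p\<bar> \<le> Cp" for u
    using order_trans[OF abs_Re_le_cmod Cp[of u]] order_trans[OF abs_Im_le_cmod Cp[of u]]
    by (auto split: if_splits)
  have m: "\<bar>Re (\<gamma>m u) - \<bar>u\<bar> * cos \<phi>m\<bar> \<le> Cm" "\<bar>Im (\<gamma>m u) - u * sin \<phi>m\<bar> \<le> Cm" for u
    using order_trans[OF abs_Re_le_cmod Cm[of u]] order_trans[OF abs_Im_le_cmod Cm[of u]]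
    by (auto split: if_splits)
  have cont_p: "continuous_on UNIV \<gamma>p" and cont_m: "continuous_on UNIV \<gamma>m"
    using ray_contour_continuous rp rm by auto
  have np: "norm q \<le> \<bar>fst q\<bar> + \<bar>snd q\<bar>" for q :: "real \<times> real"
    using norm_Pair_le[of "fst q" "snd q"] by simp
  have "\<exists>\<delta>>0. \<forall>q\<in>UNIV. \<delta> \<le> norm (\<gamma>m (fst q) - \<gamma>p (snd q))"
  proof (rule norm_bounded_below)
    show "continuous_on UNIV (\<lambda>q. \<gamma>m (fst q) - \<gamma>p (snd q))"
      by (intro continuous_intros continuous_on_compose2[OF cont_p] continuous_on_compose2[OF cont_m]) auto
    show "\<gamma>m (fst q) - \<gamma>p (snd q) \<noteq> 0" for q
      using l(1)[unfolded left_of_def, rule_format, of "fst q" "snd q"] by (auto simp: complex_eq_iff)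
    \<comment> \<open>The real parts drift apart along both contours because cos
      \<open>\<phi>m\<close> < 0 < cos \<open>\<phi>p\<close>; \<open>\<kappa>\<close> is the slower
      rate.\<close>
    define \<kappa> where "\<kappa> = min (cos \<phi>p) (- cos \<phi>m)"
    have \<kappa>: "0 < \<kappa>" using pos by (simp add: \<kappa>_def)
    show "1 \<le> norm (\<gamma>m (fst q) - \<gamma>p (snd q))" if "(1 + Cp + Cm) / \<kappa> \<le> norm q" for q :: "real \<times> real"
    proof -
      have "1 + Cp + Cm \<le> \<kappa> * norm q" using that \<kappa> by (simp add: field_simps)
      also have "\<dots> \<le> \<kappa> * (\<bar>fst q\<bar> + \<bar>snd q\<bar>)" using \<kappa> np by (intro mult_left_mono) auto
      also have "\<dots> \<le> \<bar>fst q\<bar> * (- cos \<phi>m) + \<bar>snd q\<bar> * cos \<phi>p"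
        unfolding distrib_left by (subst (1 2) mult.commute) (intro add_mono mult_left_mono, auto simp: \<kappa>_def)
      finally have "1 \<le> Re (\<gamma>p (snd q)) - Re (\<gamma>m (fst q))"
        using p(1)[of "snd q"] m(1)[of "fst q"] by (simp add: abs_le_iff)
      then show ?thesis using abs_Re_le_cmod[of "\<gamma>m (fst q) - \<gamma>p (snd q)"] by simp
    qed
  qed auto
  moreover have "\<exists>\<delta>>0. \<forall>q\<in>UNIV. \<delta> \<le> norm (\<gamma>m (fst q) + \<gamma>p (snd q))"
  proof (rule norm_bounded_below)
    show "continuous_on UNIV (\<lambda>q. \<gamma>m (fst q) + \<gamma>p (snd q))"
      by (intro continuous_intros continuous_on_compose2[OF cont_p] continuous_on_compose2[OF cont_m]) auto
    show "\<gamma>m (fst q) + \<gamma>p (snd q) \<noteq> 0" for q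
      using l(2)[unfolded left_of_def, rule_format, of "snd q" "fst q"] by (auto simp: complex_eq_iff)
    \<comment> \<open>Up to bounded errors the sum has real part \<open>X\<close> and imaginary part
      \<open>Y\<close> below. The map from (|\<open>\<sigma>\<close>|, |\<open>\<tau>\<close>|) to
      (\<open>X\<close>, \<open>Y'\<close>) is linear with determinant \<open>\<kappa>\<close> up to
      sign, positive because \<phi>p + \<phi>m < pi; inverting it bounds the parameters.\<close>
    define \<kappa> where "\<kappa> = sin (\<phi>p + \<phi>m)"
    show "1 \<le> norm (\<gamma>m (fst q) + \<gamma>p (snd q))" if "4 * (1 + Cp + Cm) / \<kappa> \<le> norm q" for q :: "real \<times> real"
    proof -
      define \<sigma> \<tau> where "\<sigma> = fst q" and "\<tau> = snd q"
      define X where "X = \<bar>\<tau>\<bar> * cos \<phi>p + \<bar>\<sigma>\<bar> * cos \<phi>m"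
      define Y where "Y = \<sigma> * sin \<phi>m - \<tau> * sin \<phi>p"
      \<comment> \<open>By the reverse triangle inequality \<open>Y'\<close> bounds
        |\<open>Y\<close>| from below for all signs of the parameters, so one linear system covers
        all quadrants.\<close>
      define Y' where "Y' = \<bar>\<sigma>\<bar> * sin \<phi>m - \<bar>\<tau>\<bar> * sin \<phi>p"
      have YY: "\<bar>Y'\<bar> \<le> \<bar>Y\<bar>"
        using pos abs_triangle_ineq3[of "\<sigma> * sin \<phi>m" "\<tau> * sin \<phi>p"] by (simp add: Y_def Y'_def abs_mult)
      have "\<kappa> * \<bar>\<tau>\<bar> = sin \<phi>m * X - cos \<phi>m * Y'" "\<kappa> * \<bar>\<sigma>\<bar> = sin \<phi>p * X + cos \<phi>p * Y'"
        by (simp_all add: \<kappa>_def X_def Y'_def sin_add algebra_simps)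
      moreover have "sin \<phi>m * X - cos \<phi>m * Y' \<le> \<bar>X\<bar> + \<bar>Y'\<bar>" "sin \<phi>p * X + cos \<phi>p * Y' \<le> \<bar>X\<bar> + \<bar>Y'\<bar>"
      proof -
        have le: "c * z \<le> \<bar>z\<bar>" if "\<bar>c\<bar> \<le> 1" for c z :: real
          using mult_left_le_one_le[of "\<bar>z\<bar>" "\<bar>c\<bar>"] that abs_ge_self[of "c * z"] by (simp add: abs_mult)
        show "sin \<phi>m * X - cos \<phi>m * Y' \<le> \<bar>X\<bar> + \<bar>Y'\<bar>"
          using le[of "sin \<phi>m" X] le[of "- cos \<phi>m" Y'] by simp
        show "sin \<phi>p * X + cos \<phi>p * Y' \<le> \<bar>X\<bar> + \<bar>Y'\<bar>"
          using le[of "sin \<phi>p" X] le[of "cos \<phi>p" Y'] by simp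
      qed
      ultimately have "\<kappa> * (\<bar>\<sigma>\<bar> + \<bar>\<tau>\<bar>) \<le> 2 * (\<bar>X\<bar> + \<bar>Y\<bar>)"
        using YY by (simp add: distrib_left)
      moreover have "4 * (1 + Cp + Cm) \<le> \<kappa> * (\<bar>\<sigma>\<bar> + \<bar>\<tau>\<bar>)"
      proof -
        have "4 * (1 + Cp + Cm) \<le> \<kappa> * norm q" using that pos by (simp add: \<kappa>_def field_simps)
        also have "\<dots> \<le> \<kappa> * (\<bar>\<sigma>\<bar> + \<bar>\<tau>\<bar>)" using pos np[of q] by (intro mult_left_mono) (auto simp: \<kappa>_def \<sigma>_def \<tau>_def)
        finally show ?thesis .
      qed
      moreover have "\<bar>X\<bar> \<le> \<bar>Re (\<gamma>m \<sigma> + \<gamma>p \<tau>)\<bar> + (Cp + Cm)"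
        using p(1)[of \<tau>] m(1)[of \<sigma>] unfolding X_def plus_complex.simps by linarith
      moreover have "\<bar>Y\<bar> \<le> \<bar>Im (\<gamma>m \<sigma> + \<gamma>p \<tau>)\<bar> + (Cp + Cm)"
        using p(2)[of \<tau>] m(2)[of \<sigma>] unfolding Y_def plus_complex.simps by linarith
      moreover have "\<bar>Re (\<gamma>m \<sigma> + \<gamma>p \<tau>)\<bar> \<le> norm (\<gamma>m \<sigma> + \<gamma>p \<tau>)" "\<bar>Im (\<gamma>m \<sigma> + \<gamma>p \<tau>)\<bar> \<le> norm (\<gamma>m \<sigma> + \<gamma>p \<tau>)"
        by (rule abs_Re_le_cmod abs_Im_le_cmod)+
      ultimately have "4 * (1 + Cp + Cm) \<le> 4 * norm (\<gamma>m \<sigma> + \<gamma>p \<tau>) + 4 * (Cp + Cm)" by argo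
      then show ?thesis by (simp add: \<sigma>_def \<tau>_def)
    qed
  qed auto
  ultimately obtain d1 d2 where d: "0 < d1" "0 < d2" and
      "\<forall>q\<in>UNIV. d1 \<le> norm (\<gamma>m (fst q) - \<gamma>p (snd q))" "\<forall>q\<in>UNIV. d2 \<le> norm (\<gamma>m (fst q) + \<gamma>p (snd q))"
    by blast
  then have "d1 \<le> norm (\<gamma>m \<sigma> - \<gamma>p \<tau>)" "d2 \<le> norm (\<gamma>m \<sigma> + \<gamma>p \<tau>)" for \<sigma> \<tau>
    by (metis UNIV_I fst_conv snd_conv)+
  with d show ?thesis
    by (intro exI[of _ "min d1 d2"]) (auto intro: min.coboundedI1 min.coboundedI2)
qed

section \<open>Shifting a contour\<close>

lemma integral_derivative_eq_0:
  fixes g g' :: "real \<Rightarrow> complex"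
  assumes S: "finite S" and d: "\<And>u. u \<notin> S \<Longrightarrow> (g has_vector_derivative g' u) (at u)"
    and c: "continuous_on UNIV g" and int: "integrable lborel g'"
    and lim: "(g \<longlongrightarrow> 0) at_top" "(g \<longlongrightarrow> 0) at_bot"
  shows "(\<integral>u. g' u \<partial>lborel) = 0"
proof -
  have "(\<integral>u. indicator {- real n..real n} u *\<^sub>R g' u \<partial>lborel) = g (real n) - g (- real n)" for n
  proof -
    have "set_integrable lborel {- real n..real n} g'"
      unfolding set_integrable_def by (rule integrable_mult_indicator[OF _ int]) simp
    then have "(\<integral>u. indicator {- real n..real n} u *\<^sub>R g' u \<partial>lborel) = integral {- real n..real n} g'"
      using set_borel_integral_eq_integral(2) unfolding set_lebesgue_integral_def by blast
    also have "(g' has_integral (g (real n) - g (- real n))) {- real n..real n}"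
      by (rule fundamental_theorem_of_calculus_interior_strong[OF S]) (auto intro: d continuous_on_subset[OF c])
    then have "integral {- real n..real n} g' = g (real n) - g (- real n)"
      by (rule integral_unique)
    finally show ?thesis .
  qed
  moreover have "(\<lambda>n. g (real n) - g (- real n)) \<longlonglongrightarrow> 0 - 0"
    by (intro tendsto_diff filterlim_compose[OF lim(1)] filterlim_compose[OF lim(2)]
        filterlim_real_sequentially filterlim_compose[OF filterlim_uminus_at_bot_at_top])
  moreover have "(\<lambda>n. \<integral>u. indicator {- real n..real n} u *\<^sub>R g' u \<partial>lborel) \<longlonglongrightarrow> (\<integral>u. g' u \<partial>lborel)"
  proof (rule integral_dominated_convergence[where w = "\<lambda>u. norm (g' u)"])
    show "AE u in lborel. (\<lambda>n. indicator {- real n..real n} u *\<^sub>R g' u) \<longlonglongrightarrow> g' u"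
    proof (rule AE_I2)
      fix u :: real
      have "\<forall>\<^sub>F n in sequentially. indicator {- real n..real n} u *\<^sub>R g' u = g' u"
        using eventually_ge_at_top[of "nat \<lceil>\<bar>u\<bar>\<rceil>"]
      proof eventually_elim
        case (elim n)
        then have "\<bar>u\<bar> \<le> real n" by linarith
        then show ?case by (simp add: abs_le_iff)
      qed
      then show "(\<lambda>n. indicator {- real n..real n} u *\<^sub>R g' u) \<longlonglongrightarrow> g' u"
        by (rule tendsto_eventually)
    qed
    show "AE u in lborel. norm (indicator {- real n..real n} u *\<^sub>R g' u) \<le> norm (g' u)" for n
      by (auto simp: indicator_def)
  qed (use int in auto)
  ultimately show ?thesis
    using LIMSEQ_unique by fastforce
qed

lemma exp_neg_sq_tendsto: "((\<lambda>u::real. exp (- u\<^sup>2)) \<longlongrightarrow> 0) at_top" "((\<lambda>u::real. exp (- u\<^sup>2)) \<longlongrightarrow> 0) at_bot"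
proof -
  have "filterlim (\<lambda>u::real. u\<^sup>2) at_top at_top"
    by (rule filterlim_pow_at_top) (auto simp: filterlim_ident)
  moreover have "filterlim (\<lambda>u::real. u\<^sup>2) at_top at_bot"
    by (rule filterlim_pow_at_bot_even) (auto simp: filterlim_ident)
  ultimately show "((\<lambda>u::real. exp (- u\<^sup>2)) \<longlongrightarrow> 0) at_top" "((\<lambda>u::real. exp (- u\<^sup>2)) \<longlongrightarrow> 0) at_bot"
    by (auto intro!: filterlim_compose[OF exp_at_bot] simp: filterlim_uminus_at_top)
qed

text \<open>Both integrals differ by \<open>\<integral>\<^sub>0\<^sup>c \<integral> f' (\<gamma> + s) d\<gamma> ds\<close>, whose inner integrals vanish, so no
  form of Cauchy's theorem for unbounded regions is needed.\<close>

lemma contour_shift: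
  fixes f f' :: "complex \<Rightarrow> complex"
  assumes ray: "ray_contour \<alpha> \<beta> \<gamma>" and c: "0 \<le> c"
    and f: "\<And>\<tau> s. 0 \<le> s \<Longrightarrow> s \<le> c \<Longrightarrow> (f has_field_derivative f' (\<gamma> \<tau> + of_real s)) (at (\<gamma> \<tau> + of_real s))"
    and f'_meas: "f' \<in> borel_measurable borel"
    and f'_cont: "\<And>\<tau>. continuous_on {0..c} (\<lambda>s. f' (\<gamma> \<tau> + of_real s))"
    and B: "\<And>\<tau> s. 0 \<le> s \<Longrightarrow> s \<le> c \<Longrightarrow> norm (f (\<gamma> \<tau> + of_real s)) \<le> B * exp (- \<tau>\<^sup>2)"
      "\<And>\<tau> s. 0 \<le> s \<Longrightarrow> s \<le> c \<Longrightarrow> norm (f' (\<gamma> \<tau> + of_real s)) \<le> B * exp (- \<tau>\<^sup>2)"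
  shows "(\<integral>\<tau>. f (\<gamma> \<tau> + of_real c) * vector_derivative \<gamma> (at \<tau>) \<partial>lborel) = (\<integral>\<tau>. f (\<gamma> \<tau>) * vector_derivative \<gamma> (at \<tau>) \<partial>lborel)"
proof -
  define d where "d \<tau> = vector_derivative \<gamma> (at \<tau>)" for \<tau>
  have d_meas [measurable]: "d \<in> borel_measurable borel"
    using ray_contour_speed(2)[OF ray] by (simp add: d_def[abs_def])
  obtain L where L: "\<And>\<tau>. norm (d \<tau>) \<le> L" using ray_contour_speed(1)[OF ray] by (auto simp: d_def)
  have L0: "0 \<le> L" using L[of 0] norm_ge_zero order_trans by blast
  note \<gamma>_cont = ray_contour_continuous[OF ray]
  have \<gamma>_meas [measurable]: "\<gamma> \<in> borel_measurable borel"
    by (rule borel_measurable_continuous_onI[OF \<gamma>_cont])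
  note [measurable] = f'_meas
  obtain S where S: "finite S" "\<gamma> C1_differentiable_on (UNIV - S)"
    using ray by (auto simp: ray_contour_def piecewise_C1_differentiable_on_def)
  have \<gamma>_deriv: "(\<gamma> has_vector_derivative d \<tau>) (at \<tau>)" if "\<tau> \<notin> S" for \<tau>
    using S(2) that by (simp add: C1_differentiable_on_eq d_def vector_derivative_works)
  have fg_cont: "continuous_on UNIV (\<lambda>\<tau>. f (\<gamma> \<tau> + of_real s))" if s: "0 \<le> s" "s \<le> c" for s
  proof (rule continuous_at_imp_continuous_on, rule ballI)
    fix \<tau>
    have "isCont \<gamma> \<tau>" using \<gamma>_cont by (simp add: continuous_on_eq_continuous_at)
    then have "isCont (\<lambda>\<tau>. \<gamma> \<tau> + of_real s) \<tau>" by (intro continuous_intros)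
    moreover have "isCont f (\<gamma> \<tau> + of_real s)" using f[OF s] by (rule DERIV_isCont)
    ultimately show "isCont (\<lambda>\<tau>. f (\<gamma> \<tau> + of_real s)) \<tau>"
      by (rule isCont_o2)
  qed
  have gauss: "integrable lborel (\<lambda>\<tau>::real. (B * L) * exp (- \<tau>\<^sup>2))"
    using integrable_gaussian[of 1 0] by simp
  have bd: "norm (z * d \<tau>) \<le> (B * L) * exp (- \<tau>\<^sup>2)" if "norm z \<le> B * exp (- \<tau>\<^sup>2)" for z \<tau>
    using mult_mono[OF that L] that L0 by (simp add: norm_mult ac_simps order_trans[OF norm_ge_zero])
  have int_bd: "integrable lborel (\<lambda>\<tau>. h \<tau> * d \<tau>)"
    if "h \<in> borel_measurable borel" "\<And>\<tau>. norm (h \<tau>) \<le> B * exp (- \<tau>\<^sup>2)" for h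
  proof (rule Bochner_Integration.integrable_bound[OF gauss])
    show "(\<lambda>\<tau>. h \<tau> * d \<tau>) \<in> borel_measurable lborel" using that(1) by measurable
    show "AE \<tau> in lborel. norm (h \<tau> * d \<tau>) \<le> norm ((B * L) * exp (- \<tau>\<^sup>2))"
      by (rule AE_I2, rule order_trans[OF bd[OF that(2)]]) simp
  qed
  have int_f: "integrable lborel (\<lambda>\<tau>. f (\<gamma> \<tau> + of_real s) * d \<tau>)" if s: "0 \<le> s" "s \<le> c" for s
    by (rule int_bd[OF borel_measurable_continuous_onI[OF fg_cont[OF s]] B(1)[OF s]])
  have int_f': "integrable lborel (\<lambda>\<tau>. f' (\<gamma> \<tau> + of_real s) * d \<tau>)" if s: "0 \<le> s" "s \<le> c" for s
    by (rule int_bd[OF _ B(2)[OF s]]) measurable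
  \<comment> \<open>The integrand is the derivative along the curve of f (\<gamma> + s), which tends
    to zero at both ends.\<close>
  have zero: "(\<integral>\<tau>. f' (\<gamma> \<tau> + of_real s) * d \<tau> \<partial>lborel) = 0" if s: "0 \<le> s" "s \<le> c" for s
  proof (rule integral_derivative_eq_0[OF S(1) _ fg_cont[OF s] int_f'[OF s]])
    show "((\<lambda>\<tau>. f (\<gamma> \<tau> + of_real s)) has_vector_derivative f' (\<gamma> u + of_real s) * d u) (at u)" if "u \<notin> S" for u
    proof -
      have "((\<lambda>\<tau>. \<gamma> \<tau> + of_real s) has_vector_derivative d u) (at u)"
        using has_vector_derivative_add[OF \<gamma>_deriv[OF that] has_vector_derivative_const] by simp
      then have "(f \<circ> (\<lambda>\<tau>. \<gamma> \<tau> + of_real s) has_vector_derivative d u * f' (\<gamma> u + of_real s)) (at u)"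
        by (rule field_vector_diff_chain_at) (rule f[OF s])
      then show ?thesis by (simp add: o_def mult.commute)
    qed
    have le: "\<forall>\<^sub>F u in F. norm (f (\<gamma> u + of_real s)) \<le> B * exp (- u\<^sup>2)" for F
      using B(1)[OF s] by (simp add: always_eventually)
    show "((\<lambda>\<tau>. f (\<gamma> \<tau> + of_real s)) \<longlongrightarrow> 0) at_top"
      by (rule Lim_null_comparison[OF le tendsto_mult_right_zero[OF exp_neg_sq_tendsto(1)]])
    show "((\<lambda>\<tau>. f (\<gamma> \<tau> + of_real s)) \<longlongrightarrow> 0) at_bot"
      by (rule Lim_null_comparison[OF le tendsto_mult_right_zero[OF exp_neg_sq_tendsto(2)]])
  qed
  define G where "G s \<tau> = indicator {0..c} s *\<^sub>R (f' (\<gamma> \<tau> + of_real s) * d \<tau>)" for s \<tau>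
  have Gint: "integrable (lborel \<Otimes>\<^sub>M lborel) (\<lambda>(s, \<tau>). G s \<tau>)"
  proof (rule Bochner_Integration.integrable_bound)
    have "integrable lborel (indicator {0..c} :: real \<Rightarrow> real)"
      using c by (intro integrable_real_indicator) auto
    then show "integrable (lborel \<Otimes>\<^sub>M lborel) (\<lambda>p. indicator {0..c} (fst p) * ((B * L) * exp (- (snd p)\<^sup>2)) :: real)"
      using integrable_product[OF _ _ _ gauss, of lborel] by (simp add: lborel.sigma_finite_measure_axioms)
    show "(\<lambda>(s, \<tau>). G s \<tau>) \<in> borel_measurable (lborel \<Otimes>\<^sub>M lborel)"
      unfolding G_def by measurable
    show "AE p in lborel \<Otimes>\<^sub>M lborel. norm (case p of (s, \<tau>) \<Rightarrow> G s \<tau>) \<le> norm (indicator {0..c} (fst p) * ((B * L) * exp (- (snd p)\<^sup>2)) :: real)"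
    proof (rule AE_I2)
      fix p :: "real \<times> real"
      show "norm (case p of (s, \<tau>) \<Rightarrow> G s \<tau>) \<le> norm (indicator {0..c} (fst p) * ((B * L) * exp (- (snd p)\<^sup>2)) :: real)"
        using bd[OF B(2), of "fst p" "snd p"]
        by (cases p) (auto simp: G_def indicator_def intro: order_trans)
    qed
  qed
  have "(\<integral>\<tau>. f (\<gamma> \<tau> + of_real c) * d \<tau> \<partial>lborel) - (\<integral>\<tau>. f (\<gamma> \<tau>) * d \<tau> \<partial>lborel)
      = (\<integral>\<tau>. f (\<gamma> \<tau> + of_real c) * d \<tau> - f (\<gamma> \<tau>) * d \<tau> \<partial>lborel)"
    using int_f[of c] int_f[of 0] c by simp
  also have "\<dots> = (\<integral>\<tau>. \<integral>s. G s \<tau> \<partial>lborel \<partial>lborel)"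
  proof (intro Bochner_Integration.integral_cong refl)
    fix \<tau>
    have "(\<integral>s. indicator {0..c} s *\<^sub>R f' (\<gamma> \<tau> + of_real s) \<partial>lborel) = f (\<gamma> \<tau> + of_real c) - f (\<gamma> \<tau> + of_real 0)"
    proof (rule integral_FTC_atLeastAtMost[OF c _ f'_cont])
      fix s assume s: "0 \<le> s" "s \<le> c"
      have "((\<lambda>s. \<gamma> \<tau> + complex_of_real s) has_vector_derivative 0 + of_real 1) (at s)"
        by (intro has_vector_derivative_add has_vector_derivative_const
            bounded_linear.has_vector_derivative[OF bounded_linear_of_real has_vector_derivative_id])
      then have "(f \<circ> (\<lambda>s. \<gamma> \<tau> + complex_of_real s) has_vector_derivative (0 + of_real 1) * f' (\<gamma> \<tau> + of_real s)) (at s)"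
        by (rule field_vector_diff_chain_at) (rule f[OF s])
      then have "((\<lambda>s. f (\<gamma> \<tau> + of_real s)) has_vector_derivative f' (\<gamma> \<tau> + of_real s)) (at s)"
        by (simp add: o_def)
      then show "((\<lambda>s. f (\<gamma> \<tau> + of_real s)) has_vector_derivative f' (\<gamma> \<tau> + of_real s)) (at s within {0..c})"
        by (rule has_vector_derivative_at_within)
    qed
    then have "f (\<gamma> \<tau> + of_real c) * d \<tau> - f (\<gamma> \<tau>) * d \<tau> = (\<integral>s. indicator {0..c} s *\<^sub>R f' (\<gamma> \<tau> + of_real s) \<partial>lborel) * d \<tau>"
      by (simp add: left_diff_distrib)
    also have "\<dots> = (\<integral>s. G s \<tau> \<partial>lborel)"
      unfolding G_def by (subst integral_mult_left_zero[symmetric]) simp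
    finally show "f (\<gamma> \<tau> + of_real c) * d \<tau> - f (\<gamma> \<tau>) * d \<tau> = (\<integral>s. G s \<tau> \<partial>lborel)" .
  qed
  also have "\<dots> = (\<integral>s. \<integral>\<tau>. G s \<tau> \<partial>lborel \<partial>lborel)"
    by (rule lborel_pair.Fubini_integral[OF Gint])
  also have "\<dots> = 0"
  proof -
    have "(\<integral>\<tau>. G s \<tau> \<partial>lborel) = 0" for s
      using zero[of s] by (simp add: G_def indicator_def)
    then show ?thesis by simp
  qed
  finally show ?thesis by (simp add: d_def)
qed

text \<open>The strip swept by the translation avoids both poles z and -z. Compactness in
  \<open>s\<close> and growth along the contour make the distance uniform, and the cubic decay
  dominates the integrand together with its derivative.\<close>

lemma contour_shift_kernel:
  fixes z :: complex and t y c :: real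
  assumes ray: "ray_contour \<phi>p (- \<phi>p) \<gamma>p" and ang: "cos (3 * \<phi>p) < 0" and c: "0 \<le> c"
    and nz: "\<And>\<tau> s. 0 \<le> s \<Longrightarrow> s \<le> c \<Longrightarrow> z - (\<gamma>p \<tau> + of_real s) \<noteq> 0 \<and> z + (\<gamma>p \<tau> + of_real s) \<noteq> 0"
  defines "f \<equiv> \<lambda>w. exp (w ^ 3 / 3 + of_real t * w\<^sup>2 - of_real y * w) * (1 / (z - w) - 1 / (z + w))"
  shows "(\<integral>\<tau>. f (\<gamma>p \<tau> + of_real c) * vector_derivative \<gamma>p (at \<tau>) \<partial>lborel)
    = (\<integral>\<tau>. f (\<gamma>p \<tau>) * vector_derivative \<gamma>p (at \<tau>) \<partial>lborel)"
proof -
  define e where "e w = exp (w ^ 3 / 3 + of_real t * w\<^sup>2 - of_real y * w)" for w :: complex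
  define h where "h w = 1 / (z - w) - 1 / (z + w)" for w
  define h' where "h' w = 1 / (z - w)\<^sup>2 + 1 / (z + w)\<^sup>2" for w
  define f' where "f' w = e w * ((w\<^sup>2 + 2 * of_real t * w - of_real y) * h w + h' w)" for w
  have f_eq: "f w = e w * h w" for w by (simp add: f_def e_def h_def)
  note \<gamma>_cont = ray_contour_continuous[OF ray]
  obtain C where C: "\<And>u. norm (\<gamma>p u - of_real \<bar>u\<bar> * cis (if u < 0 then \<phi>p else - \<phi>p)) \<le> C"
    using ray_contour_asymp[OF ray] by blast
  have big: "\<bar>u\<bar> - C \<le> norm (\<gamma>p u)" for u
    using C[of u] norm_triangle_ineq2[of "of_real \<bar>u\<bar> * cis (if u < 0 then \<phi>p else - \<phi>p)" "\<gamma>p u"]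
    by (simp add: norm_mult norm_minus_commute)
  define S where "S = (UNIV :: real set) \<times> {0..c}"
  have S: "closed S" unfolding S_def by (intro closed_Times) auto
  have far: "1 \<le> norm (\<gamma>p (fst q)) - norm z - c" if "q \<in> S" "1 + C + norm z + 2 * c \<le> norm q" for q
  proof -
    have "norm q \<le> \<bar>fst q\<bar> + \<bar>snd q\<bar>" using norm_Pair_le[of "fst q" "snd q"] by simp
    then show ?thesis using that big[of "fst q"] by (auto simp: S_def)
  qed
  have cont: "continuous_on S (\<lambda>q. \<gamma>p (fst q) + complex_of_real (snd q))"
    by (intro continuous_intros continuous_on_compose2[OF \<gamma>_cont]) auto
  have tri: "norm (\<gamma>p (fst q)) - norm z - c \<le> norm (z - (\<gamma>p (fst q) + of_real (snd q)))"
     "norm (\<gamma>p (fst q)) - norm z - c \<le> norm (z + (\<gamma>p (fst q) + of_real (snd q)))" if "q \<in> S" for q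
  proof -
    let ?v = "\<gamma>p (fst q) + complex_of_real (snd q)"
    have "norm (\<gamma>p (fst q)) - c \<le> norm ?v"
      using norm_diff_ineq[of "\<gamma>p (fst q)" "complex_of_real (snd q)"] that by (auto simp: S_def)
    moreover have "norm ?v - norm z \<le> norm (z - ?v)" "norm ?v - norm z \<le> norm (z + ?v)"
      using norm_triangle_ineq2[of ?v z] norm_diff_ineq[of ?v z] by (simp_all add: norm_minus_commute add.commute)
    ultimately show "norm (\<gamma>p (fst q)) - norm z - c \<le> norm (z - ?v)" "norm (\<gamma>p (fst q)) - norm z - c \<le> norm (z + ?v)"
      by simp_all
  qed
  have nzS: "z - (\<gamma>p (fst q) + of_real (snd q)) \<noteq> 0" "z + (\<gamma>p (fst q) + of_real (snd q)) \<noteq> 0" if "q \<in> S" for q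
    using nz[of "snd q" "fst q"] that by (auto simp: S_def)
  have "\<exists>\<delta>>0. \<forall>q\<in>S. \<delta> \<le> norm (z - (\<gamma>p (fst q) + of_real (snd q)))"
    by (rule norm_bounded_below[OF S _ nzS(1) order_trans[OF far tri(1)]]) (auto intro!: continuous_intros cont)
  moreover have "\<exists>\<delta>>0. \<forall>q\<in>S. \<delta> \<le> norm (z + (\<gamma>p (fst q) + of_real (snd q)))"
    by (rule norm_bounded_below[OF S _ nzS(2) order_trans[OF far tri(2)]]) (auto intro!: continuous_intros cont)
  ultimately obtain d1 d2 where "0 < d1" "0 < d2" and d12: "\<forall>q\<in>S. d1 \<le> norm (z - (\<gamma>p (fst q) + of_real (snd q)))"
      "\<forall>q\<in>S. d2 \<le> norm (z + (\<gamma>p (fst q) + of_real (snd q)))"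
    by blast
  define \<delta> where "\<delta> = min d1 d2"
  have \<delta>: "0 < \<delta>" using \<open>0 < d1\<close> \<open>0 < d2\<close> by (simp add: \<delta>_def)
  have zw: "\<delta> \<le> norm (z - (\<gamma>p \<tau> + of_real s))" "\<delta> \<le> norm (z + (\<gamma>p \<tau> + of_real s))" if "0 \<le> s" "s \<le> c" for \<tau> s
    using d12[THEN bspec, of "(\<tau>, s)"] that by (auto simp: S_def \<delta>_def)
  have hb: "norm (h (\<gamma>p \<tau> + of_real s)) \<le> 2 / \<delta>" "norm (h' (\<gamma>p \<tau> + of_real s)) \<le> 2 / \<delta>\<^sup>2" if s: "0 \<le> s" "s \<le> c" for \<tau> s
  proof -
    let ?v = "\<gamma>p \<tau> + complex_of_real s"
    have 1: "norm (1 / (z - ?v)) \<le> 1 / \<delta>" "norm (1 / (z + ?v)) \<le> 1 / \<delta>"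
      using zw[OF s] \<delta> by (simp_all add: norm_divide frac_le)
    have "norm (h ?v) \<le> norm (1 / (z - ?v)) + norm (1 / (z + ?v))"
      unfolding h_def by (rule norm_triangle_ineq4)
    then show "norm (h ?v) \<le> 2 / \<delta>" using 1 by simp
    have 2: "norm (1 / (z - ?v)\<^sup>2) \<le> 1 / \<delta>\<^sup>2" "norm (1 / (z + ?v)\<^sup>2) \<le> 1 / \<delta>\<^sup>2"
      using zw[OF s] \<delta> by (auto simp: norm_divide norm_power intro!: frac_le power_mono)
    have "norm (h' ?v) \<le> norm (1 / (z - ?v)\<^sup>2) + norm (1 / (z + ?v)\<^sup>2)"
      unfolding h'_def by (rule norm_triangle_ineq)
    then show "norm (h' ?v) \<le> 2 / \<delta>\<^sup>2" using 2 by simp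
  qed
  define A1 where "A1 = c + c\<^sup>2 + 2 * \<bar>t\<bar> + \<bar>y\<bar>"
  define A0 where "A0 = c\<^sup>2 + c ^ 3 / 3 + 2 * \<bar>t\<bar> * c\<^sup>2 + \<bar>y\<bar> * (1 + c)"
  define P where "P = 2 + 2 * c\<^sup>2 + 2 * \<bar>t\<bar> * (1 + c) + \<bar>y\<bar>"
  have P: "0 \<le> P" using c by (simp add: P_def)
  \<comment> \<open>\<open>A1\<close> pays for the quadratic terms caused by the translation and by
    the lower order exponents. The extra 1 leaves a factor exp(-N^2), N the norm of the point on the
    contour, which absorbs the polynomial factor of the derivative.\<close>
  obtain D where D: "\<And>u. Re ((\<gamma>p u) ^ 3 / 3) + (A1 + 1) * (norm (\<gamma>p u))\<^sup>2 + u\<^sup>2 \<le> D"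
    using ray_contour_cubic_decay[OF ray, of 1 "A1 + 1"] ang by auto
  define K where "K = 1 + P * (2 / \<delta>) + 2 / \<delta> + 2 / \<delta>\<^sup>2"
  have K: "norm (h (\<gamma>p \<tau> + of_real s)) \<le> K" if s: "0 \<le> s" "s \<le> c" for \<tau> s
  proof -
    have "0 \<le> P * (2 / \<delta>)" "0 \<le> 2 / \<delta>\<^sup>2" using P \<delta> by simp_all
    then show ?thesis using hb(1)[OF s, of \<tau>] unfolding K_def by linarith
  qed
  have wb: "norm (e (\<gamma>p \<tau> + of_real s)) \<le> exp (D + A0) * exp (- \<tau>\<^sup>2) * exp (- (norm (\<gamma>p \<tau>))\<^sup>2)"
    and pb: "norm ((\<gamma>p \<tau> + of_real s)\<^sup>2 + 2 * of_real t * (\<gamma>p \<tau> + of_real s) - of_real y) \<le> P * exp ((norm (\<gamma>p \<tau>))\<^sup>2)"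
    if s: "0 \<le> s" "s \<le> c" for \<tau> s
  proof -
    define v where "v = \<gamma>p \<tau> + complex_of_real s"
    define N where "N = norm (\<gamma>p \<tau>)"
    have N: "0 \<le> N" "N \<le> 1 + N\<^sup>2"
    proof -
      show N0: "0 \<le> N" by (simp add: N_def)
      have "2 * N \<le> 1 + N\<^sup>2" using zero_le_power2[of "N - 1"] by (simp add: power2_eq_square algebra_simps)
      then show "N \<le> 1 + N\<^sup>2" using N0 by linarith
    qed
    have vN: "norm v \<le> N + c"
      using norm_triangle_ineq[of "\<gamma>p \<tau>" "of_real s"] s unfolding v_def N_def by simp
    have vN2: "(norm v)\<^sup>2 \<le> 2 * N\<^sup>2 + 2 * c\<^sup>2"
    proof -
      have "(norm v)\<^sup>2 \<le> (N + c)\<^sup>2" using vN by (intro power_mono) auto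
      also have "\<dots> \<le> 2 * N\<^sup>2 + 2 * c\<^sup>2" using sum_squares_bound[of N c] by (simp add: power2_sum)
      finally show ?thesis .
    qed
    have "v ^ 3 / 3 = (\<gamma>p \<tau>) ^ 3 / 3 + (of_real s * (\<gamma>p \<tau>)\<^sup>2 + of_real (s\<^sup>2) * \<gamma>p \<tau> + of_real (s ^ 3 / 3))"
      unfolding v_def by (simp add: power3_eq_cube power2_eq_square field_simps)
    then have "Re (v ^ 3 / 3) = Re ((\<gamma>p \<tau>) ^ 3 / 3) + Re (of_real s * (\<gamma>p \<tau>)\<^sup>2 + of_real (s\<^sup>2) * \<gamma>p \<tau> + of_real (s ^ 3 / 3))"
      by (simp only: plus_complex.simps)
    also have "Re (of_real s * (\<gamma>p \<tau>)\<^sup>2 + of_real (s\<^sup>2) * \<gamma>p \<tau> + of_real (s ^ 3 / 3))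
        \<le> norm (of_real s * (\<gamma>p \<tau>)\<^sup>2) + norm (of_real (s\<^sup>2) * \<gamma>p \<tau>) + norm (complex_of_real (s ^ 3 / 3))"
      by (rule order_trans[OF complex_Re_le_cmod]) (intro norm_triangle_le add_mono norm_triangle_ineq order_refl)
    also have "\<dots> = s * N\<^sup>2 + s\<^sup>2 * N + s ^ 3 / 3"
      unfolding norm_mult norm_power norm_of_real N_def[symmetric] using s by simp
    also have "\<dots> \<le> c * N\<^sup>2 + c\<^sup>2 * (1 + N\<^sup>2) + c ^ 3 / 3"
      using s N by (intro add_mono mult_mono divide_right_mono power_mono) auto
    finally have 1: "Re (v ^ 3 / 3) \<le> Re ((\<gamma>p \<tau>) ^ 3 / 3) + (c * N\<^sup>2 + c\<^sup>2 * (1 + N\<^sup>2) + c ^ 3 / 3)" by simp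
    have 2: "t * Re (v\<^sup>2) \<le> \<bar>t\<bar> * (2 * N\<^sup>2 + 2 * c\<^sup>2)"
    proof -
      have "\<bar>Re (v\<^sup>2)\<bar> \<le> (norm v)\<^sup>2" using abs_Re_le_cmod[of "v\<^sup>2"] by (simp add: norm_power)
      then have "\<bar>t\<bar> * \<bar>Re (v\<^sup>2)\<bar> \<le> \<bar>t\<bar> * (2 * N\<^sup>2 + 2 * c\<^sup>2)" using vN2 by (intro mult_left_mono) auto
      then show ?thesis using abs_ge_self[of "t * Re (v\<^sup>2)"] unfolding abs_mult by linarith
    qed
    have 3: "- y * Re v \<le> \<bar>y\<bar> * (1 + N\<^sup>2 + c)"
    proof -
      have "\<bar>y\<bar> * \<bar>Re v\<bar> \<le> \<bar>y\<bar> * (1 + N\<^sup>2 + c)"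
        using abs_Re_le_cmod[of v] vN N by (intro mult_left_mono) auto
      then show ?thesis using abs_ge_self[of "- y * Re v"] unfolding abs_mult abs_minus_cancel by linarith
    qed
    have "Re (v ^ 3 / 3) + t * Re (v\<^sup>2) - y * Re v \<le> (D + A0) + - \<tau>\<^sup>2 + - N\<^sup>2"
      using 1 2 3 D[of \<tau>] by (simp add: A1_def A0_def N_def algebra_simps)
    then show "norm (e (\<gamma>p \<tau> + of_real s)) \<le> exp (D + A0) * exp (- \<tau>\<^sup>2) * exp (- (norm (\<gamma>p \<tau>))\<^sup>2)"
      unfolding v_def[symmetric] N_def[symmetric] e_def norm_exp_eq_Re exp_add[symmetric] by simp
    have "norm (v\<^sup>2 + 2 * of_real t * v - of_real y) \<le> norm (v\<^sup>2) + norm (2 * of_real t * v) + norm (complex_of_real y)"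
      by (intro order_trans[OF norm_triangle_ineq4] add_mono norm_triangle_ineq order_refl)
    also have "\<dots> = (norm v)\<^sup>2 + 2 * \<bar>t\<bar> * norm v + \<bar>y\<bar>" by (simp add: norm_mult norm_power)
    also have "\<dots> \<le> (2 * N\<^sup>2 + 2 * c\<^sup>2) + 2 * \<bar>t\<bar> * (1 + N\<^sup>2 + c) + \<bar>y\<bar>"
      using vN vN2 N by (intro add_mono mult_left_mono) auto
    also have "\<dots> \<le> P * (1 + N\<^sup>2)"
    proof -
      have "0 \<le> 2 * c\<^sup>2 * N\<^sup>2 + 2 * \<bar>t\<bar> * c * N\<^sup>2 + \<bar>y\<bar> * N\<^sup>2 + 2" using c by (intro add_nonneg_nonneg) auto
      then show ?thesis by (simp add: P_def algebra_simps)
    qed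
    also have "\<dots> \<le> P * exp (N\<^sup>2)" using P by (intro mult_left_mono) auto
    finally show "norm ((\<gamma>p \<tau> + of_real s)\<^sup>2 + 2 * of_real t * (\<gamma>p \<tau> + of_real s) - of_real y) \<le> P * exp ((norm (\<gamma>p \<tau>))\<^sup>2)"
      by (simp add: v_def N_def)
  qed
  show ?thesis
  proof (rule contour_shift[OF ray c, where f' = f' and B = "exp (D + A0) * K"])
    fix \<tau> s :: real assume s: "0 \<le> s" "s \<le> c"
    let ?v = "\<gamma>p \<tau> + complex_of_real s"
    let ?N = "(norm (\<gamma>p \<tau>))\<^sup>2"
    note nzv = nz[OF s, of \<tau>]
    have "(e has_field_derivative e ?v * (?v\<^sup>2 + 2 * of_real t * ?v - of_real y)) (at ?v)"
      unfolding e_def[abs_def]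
      by (rule derivative_eq_intros refl | simp)+
    moreover have "(h has_field_derivative h' ?v) (at ?v)"
      unfolding h_def[abs_def] h'_def using nzv
      by (auto intro!: derivative_eq_intros simp: power2_eq_square)
    ultimately have "((\<lambda>w. e w * h w) has_field_derivative e ?v * (?v\<^sup>2 + 2 * of_real t * ?v - of_real y) * h ?v + h' ?v * e ?v) (at ?v)"
      by (rule DERIV_mult)
    then show "(f has_field_derivative f' ?v) (at ?v)"
      unfolding f_eq[abs_def] f'_def by (simp add: algebra_simps)
    have Nle: "exp (- ?N) \<le> 1" by simp
    have "norm (e ?v) * norm (h ?v) \<le> (exp (D + A0) * exp (- \<tau>\<^sup>2) * exp (- ?N)) * K"
      using wb[OF s, of \<tau>] K[OF s, of \<tau>] by (intro mult_mono) auto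
    also have "\<dots> \<le> (exp (D + A0) * exp (- \<tau>\<^sup>2) * 1) * K"
      using Nle order_trans[OF norm_ge_zero K[OF s, of \<tau>]] by (intro mult_right_mono mult_left_mono) auto
    finally show "norm (f ?v) \<le> exp (D + A0) * K * exp (- \<tau>\<^sup>2)"
      unfolding f_eq norm_mult by (simp add: ac_simps)
    have "norm ((?v\<^sup>2 + 2 * of_real t * ?v - of_real y) * h ?v + h' ?v) \<le> (P * exp ?N) * (2 / \<delta>) + 2 / \<delta>\<^sup>2"
      unfolding norm_mult[symmetric]
      by (rule order_trans[OF norm_triangle_ineq]) (unfold norm_mult, intro add_mono mult_mono pb hb s, use P in auto)
    also have "\<dots> \<le> (P * exp ?N) * (2 / \<delta>) + 2 / \<delta>\<^sup>2 * exp ?N"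
      using \<delta> by (intro add_left_mono mult_left_le[of _ "2 / \<delta>\<^sup>2", THEN order_trans] order_refl) (auto simp: field_simps)
    also have "\<dots> \<le> K * exp ?N" using \<delta> P by (simp add: K_def algebra_simps)
    finally have "norm (e ?v) * norm ((?v\<^sup>2 + 2 * of_real t * ?v - of_real y) * h ?v + h' ?v)
        \<le> (exp (D + A0) * exp (- \<tau>\<^sup>2) * exp (- ?N)) * (K * exp ?N)"
      using wb[OF s, of \<tau>] by (intro mult_mono) auto
    also have "\<dots> = exp (D + A0) * K * exp (- \<tau>\<^sup>2)" by (simp add: exp_minus)
    finally show "norm (f' ?v) \<le> exp (D + A0) * K * exp (- \<tau>\<^sup>2)" unfolding f'_def norm_mult .
  next
    show "f' \<in> borel_measurable borel"
      unfolding f'_def[abs_def] e_def h_def h'_def by measurable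
    show "continuous_on {0..c} (\<lambda>s. f' (\<gamma>p \<tau> + of_real s))" for \<tau>
      unfolding f'_def e_def h_def h'_def using nz by (intro continuous_intros) auto
  qed
qed

section \<open>The path-integral formula\<close>

text \<open>From \<phi>p > pi/3 and \<phi>m < pi - \<phi>p follows \<phi>m < 2 pi/3. Hence 3 \<phi>p
  lies in (pi, 3 pi/2) and 3 \<phi>m in (3 pi/2, 2 pi).\<close>

lemma airy21_cubic_signs:
  assumes "airy21_contours \<phi>p \<phi>m \<gamma>p \<gamma>m"
  shows "cos (3 * \<phi>p) < 0" "0 < cos (3 * \<phi>m)"
proof -
  have ang: "pi / 3 < \<phi>p" "\<phi>p < pi / 2" "pi / 2 < \<phi>m" "\<phi>m < pi - \<phi>p"
    using assms by (auto simp: airy21_contours_def)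
  have "0 < cos (3 * \<phi>p - pi)" using ang by (intro cos_gt_zero) auto
  then show "cos (3 * \<phi>p) < 0" by (simp add: cos_diff)
  have "0 < cos (2 * pi - 3 * \<phi>m)" using ang by (intro cos_gt_zero) auto
  then show "0 < cos (3 * \<phi>m)" by (simp add: cos_diff)
qed

lemma contour_pair_of_airy21_contours:
  assumes cont: "airy21_contours \<phi>p \<phi>m \<gamma>p \<gamma>m"
    and d: "dp \<in> borel_measurable borel" "dm \<in> borel_measurable borel"
      "\<And>u. norm (dp u) \<le> L" "\<And>u. norm (dm u) \<le> L"
    and re: "\<And>u. Re (\<gamma>m u) \<le> a" "\<And>u. b \<le> Re (\<gamma>p u)"
  shows "\<exists>\<delta>. contour_pair \<gamma>p \<gamma>m dp dm a b \<delta> L"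
proof -
  have rp: "ray_contour \<phi>p (- \<phi>p) \<gamma>p" and rm: "ray_contour (- \<phi>m) (- (- \<phi>m)) \<gamma>m"
    using cont by (auto simp: airy21_contours_def)
  obtain \<delta> where \<delta>: "0 < \<delta>" "\<And>\<sigma> \<tau>. \<delta> \<le> norm (\<gamma>m \<sigma> - \<gamma>p \<tau>)" "\<And>\<sigma> \<tau>. \<delta> \<le> norm (\<gamma>m \<sigma> + \<gamma>p \<tau>)"
    using airy21_contours_separated[OF cont] by blast
  have "\<exists>C. \<forall>u. Re ((\<gamma>p u) ^ 3 / 3) + A * (norm (\<gamma>p u))\<^sup>2 + u\<^sup>2 \<le> C" for A
    using ray_contour_cubic_decay[OF rp, of 1 A] airy21_cubic_signs[OF cont] by simp
  moreover have "\<exists>C. \<forall>u. - Re ((\<gamma>m u) ^ 3 / 3) + A * (norm (\<gamma>m u))\<^sup>2 + u\<^sup>2 \<le> C" for A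
    using ray_contour_cubic_decay[OF rm, of "- 1" A] airy21_cubic_signs[OF cont] by simp
  ultimately have "contour_pair \<gamma>p \<gamma>m dp dm a b \<delta> L"
    using d re \<delta> ray_contour_continuous[OF rp] ray_contour_continuous[OF rm]
    by unfold_locales (auto intro: borel_measurable_continuous_onI)
  then show ?thesis by blast
qed

lemma ray_contour_Re_bounds:
  assumes "ray_contour \<alpha> (- \<alpha>) \<gamma>"
  shows "0 \<le> cos \<alpha> \<Longrightarrow> \<exists>C. \<forall>u. C \<le> Re (\<gamma> u)" and "cos \<alpha> \<le> 0 \<Longrightarrow> \<exists>C. \<forall>u. Re (\<gamma> u) \<le> C"
proof -
  obtain C where C: "\<And>u. norm (\<gamma> u - of_real \<bar>u\<bar> * cis (if u < 0 then \<alpha> else - \<alpha>)) \<le> C"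
    using ray_contour_asymp[OF assms] by blast
  have R: "\<bar>Re (\<gamma> u) - \<bar>u\<bar> * cos \<alpha>\<bar> \<le> C" for u
    using order_trans[OF abs_Re_le_cmod C[of u]] by (auto split: if_splits)
  show "\<exists>C. \<forall>u. C \<le> Re (\<gamma> u)" if "0 \<le> cos \<alpha>"
  proof (intro exI allI)
    fix u
    have "0 \<le> \<bar>u\<bar> * cos \<alpha>" using that by simp
    then show "- C \<le> Re (\<gamma> u)" using R[of u] by linarith
  qed
  show "\<exists>C. \<forall>u. Re (\<gamma> u) \<le> C" if "cos \<alpha> \<le> 0"
  proof (intro exI allI)
    fix u
    have "\<bar>u\<bar> * cos \<alpha> \<le> 0" using that by (simp add: mult_nonneg_nonpos)
    then show "Re (\<gamma> u) \<le> C" using R[of u] by linarith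
  qed
qed

text \<open>The integral over z is already the inner one, so no interchange occurs: the exponential
  in w leaves it, the prefactor is stored in \<open>Hk\<close>, and the inner integral is
  \<open>kk\<close>.\<close>

lemma (in contour_pair) double_contour_integral:
  "1 / (2 * of_real pi * \<i>)\<^sup>2 * (\<integral>\<tau>. (\<integral>\<sigma>. exp ((w \<tau>) ^ 3 / 3 + of_real t * (w \<tau>)\<^sup>2 - of_real y * w \<tau>)
      / exp ((z \<sigma>) ^ 3 / 3 + of_real s * (z \<sigma>)\<^sup>2 - of_real x * z \<sigma>)
      * (2 * w \<tau> / ((z \<sigma> - w \<tau>) * (z \<sigma> + w \<tau>))) * dz \<sigma> \<partial>lborel) * dw \<tau> \<partial>lborel)
   = kcomp lborel (kk s) (Rk t) x y"
proof -
  let ?c = "1 / (2 * of_real pi * \<i>)\<^sup>2 :: complex"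
  have "?c * ((\<integral>\<sigma>. exp ((w \<tau>) ^ 3 / 3 + of_real t * (w \<tau>)\<^sup>2 - of_real y * w \<tau>)
      / exp ((z \<sigma>) ^ 3 / 3 + of_real s * (z \<sigma>)\<^sup>2 - of_real x * z \<sigma>)
      * (2 * w \<tau> / ((z \<sigma> - w \<tau>) * (z \<sigma> + w \<tau>))) * dz \<sigma> \<partial>lborel) * dw \<tau>) = kk s x \<tau> * Rk t \<tau> y" for \<tau>
  proof -
    let ?e = "exp ((w \<tau>) ^ 3 / 3 + of_real t * (w \<tau>)\<^sup>2 - of_real y * w \<tau>)"
    have "?c * (?e / exp ((z \<sigma>) ^ 3 / 3 + of_real s * (z \<sigma>)\<^sup>2 - of_real x * z \<sigma>)
      * (2 * w \<tau> / ((z \<sigma> - w \<tau>) * (z \<sigma> + w \<tau>))) * dz \<sigma>) = ?e * (Zk s x \<sigma> * Hk \<sigma> \<tau>)" for \<sigma>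
    proof -
      have nz: "z \<sigma> - w \<tau> \<noteq> 0" "z \<sigma> + w \<tau> \<noteq> 0" using zw_minus[of \<sigma> \<tau>] zw_plus[of \<sigma> \<tau>] \<delta> by auto
      then have "2 * w \<tau> / ((z \<sigma> - w \<tau>) * (z \<sigma> + w \<tau>)) = 1 / (z \<sigma> - w \<tau>) - 1 / (z \<sigma> + w \<tau>)"
        by (subst diff_frac_eq) auto
      moreover have "inverse (exp ((z \<sigma>) ^ 3 / 3 + of_real s * (z \<sigma>)\<^sup>2 - of_real x * z \<sigma>))
          = exp (- ((z \<sigma>) ^ 3 / 3) - of_real s * (z \<sigma>)\<^sup>2 + of_real x * z \<sigma>)"
        unfolding exp_minus[symmetric] by (rule arg_cong[of _ _ exp]) simp
      ultimately show ?thesis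
        unfolding Zk_def Hk_def divide_inverse[of ?e] by (simp only: ac_simps)
    qed
    then have "?c * (\<integral>\<sigma>. ?e / exp ((z \<sigma>) ^ 3 / 3 + of_real s * (z \<sigma>)\<^sup>2 - of_real x * z \<sigma>)
        * (2 * w \<tau> / ((z \<sigma> - w \<tau>) * (z \<sigma> + w \<tau>))) * dz \<sigma> \<partial>lborel) = ?e * kk s x \<tau>"
      unfolding kk_def kcomp_def integral_mult_right_zero[symmetric] by (simp only:)
    then show ?thesis
      unfolding Rk_def mult.assoc[symmetric] by (simp only: ac_simps)
  qed
  then show ?thesis
    unfolding kcomp_def integral_mult_right_zero[symmetric] by (simp only:)
qed

theorem corollary4p8:
  fixes M :: "'a measure" and X :: "real \<Rightarrow> 'a \<Rightarrow> real"
    and \<phi>p \<phi>m :: real and \<gamma>p \<gamma>m :: "real \<Rightarrow> complex"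
    and n :: nat and t x :: "nat \<Rightarrow> real"
  assumes "airy21_contours \<phi>p \<phi>m \<gamma>p \<gamma>m"
    and "airy21_process \<gamma>p \<gamma>m M X"
    and "1 \<le> n" and "strict_mono_on {1..n} t"
  shows "fredholm_convergent lborel (path_kernel \<gamma>p \<gamma>m t x n) \<and>
         complex_of_real (measure M {\<omega> \<in> space M. \<forall>k\<in>{1..n}. X (t k) \<omega> \<le> x k})
         = fredholm_det lborel (path_kernel \<gamma>p \<gamma>m t x n)"
proof -
  note cont = assms(1)
  have rp: "ray_contour \<phi>p (- \<phi>p) \<gamma>p" and rm: "ray_contour (- \<phi>m) (- (- \<phi>m)) \<gamma>m"
    and ang: "0 < \<phi>p" "\<phi>p < pi / 2" "pi / 2 < \<phi>m" "\<phi>m < pi"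
    and lft: "left_of \<gamma>m \<gamma>p" "left_of (\<lambda>u. - \<gamma>p u) \<gamma>m"
    using cont pi_gt_zero by (auto simp: airy21_contours_def)
  have "0 < cos \<phi>p" "cos (- \<phi>m) < 0"
    using ang cos_gt_zero[of \<phi>p] cos_lt_zero_pi[of \<phi>m] by auto
  then obtain b0 a where b0: "\<And>u. b0 \<le> Re (\<gamma>p u)" and a: "\<And>u. Re (\<gamma>m u) \<le> a"
    using ray_contour_Re_bounds[OF rp] ray_contour_Re_bounds[OF rm] by (meson less_imp_le)
  \<comment> \<open>The least translation to the right for which every point of the right contour
    has real part at least \<open>a + 1\<close>, as far as the bound \<open>b0\<close>
    shows.\<close>
  define c where "c = max 0 (a - b0 + 1)"
  have c: "0 \<le> c" "a < b0 + c" by (auto simp: c_def)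
  define dp dm where "dp u = vector_derivative \<gamma>p (at u)" and "dm u = vector_derivative \<gamma>m (at u)" for u
  have dmeas: "dp \<in> borel_measurable borel" "dm \<in> borel_measurable borel"
    using ray_contour_speed(2)[OF rp] ray_contour_speed(2)[OF rm] by (simp_all add: dp_def[abs_def] dm_def[abs_def])
  obtain L1 L2 where L12: "\<And>u. norm (dp u) \<le> L1" "\<And>u. norm (dm u) \<le> L2"
    using ray_contour_speed(1)[OF rp] ray_contour_speed(1)[OF rm] by (auto simp: dp_def dm_def)
  define L where "L = max L1 L2"
  have L: "norm (dp u) \<le> L" "norm (dm u) \<le> L" for u
    using L12[of u] by (auto simp: L_def)
  define \<gamma>c where "\<gamma>c u = \<gamma>p u + complex_of_real c" for u
  have cont_c: "airy21_contours \<phi>p \<phi>m \<gamma>c \<gamma>m"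
    using airy21_contours_shift[OF cont c(1)] by (simp add: \<gamma>c_def[abs_def])
  obtain \<delta>0 where "contour_pair \<gamma>p \<gamma>m dp dm a b0 \<delta>0 L"
    using contour_pair_of_airy21_contours[OF cont dmeas L a b0] by blast
  then interpret P: contour_pair \<gamma>p \<gamma>m dp dm a b0 \<delta>0 L .
  have bc: "b0 + c \<le> Re (\<gamma>c u)" for u using b0[of u] by (simp add: \<gamma>c_def)
  \<comment> \<open>A translation does not change the velocity, so \<open>dp\<close> serves the
    translated contour as well.\<close>
  obtain \<delta> where "contour_pair \<gamma>c \<gamma>m dp dm a (b0 + c) \<delta> L"
    using contour_pair_of_airy21_contours[OF cont_c dmeas L a bc] by blast
  then interpret C: path_setup \<gamma>c \<gamma>m dp dm a "b0 + c" \<delta> L n t x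
    by (intro path_setup.intro path_setup_axioms.intro c(2) assms(3,4))
  \<comment> \<open>The contour moves for each fixed z. At the height of a point w of the right
    contour, both z and -z lie to the left of w if they occur at that height, by the two ordering
    conditions, so the translation meets neither pole.\<close>
  have shift: "kcomp lborel P.Hk (P.Rk r) \<sigma> v = kcomp lborel C.Hk (C.Rk r) \<sigma> v" for r \<sigma> v
  proof -
    let ?f = "\<lambda>w. exp (w ^ 3 / 3 + of_real r * w\<^sup>2 - of_real v * w) * (1 / (\<gamma>m \<sigma> - w) - 1 / (\<gamma>m \<sigma> + w))"
    have "(\<integral>\<tau>. ?f (\<gamma>p \<tau> + of_real c) * vector_derivative \<gamma>p (at \<tau>) \<partial>lborel) = (\<integral>\<tau>. ?f (\<gamma>p \<tau>) * vector_derivative \<gamma>p (at \<tau>) \<partial>lborel)"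
    proof (rule contour_shift_kernel[OF rp airy21_cubic_signs(1)[OF cont] c(1)])
      fix \<tau> s :: real assume s: "0 \<le> s" "s \<le> c"
      show "\<gamma>m \<sigma> - (\<gamma>p \<tau> + complex_of_real s) \<noteq> 0 \<and> \<gamma>m \<sigma> + (\<gamma>p \<tau> + complex_of_real s) \<noteq> 0"
        using lft(1)[unfolded left_of_def, rule_format, of \<sigma> \<tau>] lft(2)[unfolded left_of_def, rule_format, of \<tau> \<sigma>] s
        by (auto simp: complex_eq_iff)
    qed
    then have "(1 / (2 * of_real pi * \<i>)\<^sup>2) * (\<integral>\<tau>. ?f (\<gamma>c \<tau>) * dp \<tau> \<partial>lborel) = (1 / (2 * of_real pi * \<i>)\<^sup>2) * (\<integral>\<tau>. ?f (\<gamma>p \<tau>) * dp \<tau> \<partial>lborel)"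
      by (simp only: \<gamma>c_def dp_def)
    then show ?thesis
      unfolding kcomp_def P.Hk_def P.Rk_def C.Hk_def C.Rk_def integral_mult_right_zero[symmetric]
      by (simp only: ac_simps)
  qed
  \<comment> \<open>Associativity brings \<open>Hk\<close> and \<open>Rk\<close> together so that
    the translation applies; \<open>Zk\<close> does not involve w.\<close>
  have kR: "kcomp lborel (P.kk r) (P.Rk r') u v = kcomp lborel (C.kk r) (C.Rk r') u v" for r r' u v
  proof -
    have "kcomp lborel (P.kk r) (P.Rk r') u v = kcomp lborel (P.Zk r) (kcomp lborel P.Hk (P.Rk r')) u v"
      unfolding P.kk_def
      by (rule weighted_space.kcomp_assoc[OF P.weighted_mid P.weighted_Y P.kern_Z[of 1] P.kern_H P.kern_R[of 1]]) auto
    also have "\<dots> = kcomp lborel (C.Zk r) (kcomp lborel C.Hk (C.Rk r')) u v"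
      by (rule kcomp_cong) (simp_all add: shift)
    also have "\<dots> = kcomp lborel (C.kk r) (C.Rk r') u v"
      unfolding C.kk_def
      by (rule weighted_space.kcomp_assoc[OF C.weighted_mid C.weighted_Y C.kern_Z[of 1] C.kern_H C.kern_R[of 1], symmetric]) auto
    finally show ?thesis .
  qed
  have K: "K21_ext \<gamma>p \<gamma>m r u r' v = - complex_of_real (if r' > r then heat_kernel (r' - r) (u - neg_sq r) (v - neg_sq r') else 0)
      + kcomp lborel (C.kk r) (C.Rk r') (u - neg_sq r) (v - neg_sq r')" for r u r' v
    using P.double_contour_integral[where s = r and t = r' and x = "u - neg_sq r" and y = "v - neg_sq r'"]
      kR[of r r' "u - neg_sq r" "v - neg_sq r'"]
    by (simp only: K21_ext_def Let_def line_integral_def dp_def dm_def)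
  have lev: "C.lev = (\<lambda>i. x i - neg_sq (t i))" by (intro ext) (simp add: C.lev_def)
  have path: "path_kernel \<gamma>p \<gamma>m t x n = kcomp lborel C.Pt (C.Rk (t 1))"
  proof (intro ext)
    fix u v
    \<comment> \<open>In both time pairs, (t_1, t_1) and (t_n, t_1), the second time is not larger,
      so no heat term enters and both kernels are plain compositions of k and R.\<close>
    have "\<not> t 1 > t n" using C.t_le[of n] assms(3) by simp
    then show "path_kernel \<gamma>p \<gamma>m t x n u v = kcomp lborel C.Pt (C.Rk (t 1)) u v"
      unfolding C.Pt_R path_kernel_def K21_shifted_def K lev by simp
  qed
  have chi: "chi_K21_ext \<gamma>p \<gamma>m t x p q = C.AX n p q" if p: "p \<in> space C.XS" and q: "q \<in> space C.XS" for p q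
  proof -
    obtain i u j v where pq: "p = (i, u)" "q = (j, v)" and ij: "i \<in> {1..n}" "j \<in> {1..n}"
      using p q by (auto simp: C.XS_def space_pair_measure)
    have ge: "u - neg_sq (t i) \<in> {C.lev i..} \<longleftrightarrow> x i \<le> u" by (simp add: C.lev_def)
    have "kcomp lborel C.kX C.RX p q = (if x i \<le> u then kcomp lborel (C.kk (t i)) (C.Rk (t j)) (u - neg_sq (t i)) (v - neg_sq (t j)) else 0)"
      by (simp add: kcomp_def C.kX_def C.RX_def C.kcut_def pq ge del: atLeast_iff)
    moreover have "C.NX p q = (if x i \<le> u then - complex_of_real (if t i < t j then heat_kernel (t j - t i) (u - neg_sq (t i)) (v - neg_sq (t j)) else 0) else 0)"
      using C.t_less_iff[OF ij] by (simp add: C.NX_def C.Nb_def pq ge heat_ker_def del: atLeast_iff)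
    ultimately show ?thesis
      using ij by (simp add: C.AX_def chi_K21_ext_def K pq)
  qed
  have "complex_of_real (measure M {\<omega> \<in> space M. \<forall>k\<in>{1..n}. X (t k) \<omega> \<le> x k})
      = fredholm_det C.XS (chi_K21_ext \<gamma>p \<gamma>m t x)"
    using assms(2-4) unfolding airy21_process_def C.XS_def by blast
  also have "\<dots> = fredholm_det C.XS (C.AX n)"
    by (rule fredholm_det_cong[OF C.weighted_X chi])
  also have "\<dots> = fredholm_det lborel (path_kernel \<gamma>p \<gamma>m t x n)"
    unfolding path by (rule C.fredholm_det_path)
  finally show ?thesis
    using C.fredholm_convergent_path unfolding path by blast
qed

end
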